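(* Let $\mathcal{C}$ be one of the following: (a) the class of sofic groups; (b) the class of $\mathbb{K}$-linear sofic groups, for $\mathbb{K}$ a field; (c) the class of hyperlinear groups; (d) the class of weakly sofic groups. Let $\Gamma,\Delta\in\mathcal{C}$, and let $\beta:\Gamma\curvearrowright\Delta$ be a sofic $\mathcal{C}$-action by automorphisms. Then $\Delta\rtimes_{\beta}\Gamma\in\mathcal{C}$.
   Context: Metric approximation. For a group $\Gamma$, a group $G$ with bounded bi-invariant metric $d$, a function $\varphi:\Gamma\to G$, finite $F\subseteq\Gamma$ and $\epsilon,c>0$: $\varphi$ is $(F,\epsilon)$-multiplicative if $d(\varphi(gh),\varphi(g)\varphi(h))<\epsilon$ for all $g,h\in F$ with $gh\in F$; $(F,c)$-separating if $d(\varphi(g),e_G)>c$ for all $e\neq g\in F$; unital if $\varphi(e_\Gamma)=e_G$. Given a family $\mathcal{G}$ of groups with bi-invariant metrics of uniformly bounded diameter, $\Gamma$ is $\mathcal{G}$-approximable if there is $c>0$ such that for all finite $F\subseteq\Gamma$ and $\epsilon>0$ there is a unital, $(F,\epsilon)$-multiplicative, $(F,c)$-separating function from $\Gamma$ to some member of $\mathcal{G}$. Then $\Gamma$ is: sofic if $\mathcal{G}=\{(\operatorname{Sym}(n),d_n):n\in\mathbb{N}\}$ with $d_n$ the normalized Hamming metric; $\mathbb{K}$-linear sofic ($\mathbb{K}$ a field) if $\mathcal{G}=\{GL_n(\mathbb{K}):n\in\mathbb{N}\}$ with metric $\frac1n\operatorname{rk}(M-N)$; hyperlinear if $\mathcal{G}=\{U(n):n\in\mathbb{N}\}$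 (unitary groups) with metric $\sqrt{\frac1n\operatorname{Tr}((A-B)(A-B)^* )}$; weakly sofic if $\mathcal{G}$ is the family of all finite groups equipped with bi-invariant metrics of diameter one. Normalized Hamming metric on $\operatorname{Sym}(A)$, $A$ finite: $d_A(\sigma,\tau)=1-\frac{1}{|A|}|\{a\in A:\sigma(a)=\tau(a)\}|$. Sofic actions on groups. A partial homomorphism from a subset $E$ of a group to a group $\Lambda$ is a function $\pi$ with $\pi(gh)=\pi(g)\pi(h)$ whenever $g,h,gh\in E$. Given a homomorphism $\alpha:\Gamma\to\operatorname{Aut}(\Delta)$, finite $F\subseteq\Gamma$, $E\subseteq\Delta$, $\epsilon>0$ and a group $\Lambda$, a function $\varphi:\Gamma\to\operatorname{Sym}(A)$ ($A$ finite) is an $(F,E,\epsilon,\Lambda)$-automorphic approximation of $\alpha$ if there exist $S\subseteq A$ with $|S|>(1-\epsilon)|A|$ and injective partial homomorphisms $(\pi_s:E\to\Lambda)_{s\in S}$ such that for all $g\in F$, $h\in E$, $s\in S$, if $\varphi(g)\cdot s\in S$ and $\alpha(g)^{-1}[h]\in E$ then $\pi_{\varphi(g)\cdot s}(h)=\pi_s(\alpha(g)^{-1}[h])$. For a class $\mathcal{C}$ of groups, $\alpha$ is a sofic $\mathcal{C}$-action if for all finite $F\subseteq\Gamma$, $E\subseteq\Delta$ and $\epsilon>0$ there exist $\Lambda\in\mathcal{C}$, a finite set $A$ and a unital $(F,\epsilon)$-multiplicative (with respect to $d_A$) $(F,E,\epsilon,\Lambda)$-automorphic approximation $\varphi:\Gamma\to\operatorname{Sym}(A)$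 of $\alpha$. *)

theory Defs
  imports
    "HOL-Algebra.Bij"
    "HOL-Analysis.Abstract_Metric_Spaces"
    "Jordan_Normal_Form.DL_Rank"
    "Jordan_Normal_Form.Schur_Decomposition"
begin

section \<open>Metric approximation of groups\<close>

definition eps_multiplicative ::
  "('a, 'm) monoid_scheme \<Rightarrow> ('b, 'n) monoid_scheme \<Rightarrow> ('b \<Rightarrow> 'b \<Rightarrow> real)
    \<Rightarrow> 'a set \<Rightarrow> real \<Rightarrow> ('a \<Rightarrow> 'b) \<Rightarrow> bool" where
  "eps_multiplicative \<Gamma> G d F \<epsilon> \<phi> \<longleftrightarrow>
    (\<forall>g\<in>F. \<forall>h\<in>F. g \<otimes>\<^bsub>\<Gamma>\<^esub> h \<in> F \<longrightarrow> d (\<phi> (g \<otimes>\<^bsub>\<Gamma>\<^esub> h)) (\<phi> g \<otimes>\<^bsub>G\<^esub> \<phi> h) < \<epsilon>)"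

definition separating ::
  "('a, 'm) monoid_scheme \<Rightarrow> ('b, 'n) monoid_scheme \<Rightarrow> ('b \<Rightarrow> 'b \<Rightarrow> real)
    \<Rightarrow> 'a set \<Rightarrow> real \<Rightarrow> ('a \<Rightarrow> 'b) \<Rightarrow> bool" where
  "separating \<Gamma> G d F c \<phi> \<longleftrightarrow> (\<forall>g\<in>F. g \<noteq> \<one>\<^bsub>\<Gamma>\<^esub> \<longrightarrow> d (\<phi> g) \<one>\<^bsub>G\<^esub> > c)"

definition unital ::
  "('a, 'm) monoid_scheme \<Rightarrow> ('b, 'n) monoid_scheme \<Rightarrow> ('a \<Rightarrow> 'b) \<Rightarrow> bool" where
  "unital \<Gamma> G \<phi> \<longleftrightarrow> \<phi> \<one>\<^bsub>\<Gamma>\<^esub> = \<one>\<^bsub>G\<^esub>"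

text \<open>The constant \<open>c\<close> is chosen before \<open>F\<close> and \<open>\<epsilon>\<close>.\<close>

definition approximable ::
  "('b monoid \<times> ('b \<Rightarrow> 'b \<Rightarrow> real)) set \<Rightarrow> ('a, 'm) monoid_scheme \<Rightarrow> bool" where
  "approximable \<G> \<Gamma> \<longleftrightarrow> group \<Gamma> \<and>
    (\<exists>c>0. \<forall>F \<epsilon>. finite F \<and> F \<subseteq> carrier \<Gamma> \<and> \<epsilon> > 0 \<longrightarrow>
      (\<exists>(G, d)\<in>\<G>. \<exists>\<phi>\<in>carrier \<Gamma> \<rightarrow> carrier G.
        unital \<Gamma> G \<phi> \<and> eps_multiplicative \<Gamma> G d F \<epsilon> \<phi> \<and> separating \<Gamma> G d F c \<phi>))"

section \<open>Sofic, linear sofic, hyperlinear and weakly sofic groups\<close>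

definition hamming :: "'x set \<Rightarrow> ('x \<Rightarrow> 'x) \<Rightarrow> ('x \<Rightarrow> 'x) \<Rightarrow> real" where
  "hamming A \<sigma> \<tau> = 1 - real (card {a \<in> A. \<sigma> a = \<tau> a}) / real (card A)"

text \<open>
  In the families indexed by \<open>n\<close> the index is positive, since the normalized
  metrics are not defined for \<open>n = 0\<close>.
\<close>

definition sofic_group :: "('a, 'm) monoid_scheme \<Rightarrow> bool" where
  "sofic_group \<Gamma> \<longleftrightarrow>
    approximable {(BijGroup {..<n}, hamming {..<n}) | n :: nat. n > 0} \<Gamma>"

definition GL :: "'k::field itself \<Rightarrow> nat \<Rightarrow> 'k mat monoid" where
  "GL ty n = units_of (ring_mat ty n ())"

definition rank_dist :: "nat \<Rightarrow> 'k::field mat \<Rightarrow> 'k mat \<Rightarrow> real" where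
  "rank_dist n M N = real (vec_space.rank n (M - N)) / real n"

definition linear_sofic_group :: "'k::field itself \<Rightarrow> ('a, 'm) monoid_scheme \<Rightarrow> bool" where
  "linear_sofic_group ty \<Gamma> \<longleftrightarrow> approximable {(GL ty n, rank_dist n) | n. n > 0} \<Gamma>"

definition unitary_group :: "nat \<Rightarrow> complex mat monoid" where
  "unitary_group n =
    (GL TYPE(complex) n)\<lparr>carrier :=
      {U \<in> carrier_mat n n. U * mat_adjoint U = 1\<^sub>m n \<and> mat_adjoint U * U = 1\<^sub>m n}\<rparr>"

definition mat_trace :: "'k::comm_monoid_add mat \<Rightarrow> 'k" where
  "mat_trace A = sum_list (diag_mat A)"

text \<open>The trace below is a nonnegative real number, so taking \<open>Re\<close> only changes its type.\<close>

definition hs_dist :: "nat \<Rightarrow> complex mat \<Rightarrow> complex mat \<Rightarrow> real" where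
  "hs_dist n A B = sqrt (Re (mat_trace ((A - B) * mat_adjoint (A - B))) / real n)"

definition hyperlinear_group :: "('a, 'm) monoid_scheme \<Rightarrow> bool" where
  "hyperlinear_group \<Gamma> \<longleftrightarrow> approximable {(unitary_group n, hs_dist n) | n. n > 0} \<Gamma>"

definition biinvariant_metric :: "('b, 'n) monoid_scheme \<Rightarrow> ('b \<Rightarrow> 'b \<Rightarrow> real) \<Rightarrow> bool" where
  "biinvariant_metric G d \<longleftrightarrow> Metric_space (carrier G) d \<and>
    (\<forall>x\<in>carrier G. \<forall>y\<in>carrier G. \<forall>z\<in>carrier G.
      d (z \<otimes>\<^bsub>G\<^esub> x) (z \<otimes>\<^bsub>G\<^esub> y) = d x y \<and> d (x \<otimes>\<^bsub>G\<^esub> z) (y \<otimes>\<^bsub>G\<^esub> z) = d x y)"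

text \<open>
  Every finite group is isomorphic to one whose elements are natural numbers, so
  the groups below represent all finite groups.
\<close>

definition weakly_sofic_group :: "('a, 'm) monoid_scheme \<Rightarrow> bool" where
  "weakly_sofic_group \<Gamma> \<longleftrightarrow>
    approximable {(G :: nat monoid, d). group G \<and> finite (carrier G) \<and> biinvariant_metric G d \<and>
      (SUP (x, y) \<in> carrier G \<times> carrier G. d x y) = 1} \<Gamma>"

section \<open>Sofic actions on groups\<close>

definition partial_hom ::
  "('d, 'm) monoid_scheme \<Rightarrow> ('l, 'n) monoid_scheme \<Rightarrow> 'd set \<Rightarrow> ('d \<Rightarrow> 'l) \<Rightarrow> bool" where
  "partial_hom \<Delta> \<Lambda> E \<pi> \<longleftrightarrow> \<pi> \<in> E \<rightarrow> carrier \<Lambda> \<and>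
    (\<forall>g\<in>E. \<forall>h\<in>E. g \<otimes>\<^bsub>\<Delta>\<^esub> h \<in> E \<longrightarrow> \<pi> (g \<otimes>\<^bsub>\<Delta>\<^esub> h) = \<pi> g \<otimes>\<^bsub>\<Lambda>\<^esub> \<pi> h)"

definition automorphic_approximation ::
  "('g, 'm) monoid_scheme \<Rightarrow> ('d, 'n) monoid_scheme \<Rightarrow> ('g \<Rightarrow> 'd \<Rightarrow> 'd)
    \<Rightarrow> 'g set \<Rightarrow> 'd set \<Rightarrow> real \<Rightarrow> ('l, 'o) monoid_scheme \<Rightarrow> 'x set \<Rightarrow> ('g \<Rightarrow> 'x \<Rightarrow> 'x) \<Rightarrow> bool" where
  "automorphic_approximation \<Gamma> \<Delta> \<alpha> F E \<epsilon> \<Lambda> A \<phi> \<longleftrightarrow>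
    \<phi> \<in> carrier \<Gamma> \<rightarrow> carrier (BijGroup A) \<and>
    (\<exists>S \<pi>. S \<subseteq> A \<and> real (card S) > (1 - \<epsilon>) * real (card A) \<and>
      (\<forall>s\<in>S. partial_hom \<Delta> \<Lambda> E (\<pi> s) \<and> inj_on (\<pi> s) E) \<and>
      (\<forall>g\<in>F. \<forall>h\<in>E. \<forall>s\<in>S.
        \<phi> g s \<in> S \<and> (inv\<^bsub>AutoGroup \<Delta>\<^esub> \<alpha> g) h \<in> E \<longrightarrow>
        \<pi> (\<phi> g s) h = \<pi> s ((inv\<^bsub>AutoGroup \<Delta>\<^esub> \<alpha> g) h)))"

text \<open>
  The class \<open>C\<close> is a predicate on groups with elements in a type \<open>'l\<close>; a theorem that
  assumes \<open>sofic_action C \<Gamma> \<Delta> \<alpha>\<close> with \<open>'l\<close> a type variable covers groups \<open>\<Lambda>\<close> over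
  any type. The finite sets \<open>A\<close> are taken, up to bijection, among sets of natural numbers.
\<close>

definition sofic_action ::
  "('l monoid \<Rightarrow> bool) \<Rightarrow> ('g, 'm) monoid_scheme \<Rightarrow> ('d, 'n) monoid_scheme
    \<Rightarrow> ('g \<Rightarrow> 'd \<Rightarrow> 'd) \<Rightarrow> bool" where
  "sofic_action C \<Gamma> \<Delta> \<alpha> \<longleftrightarrow> \<alpha> \<in> hom \<Gamma> (AutoGroup \<Delta>) \<and>
    (\<forall>F E \<epsilon>. finite F \<and> F \<subseteq> carrier \<Gamma> \<and> finite E \<and> E \<subseteq> carrier \<Delta> \<and> \<epsilon> > 0 \<longrightarrow>
      (\<exists>\<Lambda> (A :: nat set) \<phi>. C \<Lambda> \<and> finite A \<and>
        unital \<Gamma> (BijGroup A) \<phi> \<and>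
        eps_multiplicative \<Gamma> (BijGroup A) (hamming A) F \<epsilon> \<phi> \<and>
        automorphic_approximation \<Gamma> \<Delta> \<alpha> F E \<epsilon> \<Lambda> A \<phi>))"

definition semidirect_product ::
  "('d, 'm) monoid_scheme \<Rightarrow> ('g, 'n) monoid_scheme \<Rightarrow> ('g \<Rightarrow> 'd \<Rightarrow> 'd) \<Rightarrow> ('d \<times> 'g) monoid" where
  "semidirect_product \<Delta> \<Gamma> \<beta> =
    \<lparr>carrier = carrier \<Delta> \<times> carrier \<Gamma>,
     monoid.mult = (\<lambda>(h, g) (h', g'). (h \<otimes>\<^bsub>\<Delta>\<^esub> \<beta> g h', g \<otimes>\<^bsub>\<Gamma>\<^esub> g')),
     one = (\<one>\<^bsub>\<Delta>\<^esub>, \<one>\<^bsub>\<Gamma>\<^esub>)\<rparr>"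

end

(*
  An approximation phi : Gamma -> Sym(A) of the action, with partial homomorphisms pi_s : Delta -> Lambda,
  and an approximation psi : Lambda -> G combine to a map from the semidirect product to the wreath
  product of G with Sym(A): the pair (h, g) goes to the permutation phi(g) with the label
  psi(pi_{phi(g) a}(h)) at a. The equivariance of the pi_s makes it almost multiplicative. It separates
  (h, 1) from the unit when h is not 1; for g not 1 one pairs it with an approximation theta(g) of Gamma.
  Hence a class given by a family of metric groups has the permanence property as soon as the family
  contains, up to controlled maps, products of two members, wreath products with symmetric groups, and
  amplifications. The latter make the separation constant independent of Lambda and are needed since
  that constant may depend on the approximated group.

  For the indexed families the amplification is x -> (x + 1 + 1 + 1)^{(x) k}, a tensor power of a direct sum.
  For symmetric and unitary groups it works because the normalized trace is multiplicative, for GL_n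
  because Frobenius' rank inequality bounds the rank of x (x) y - 1 from below. For finite groups with
  bi-invariant metrics one replaces d by min(d / c, 1).
*)

theory Submission
  imports Defs
begin

section \<open>Semidirect products\<close>

text \<open>The order of choices shapes the axioms of \<open>permanence_family\<close>. The group
  Lambda is known only after the tolerance of the action has been fixed, and the member of the
  family that approximates Lambda only after that; hence every tolerance \<delta> is chosen before
  the members to which it is applied.

  A plain tensor product does not preserve separation: (-1) (x) (-1) = 1, although -1 is far from 1.
  Two elements are therefore joined as the direct sum of x (x) 1 and 1 (x) y. In the amplification
  the three units turn a normalized trace z into (3 + z) / 4, whose modulus is at least 1/2 and
  stays below 1 unless z is near 1. For ranks they confine the normalized distance to at most 1/4,
  the side of 1/2 on which tensoring does not decrease it.

  Over a general field there is no inner product to compute ranks with. They are controlled by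
  families of vectors that are dual for the form x^T M y: such families bound the rank from below,
  expansions into rank-one matrices bound it from above, and a maximal dual family provides
  both.\<close>

lemma auto_hom_facts:
  assumes "group \<Gamma>" "group \<Delta>" and b: "\<beta> \<in> hom \<Gamma> (AutoGroup \<Delta>)"
  shows "g \<in> carrier \<Gamma> \<Longrightarrow> h \<in> carrier \<Delta> \<Longrightarrow> \<beta> g h \<in> carrier \<Delta>"
    and "g \<in> carrier \<Gamma> \<Longrightarrow> h \<in> carrier \<Delta> \<Longrightarrow> h' \<in> carrier \<Delta> \<Longrightarrow>
          \<beta> g (h \<otimes>\<^bsub>\<Delta>\<^esub> h') = \<beta> g h \<otimes>\<^bsub>\<Delta>\<^esub> \<beta> g h'"
    and "g \<in> carrier \<Gamma> \<Longrightarrow> g' \<in> carrier \<Gamma> \<Longrightarrow> h \<in> carrier \<Delta> \<Longrightarrow>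
          \<beta> (g \<otimes>\<^bsub>\<Gamma>\<^esub> g') h = \<beta> g (\<beta> g' h)"
    and "h \<in> carrier \<Delta> \<Longrightarrow> \<beta> \<one>\<^bsub>\<Gamma>\<^esub> h = h"
    and "g \<in> carrier \<Gamma> \<Longrightarrow> h \<in> carrier \<Delta> \<Longrightarrow> (inv\<^bsub>AutoGroup \<Delta>\<^esub> \<beta> g) (\<beta> g h) = h"
proof -
  interpret G: group \<Gamma> by fact
  interpret D: group \<Delta> by fact
  interpret A: group "AutoGroup \<Delta>" by (rule D.AutoGroup)
  have c: "\<beta> g \<in> hom \<Delta> \<Delta>" "\<beta> g \<in> Bij (carrier \<Delta>)" "\<beta> g \<in> carrier (AutoGroup \<Delta>)"
    if "g \<in> carrier \<Gamma>" for g
    using b that by (auto simp: hom_def AutoGroup_def auto_def)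
  \<comment> \<open>The operations of \<open>AutoGroup\<close> are restricted to the carrier, so
    products and the unit can be evaluated only at elements of \<open>\<Delta>\<close>.\<close>
  have m: "(x \<otimes>\<^bsub>AutoGroup \<Delta>\<^esub> y) h = x (y h)"
    if "x \<in> carrier (AutoGroup \<Delta>)" "y \<in> carrier (AutoGroup \<Delta>)" "h \<in> carrier \<Delta>" for x y h
    using that by (simp add: AutoGroup_def BijGroup_def auto_def compose_def)
  have o: "\<one>\<^bsub>AutoGroup \<Delta>\<^esub> h = h" if "h \<in> carrier \<Delta>" for h
    using that by (simp add: AutoGroup_def BijGroup_def)
  show "g \<in> carrier \<Gamma> \<Longrightarrow> h \<in> carrier \<Delta> \<Longrightarrow> \<beta> g h \<in> carrier \<Delta>"
    using c(1) by (auto simp: hom_def)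
  show "g \<in> carrier \<Gamma> \<Longrightarrow> h \<in> carrier \<Delta> \<Longrightarrow> h' \<in> carrier \<Delta> \<Longrightarrow>
          \<beta> g (h \<otimes>\<^bsub>\<Delta>\<^esub> h') = \<beta> g h \<otimes>\<^bsub>\<Delta>\<^esub> \<beta> g h'"
    using c(1) by (auto simp: hom_def)
  show "g \<in> carrier \<Gamma> \<Longrightarrow> g' \<in> carrier \<Gamma> \<Longrightarrow> h \<in> carrier \<Delta> \<Longrightarrow>
          \<beta> (g \<otimes>\<^bsub>\<Gamma>\<^esub> g') h = \<beta> g (\<beta> g' h)"
    using b c(3) m by (simp add: hom_def)
  show "h \<in> carrier \<Delta> \<Longrightarrow> \<beta> \<one>\<^bsub>\<Gamma>\<^esub> h = h"
    using hom_one[OF b G.is_group A.is_group] o by simp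
  show "g \<in> carrier \<Gamma> \<Longrightarrow> h \<in> carrier \<Delta> \<Longrightarrow> (inv\<^bsub>AutoGroup \<Delta>\<^esub> \<beta> g) (\<beta> g h) = h"
    using m[of "inv\<^bsub>AutoGroup \<Delta>\<^esub> \<beta> g" "\<beta> g" h] c(3)[of g] o by simp
qed

lemma group_semidirect_product:
  assumes G: "group \<Gamma>" and D: "group \<Delta>" and b: "\<beta> \<in> hom \<Gamma> (AutoGroup \<Delta>)"
  shows "group (semidirect_product \<Delta> \<Gamma> \<beta>)"
proof -
  interpret G: group \<Gamma> by fact
  interpret D: group \<Delta> by fact
  note f = auto_hom_facts[OF G D b]
  show ?thesis
  proof (rule groupI)
    fix x assume "x \<in> carrier (semidirect_product \<Delta> \<Gamma> \<beta>)"
    then obtain h g where x: "x = (h, g)" "h \<in> carrier \<Delta>" "g \<in> carrier \<Gamma>"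
      by (auto simp: semidirect_product_def)
    \<comment> \<open>In the product \<open>?y\<close> times (h, g), the element h is moved by the
      inverse of g before it is multiplied; the inverse of h has to be moved in the same
      way.\<close>
    let ?y = "(\<beta> (inv\<^bsub>\<Gamma>\<^esub> g) (inv\<^bsub>\<Delta>\<^esub> h), inv\<^bsub>\<Gamma>\<^esub> g)"
    have "\<beta> (inv\<^bsub>\<Gamma>\<^esub> g) (inv\<^bsub>\<Delta>\<^esub> h) \<otimes>\<^bsub>\<Delta>\<^esub> \<beta> (inv\<^bsub>\<Gamma>\<^esub> g) h
        = \<beta> (inv\<^bsub>\<Gamma>\<^esub> g) \<one>\<^bsub>\<Delta>\<^esub>"
      using x f(2)[of "inv\<^bsub>\<Gamma>\<^esub> g" "inv\<^bsub>\<Delta>\<^esub> h" h] by simp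
    moreover have "\<beta> (inv\<^bsub>\<Gamma>\<^esub> g) \<one>\<^bsub>\<Delta>\<^esub> = \<one>\<^bsub>\<Delta>\<^esub>"
      using f(2)[of "inv\<^bsub>\<Gamma>\<^esub> g" "\<one>\<^bsub>\<Delta>\<^esub>" "\<one>\<^bsub>\<Delta>\<^esub>"] f(1)[of "inv\<^bsub>\<Gamma>\<^esub> g" "\<one>\<^bsub>\<Delta>\<^esub>"] x
      by (simp add: D.l_cancel_one')
    ultimately have "?y \<otimes>\<^bsub>semidirect_product \<Delta> \<Gamma> \<beta>\<^esub> x = \<one>\<^bsub>semidirect_product \<Delta> \<Gamma> \<beta>\<^esub>"
      using x by (simp add: semidirect_product_def)
    then show "\<exists>y\<in>carrier (semidirect_product \<Delta> \<Gamma> \<beta>).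
        y \<otimes>\<^bsub>semidirect_product \<Delta> \<Gamma> \<beta>\<^esub> x = \<one>\<^bsub>semidirect_product \<Delta> \<Gamma> \<beta>\<^esub>"
      using x f(1) by (intro bexI[of _ ?y]) (auto simp: semidirect_product_def)
  qed (auto simp: semidirect_product_def f D.m_assoc G.m_assoc)
qed

section \<open>Families of groups closed under wreath products\<close>

text \<open>
  A homomorphism out of the permutational wreath product of \<open>G\<close> with \<open>Sym(A)\<close>. A pair
  \<open>(x, s)\<close> acts on \<open>A \<times> G\<close> by \<open>(a, u) \<mapsto> (s a, x a u)\<close>; thus labels sit at the source.
\<close>

definition wreath_hom ::
  "('b, 'm) monoid_scheme \<Rightarrow> 'x set \<Rightarrow> ('c, 'n) monoid_scheme
    \<Rightarrow> (('x \<Rightarrow> 'b) \<Rightarrow> ('x \<Rightarrow> 'x) \<Rightarrow> 'c) \<Rightarrow> bool" where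
  "wreath_hom G A H P \<longleftrightarrow>
    (\<forall>x\<in>A \<rightarrow> carrier G. \<forall>s\<in>carrier (BijGroup A). P x s \<in> carrier H) \<and>
    (\<forall>x\<in>A \<rightarrow> carrier G. \<forall>y\<in>A \<rightarrow> carrier G. \<forall>s\<in>carrier (BijGroup A). \<forall>t\<in>carrier (BijGroup A).
      P (\<lambda>a. x (t a) \<otimes>\<^bsub>G\<^esub> y a) (s \<otimes>\<^bsub>BijGroup A\<^esub> t) = P x s \<otimes>\<^bsub>H\<^esub> P y t)"

text \<open>The image of the pair of units is idempotent, and a group has only one
  idempotent.\<close>

lemma wreath_hom_one:
  assumes P: "wreath_hom G A H P" and G: "group G" and H: "group H"
  shows "P (\<lambda>_. \<one>\<^bsub>G\<^esub>) \<one>\<^bsub>BijGroup A\<^esub> = \<one>\<^bsub>H\<^esub>"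
proof -
  interpret G: group G by fact
  interpret H: group H by fact
  interpret B: group "BijGroup A" by (rule group_BijGroup)
  let ?p = "P (\<lambda>_. \<one>\<^bsub>G\<^esub>) \<one>\<^bsub>BijGroup A\<^esub>"
  have o: "(\<lambda>_. \<one>\<^bsub>G\<^esub>) \<in> A \<rightarrow> carrier G" by simp
  have "P (\<lambda>a. \<one>\<^bsub>G\<^esub> \<otimes>\<^bsub>G\<^esub> \<one>\<^bsub>G\<^esub>) (\<one>\<^bsub>BijGroup A\<^esub> \<otimes>\<^bsub>BijGroup A\<^esub> \<one>\<^bsub>BijGroup A\<^esub>)
      = ?p \<otimes>\<^bsub>H\<^esub> ?p"
    using P o unfolding wreath_hom_def by fastforce
  moreover have "?p \<in> carrier H" using P o unfolding wreath_hom_def by fastforce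
  ultimately show ?thesis by (simp add: H.l_cancel_one')
qed

text \<open>
  In the next three definitions, \<open>\<delta>\<close>-closeness is mapped to \<open>\<epsilon>\<close>-closeness, and elements at
  distance more than \<open>c\<close> (or \<open>c'\<close>) from the unit to elements at distance more than \<open>c''\<close>.
\<close>

definition amplification ::
  "('b, 'm) monoid_scheme \<Rightarrow> ('b \<Rightarrow> 'b \<Rightarrow> real) \<Rightarrow> ('c, 'n) monoid_scheme \<Rightarrow> ('c \<Rightarrow> 'c \<Rightarrow> real)
    \<Rightarrow> real \<Rightarrow> real \<Rightarrow> real \<Rightarrow> real \<Rightarrow> ('b \<Rightarrow> 'c) \<Rightarrow> bool" where
  "amplification G d H e \<delta> \<epsilon> c c'' P \<longleftrightarrow> P \<in> hom G H \<and>
    (\<forall>x\<in>carrier G. \<forall>y\<in>carrier G. d x y < \<delta> \<longrightarrow> e (P x) (P y) < \<epsilon>) \<and>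
    (\<forall>x\<in>carrier G. d x \<one>\<^bsub>G\<^esub> > c \<longrightarrow> e (P x) \<one>\<^bsub>H\<^esub> > c'')"

definition joining ::
  "('b, 'm) monoid_scheme \<Rightarrow> ('b \<Rightarrow> 'b \<Rightarrow> real) \<Rightarrow> ('a, 'k) monoid_scheme \<Rightarrow> ('a \<Rightarrow> 'a \<Rightarrow> real)
    \<Rightarrow> ('c, 'n) monoid_scheme \<Rightarrow> ('c \<Rightarrow> 'c \<Rightarrow> real) \<Rightarrow> real \<Rightarrow> real \<Rightarrow> real \<Rightarrow> real \<Rightarrow> real
    \<Rightarrow> ('b \<times> 'a \<Rightarrow> 'c) \<Rightarrow> bool" where
  "joining G d G' d' H e \<delta> \<epsilon> c c' c'' P \<longleftrightarrow> P \<in> hom (G \<times>\<times> G') H \<and>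
    (\<forall>x\<in>carrier G. \<forall>y\<in>carrier G. \<forall>x'\<in>carrier G'. \<forall>y'\<in>carrier G'.
      d x y < \<delta> \<longrightarrow> d' x' y' < \<delta> \<longrightarrow> e (P (x, x')) (P (y, y')) < \<epsilon>) \<and>
    (\<forall>x\<in>carrier G. \<forall>x'\<in>carrier G'.
      d x \<one>\<^bsub>G\<^esub> > c \<or> d' x' \<one>\<^bsub>G'\<^esub> > c' \<longrightarrow> e (P (x, x')) \<one>\<^bsub>H\<^esub> > c'')"

definition wreath_map ::
  "('b, 'm) monoid_scheme \<Rightarrow> ('b \<Rightarrow> 'b \<Rightarrow> real) \<Rightarrow> 'x set \<Rightarrow> ('c, 'n) monoid_scheme \<Rightarrow> ('c \<Rightarrow> 'c \<Rightarrow> real)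
    \<Rightarrow> real \<Rightarrow> real \<Rightarrow> real \<Rightarrow> real \<Rightarrow> (('x \<Rightarrow> 'b) \<Rightarrow> ('x \<Rightarrow> 'x) \<Rightarrow> 'c) \<Rightarrow> bool" where
  "wreath_map G d A H e \<delta> \<epsilon> c c'' P \<longleftrightarrow> wreath_hom G A H P \<and>
    (\<forall>x\<in>A \<rightarrow> carrier G. \<forall>y\<in>A \<rightarrow> carrier G. \<forall>s\<in>carrier (BijGroup A). \<forall>t\<in>carrier (BijGroup A).
      real (card {a \<in> A. \<not> (s a = t a \<and> d (x a) (y a) < \<delta>)}) < \<delta> * real (card A) \<longrightarrow>
      e (P x s) (P y t) < \<epsilon>) \<and>
    (\<forall>x\<in>A \<rightarrow> carrier G. 2 * card {a \<in> A. d (x a) \<one>\<^bsub>G\<^esub> > c} \<ge> card A \<longrightarrow>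
      e (P x \<one>\<^bsub>BijGroup A\<^esub>) \<one>\<^bsub>H\<^esub> > c'')"

text \<open>Separation travels through fixed thresholds: any \<open>c\<close> is raised to
  \<open>c0\<close>, \<open>c0\<close> on half of the labels becomes \<open>c1\<close> in the wreath
  product, and \<open>c1\<close> on one side or \<open>c0\<close> on the other becomes
  \<open>c2\<close> in a product. Each \<open>\<delta>\<close> precedes the members of the family,
  because the members to which it is applied are found only later.\<close>

locale permanence_family =
  fixes \<G> :: "('b monoid \<times> ('b \<Rightarrow> 'b \<Rightarrow> real)) set" and c0 c1 c2 :: real
  assumes c2: "c2 > 0"
    and group: "(G, d) \<in> \<G> \<Longrightarrow> group G"
    and amplify: "c > 0 \<Longrightarrow> \<epsilon> > 0 \<Longrightarrow>
      \<exists>\<delta>>0. \<forall>(G, d)\<in>\<G>. \<exists>(H, e)\<in>\<G>. \<exists>P. amplification G d H e \<delta> \<epsilon> c c0 P"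
    and product: "\<epsilon> > 0 \<Longrightarrow>
      \<exists>\<delta>>0. \<forall>(G, d)\<in>\<G>. \<forall>(G', d')\<in>\<G>. \<exists>(H, e)\<in>\<G>. \<exists>P. joining G d G' d' H e \<delta> \<epsilon> c1 c0 c2 P"
    and wreath: "\<epsilon> > 0 \<Longrightarrow>
      \<exists>\<delta>>0. \<forall>(G, d)\<in>\<G>. \<forall>A :: nat set. finite A \<and> A \<noteq> {} \<longrightarrow>
        (\<exists>(H, e)\<in>\<G>. \<exists>P. wreath_map G d A H e \<delta> \<epsilon> c0 c1 P)"
begin

text \<open>The tolerance \<open>\<delta>\<close> of the amplification is determined by
  \<open>c\<close> and \<open>\<epsilon>\<close> before an approximation is requested, so a
  \<open>\<delta>\<close>-multiplicative one can be requested and then amplified. The resulting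
  constant \<open>c0\<close> no longer depends on the group.\<close>

lemma approximable_uniform:
  assumes "approximable \<G> \<Gamma>" "finite F" "F \<subseteq> carrier \<Gamma>" "\<epsilon> > 0"
  obtains G d \<phi> where "(G, d) \<in> \<G>" "\<phi> \<in> carrier \<Gamma> \<rightarrow> carrier G" "unital \<Gamma> G \<phi>"
    "eps_multiplicative \<Gamma> G d F \<epsilon> \<phi>" "separating \<Gamma> G d F c0 \<phi>"
proof -
  obtain c where c: "c > 0" and a: "\<And>F \<epsilon>. finite F \<and> F \<subseteq> carrier \<Gamma> \<and> \<epsilon> > 0 \<Longrightarrow>
      \<exists>(G, d)\<in>\<G>. \<exists>\<phi>\<in>carrier \<Gamma> \<rightarrow> carrier G.
        unital \<Gamma> G \<phi> \<and> eps_multiplicative \<Gamma> G d F \<epsilon> \<phi> \<and> separating \<Gamma> G d F c \<phi>"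
    and gr: "Group.group \<Gamma>"
    using assms(1) unfolding approximable_def by blast
  interpret \<Gamma>: group \<Gamma> by fact
  obtain \<delta> where "\<delta> > 0"
    and d: "\<forall>(G, d)\<in>\<G>. \<exists>(H, e)\<in>\<G>. \<exists>P. amplification G d H e \<delta> \<epsilon> c c0 P"
    using amplify[OF c \<open>\<epsilon> > 0\<close>] by blast
  obtain G d \<phi> where G: "(G, d) \<in> \<G>" "\<phi> \<in> carrier \<Gamma> \<rightarrow> carrier G" "unital \<Gamma> G \<phi>"
    "eps_multiplicative \<Gamma> G d F \<delta> \<phi>" "separating \<Gamma> G d F c \<phi>"
    using a[of F \<delta>] assms \<open>\<delta> > 0\<close> by blast
  obtain H e P where H: "(H, e) \<in> \<G>" "P \<in> hom G H"
    and P1: "\<And>x y. x \<in> carrier G \<Longrightarrow> y \<in> carrier G \<Longrightarrow> d x y < \<delta> \<Longrightarrow> e (P x) (P y) < \<epsilon>"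
    and P2: "\<And>x. x \<in> carrier G \<Longrightarrow> d x \<one>\<^bsub>G\<^esub> > c \<Longrightarrow> e (P x) \<one>\<^bsub>H\<^esub> > c0"
    using d G(1) unfolding amplification_def by blast
  interpret G: group G using G(1) group by blast
  interpret H: group H using H(1) group by blast
  have fc: "\<phi> g \<in> carrier G" if "g \<in> carrier \<Gamma>" for g using G(2) that by blast
  have fF: "g \<in> carrier \<Gamma>" if "g \<in> F" for g using assms(3) that by blast
  have P: "P x \<in> carrier H" "P (x \<otimes>\<^bsub>G\<^esub> y) = P x \<otimes>\<^bsub>H\<^esub> P y" if "x \<in> carrier G" "y \<in> carrier G" for x y
    using H(2) that by (auto simp: hom_def)
  show thesis
  proof (rule that[of H e "P \<circ> \<phi>"])
    show "(H, e) \<in> \<G>" by fact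
    show "P \<circ> \<phi> \<in> carrier \<Gamma> \<rightarrow> carrier H" using P(1)[OF fc fc] by auto
    show "unital \<Gamma> H (P \<circ> \<phi>)"
      using G(3) hom_one[OF H(2) G.is_group H.is_group] by (simp add: unital_def)
    show "eps_multiplicative \<Gamma> H e F \<epsilon> (P \<circ> \<phi>)"
      unfolding eps_multiplicative_def
    proof (intro ballI impI)
      fix g h assume gh: "g \<in> F" "h \<in> F" "g \<otimes>\<^bsub>\<Gamma>\<^esub> h \<in> F"
      have "d (\<phi> (g \<otimes>\<^bsub>\<Gamma>\<^esub> h)) (\<phi> g \<otimes>\<^bsub>G\<^esub> \<phi> h) < \<delta>"
        using G(4) gh unfolding eps_multiplicative_def by blast
      then show "e ((P \<circ> \<phi>) (g \<otimes>\<^bsub>\<Gamma>\<^esub> h)) ((P \<circ> \<phi>) g \<otimes>\<^bsub>H\<^esub> (P \<circ> \<phi>) h) < \<epsilon>"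
        using P1[of "\<phi> (g \<otimes>\<^bsub>\<Gamma>\<^esub> h)" "\<phi> g \<otimes>\<^bsub>G\<^esub> \<phi> h"] P(2)[of "\<phi> g" "\<phi> h"] gh fc fF by simp
    qed
    show "separating \<Gamma> H e F c0 (P \<circ> \<phi>)"
      using G(5) P2 fc fF unfolding separating_def by simp
  qed
qed

theorem semidirect_product_approximable:
  fixes \<Gamma> :: "('g, 'm) monoid_scheme" and \<Delta> :: "('d, 'n) monoid_scheme"
  assumes \<Gamma>: "approximable \<G> \<Gamma>" and \<Delta>: "group \<Delta>"
    and \<beta>: "sofic_action (approximable \<G> :: 'l monoid \<Rightarrow> bool) \<Gamma> \<Delta> \<beta>"
  shows "approximable \<G> (semidirect_product \<Delta> \<Gamma> \<beta>)"
proof -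
  interpret \<Gamma>: group \<Gamma> using \<Gamma> by (simp add: approximable_def)
  interpret \<Delta>: group \<Delta> by fact
  have hom: "\<beta> \<in> hom \<Gamma> (AutoGroup \<Delta>)" using \<beta> by (simp add: sofic_action_def)
  note b = auto_hom_facts[OF \<Gamma>.is_group \<Delta>.is_group hom]
  let ?X = "semidirect_product \<Delta> \<Gamma> \<beta>"
  have "\<exists>(K, k)\<in>\<G>. \<exists>\<Phi>\<in>carrier ?X \<rightarrow> carrier K.
          unital ?X K \<Phi> \<and> eps_multiplicative ?X K k F \<epsilon> \<Phi> \<and> separating ?X K k F c2 \<Phi>"
    if F: "finite F" "F \<subseteq> carrier ?X" and eps: "\<epsilon> > 0" for F \<epsilon>
  proof -
    \<comment> \<open>The tolerances are fixed backwards along the construction: \<open>dp\<close>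
      for the product, \<open>dw\<close> for the wreath product, then \<open>e1\<close> for the
      action.\<close>
    obtain dp where dp: "dp > 0"
      and prod: "\<forall>(G, d)\<in>\<G>. \<forall>(G', d')\<in>\<G>. \<exists>(H, e)\<in>\<G>. \<exists>P. joining G d G' d' H e dp \<epsilon> c1 c0 c2 P"
      using product[OF eps] by (elim exE conjE) (rule that)
    obtain dw where dw: "dw > 0" and wr: "\<forall>(G, d)\<in>\<G>. \<forall>A :: nat set. finite A \<and> A \<noteq> {} \<longrightarrow>
        (\<exists>(H, e)\<in>\<G>. \<exists>P. wreath_map G d A H e dw dp c0 c1 P)"
      using wreath[OF dp] by (elim exE conjE) (rule that)
    \<comment> \<open>A third of \<open>dw\<close> for each of the three exceptional sets in the
      multiplicativity estimate; at most 1/2, so that at least half of the points carry a nontrivial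
      label in the separation estimate.\<close>
    define e1 where "e1 = min (dw / 3) (1/2)"
    have e1: "e1 > 0" "3 * e1 \<le> dw" "e1 \<le> 1/2" using dw by (auto simp: e1_def)
    define F1 where "F1 = snd ` F"
    \<comment> \<open>\<open>E\<close> contains the unit, so that each \<open>\<pi> s\<close> sends
      it to the unit and injectivity separates other elements from it, and the elements
      \<open>\<beta> g h\<close>, at which equivariance is applied.\<close>
    define E where "E = insert \<one>\<^bsub>\<Delta>\<^esub> (fst ` F \<union> (\<lambda>(g, h). \<beta> g h) ` (snd ` F \<times> fst ` F))"
    have Fc: "h \<in> carrier \<Delta>" "g \<in> carrier \<Gamma>" if "(h, g) \<in> F" for h g
      using F(2) that by (auto simp: semidirect_product_def)
    have F1: "finite F1" "F1 \<subseteq> carrier \<Gamma>" using F(1) Fc by (auto simp: F1_def)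
    have E: "finite E" "E \<subseteq> carrier \<Delta>" using F(1) Fc b(1) by (auto simp: E_def)
    have oneE: "\<one>\<^bsub>\<Delta>\<^esub> \<in> E" by (simp add: E_def)
    obtain \<Lambda> :: "'l monoid" and A :: "nat set" and \<phi> where \<Lambda>: "approximable \<G> \<Lambda>" and A: "finite A"
      and un: "unital \<Gamma> (BijGroup A) \<phi>"
      and mu: "eps_multiplicative \<Gamma> (BijGroup A) (hamming A) F1 e1 \<phi>"
      and au: "automorphic_approximation \<Gamma> \<Delta> \<beta> F1 E e1 \<Lambda> A \<phi>"
      using \<beta>[unfolded sofic_action_def, THEN conjunct2, rule_format,
        OF conjI[OF F1(1) conjI[OF F1(2) conjI[OF E(1) conjI[OF E(2) e1(1)]]]]]
      by (elim exE conjE) (rule that)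
    interpret \<Lambda>: group \<Lambda> using \<Lambda> by (simp add: approximable_def)
    interpret B: group "BijGroup A" by (rule group_BijGroup)
    have ph: "\<phi> g \<in> carrier (BijGroup A)" if "g \<in> carrier \<Gamma>" for g
      using au that unfolding automorphic_approximation_def by blast
    then have phA: "bij_betw (\<phi> g) A A" if "g \<in> carrier \<Gamma>" for g
      using that by (auto simp: BijGroup_def Bij_def)
    have phm: "\<phi> g a \<in> A" if "g \<in> carrier \<Gamma>" "a \<in> A" for g a
      using phA[OF that(1)] that(2) by (auto simp: bij_betw_def)
    obtain S \<pi> where S: "S \<subseteq> A" "real (card S) > (1 - e1) * real (card A)"
      and pi: "\<And>s. s \<in> S \<Longrightarrow> partial_hom \<Delta> \<Lambda> E (\<pi> s)" "\<And>s. s \<in> S \<Longrightarrow> inj_on (\<pi> s) E"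
      and eq: "\<And>g h s. g \<in> F1 \<Longrightarrow> h \<in> E \<Longrightarrow> s \<in> S \<Longrightarrow> \<phi> g s \<in> S \<Longrightarrow>
          (inv\<^bsub>AutoGroup \<Delta>\<^esub> \<beta> g) h \<in> E \<Longrightarrow> \<pi> (\<phi> g s) h = \<pi> s ((inv\<^bsub>AutoGroup \<Delta>\<^esub> \<beta> g) h)"
      using au unfolding automorphic_approximation_def by blast
    \<comment> \<open>For empty \<open>A\<close> the strict inequality in \<open>S(2)\<close> would
      read 0 > 0.\<close>
    have A0: "A \<noteq> {}" using S by auto
    then have cA: "card A > 0" using A by (simp add: card_gt_0_iff)
    have pic: "\<pi> s h \<in> carrier \<Lambda>" if "s \<in> S" "h \<in> E" for s h
      using pi(1)[OF that(1)] that(2) by (auto simp: partial_hom_def)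
    have pim: "\<pi> s (h \<otimes>\<^bsub>\<Delta>\<^esub> h') = \<pi> s h \<otimes>\<^bsub>\<Lambda>\<^esub> \<pi> s h'"
      if "s \<in> S" "h \<in> E" "h' \<in> E" "h \<otimes>\<^bsub>\<Delta>\<^esub> h' \<in> E" for s h h'
      using pi(1)[OF that(1)] that(2-) by (auto simp: partial_hom_def)
    have pi1: "\<pi> s \<one>\<^bsub>\<Delta>\<^esub> = \<one>\<^bsub>\<Lambda>\<^esub>" if "s \<in> S" for s
      using pim[OF that oneE oneE] oneE pic[OF that oneE] by (simp add: \<Lambda>.l_cancel_one')
    \<comment> \<open>A finite set, since \<open>S\<close> and \<open>E\<close> are finite; a single
      approximation of \<open>\<Lambda>\<close> thus serves all the partial homomorphisms at
      once.\<close>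
    define F2 where "F2 = (\<Union>s\<in>S. \<pi> s ` E)"
    have F2: "finite F2" "F2 \<subseteq> carrier \<Lambda>"
      using finite_subset[OF S(1) A] E pic by (auto simp: F2_def)
    obtain G d \<psi> where G: "(G, d) \<in> \<G>" "\<psi> \<in> carrier \<Lambda> \<rightarrow> carrier G" "unital \<Lambda> G \<psi>"
      "eps_multiplicative \<Lambda> G d F2 dw \<psi>" "separating \<Lambda> G d F2 c0 \<psi>"
      using approximable_uniform[OF \<Lambda> F2 dw] by metis
    obtain G' d' \<theta> where G': "(G', d') \<in> \<G>" "\<theta> \<in> carrier \<Gamma> \<rightarrow> carrier G'" "unital \<Gamma> G' \<theta>"
      "eps_multiplicative \<Gamma> G' d' F1 dp \<theta>" "separating \<Gamma> G' d' F1 c0 \<theta>"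
      using approximable_uniform[OF \<Gamma> F1 dp] by metis
    interpret G: group G using G(1) group by blast
    interpret G': group G' using G'(1) group by blast
    obtain H e P where H: "(H, e) \<in> \<G>" "wreath_hom G A H P"
      and P1: "\<And>x y s t. x \<in> A \<rightarrow> carrier G \<Longrightarrow> y \<in> A \<rightarrow> carrier G \<Longrightarrow>
          s \<in> carrier (BijGroup A) \<Longrightarrow> t \<in> carrier (BijGroup A) \<Longrightarrow>
          real (card {a \<in> A. \<not> (s a = t a \<and> d (x a) (y a) < dw)}) < dw * real (card A) \<Longrightarrow>
          e (P x s) (P y t) < dp"
      and P2: "\<And>x. x \<in> A \<rightarrow> carrier G \<Longrightarrow> 2 * card {a \<in> A. d (x a) \<one>\<^bsub>G\<^esub> > c0} \<ge> card A \<Longrightarrow>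
          e (P x \<one>\<^bsub>BijGroup A\<^esub>) \<one>\<^bsub>H\<^esub> > c1"
      using wr[rule_format, OF G(1), unfolded prod.case, rule_format, OF conjI[OF A A0]]
      unfolding wreath_map_def by blast
    interpret H: group H using H(1) group by blast
    obtain K k Q where K: "(K, k) \<in> \<G>" "Q \<in> hom (H \<times>\<times> G') K"
      and Q1: "\<And>x y x' y'. x \<in> carrier H \<Longrightarrow> y \<in> carrier H \<Longrightarrow> x' \<in> carrier G' \<Longrightarrow> y' \<in> carrier G' \<Longrightarrow>
        e x y < dp \<Longrightarrow> d' x' y' < dp \<Longrightarrow> k (Q (x, x')) (Q (y, y')) < \<epsilon>"
      and Q2: "\<And>x x'. x \<in> carrier H \<Longrightarrow> x' \<in> carrier G' \<Longrightarrow>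
        e x \<one>\<^bsub>H\<^esub> > c1 \<or> d' x' \<one>\<^bsub>G'\<^esub> > c0 \<Longrightarrow> k (Q (x, x')) \<one>\<^bsub>K\<^esub> > c2"
      using prod[rule_format, OF H(1), unfolded prod.case, rule_format, OF G'(1)]
      unfolding joining_def by blast
    interpret K: group K using K(1) group by blast
    \<comment> \<open>The partial homomorphism is taken at the endpoint \<open>\<phi> g a\<close> of
      the move, so that for a composite move both factors can be compared at the same final point.
      Where no such homomorphism is available the label defaults to the unit, and the point will be
      counted as exceptional.\<close>
    define lab where "lab h g a = (if \<phi> g a \<in> S \<and> h \<in> E then \<psi> (\<pi> (\<phi> g a) h) else \<one>\<^bsub>G\<^esub>)" for h g a
    define R where "R h g = P (lab h g) (\<phi> g)" for h g
    define \<Phi> where "\<Phi> = (\<lambda>(h, g). Q (R h g, \<theta> g))"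
    have psic: "\<psi> u \<in> carrier G" if "u \<in> carrier \<Lambda>" for u using G(2) that by blast
    have psi1: "\<psi> \<one>\<^bsub>\<Lambda>\<^esub> = \<one>\<^bsub>G\<^esub>" using G(3) by (simp add: unital_def)
    have labc: "lab h g \<in> A \<rightarrow> carrier G" for h g using pic psic by (simp add: lab_def)
    have thc: "\<theta> g \<in> carrier G'" if "g \<in> carrier \<Gamma>" for g using G'(2) that by blast
    have Rc: "R h g \<in> carrier H" if "g \<in> carrier \<Gamma>" for h g
      using H(2) labc ph[OF that] unfolding R_def wreath_hom_def by blast
    have Pm: "P (\<lambda>a. x (t a) \<otimes>\<^bsub>G\<^esub> y a) (s \<otimes>\<^bsub>BijGroup A\<^esub> t) = P x s \<otimes>\<^bsub>H\<^esub> P y t"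
      if "x \<in> A \<rightarrow> carrier G" "y \<in> A \<rightarrow> carrier G" "s \<in> carrier (BijGroup A)" "t \<in> carrier (BijGroup A)"
      for x y s t using H(2) that unfolding wreath_hom_def by blast
    have Qc: "Q (x, y) \<in> carrier K" if "x \<in> carrier H" "y \<in> carrier G'" for x y
      using K(2) that by (auto simp: hom_def DirProd_def)
    have Qm: "Q (x \<otimes>\<^bsub>H\<^esub> x', y \<otimes>\<^bsub>G'\<^esub> y') = Q (x, y) \<otimes>\<^bsub>K\<^esub> Q (x', y')"
      if "x \<in> carrier H" "y \<in> carrier G'" "x' \<in> carrier H" "y' \<in> carrier G'" for x x' y y'
    proof -
      have "Q ((x, y) \<otimes>\<^bsub>H \<times>\<times> G'\<^esub> (x', y')) = Q (x, y) \<otimes>\<^bsub>K\<^esub> Q (x', y')"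
        using that by (intro hom_mult[OF K(2)]) auto
      then show ?thesis by simp
    qed
    have ph1: "\<phi> \<one>\<^bsub>\<Gamma>\<^esub> = \<one>\<^bsub>BijGroup A\<^esub>" using un by (simp add: unital_def)
    have "lab \<one>\<^bsub>\<Delta>\<^esub> \<one>\<^bsub>\<Gamma>\<^esub> = (\<lambda>_. \<one>\<^bsub>G\<^esub>)" by (simp add: lab_def pi1 psi1 fun_eq_iff)
    then have R1: "R \<one>\<^bsub>\<Delta>\<^esub> \<one>\<^bsub>\<Gamma>\<^esub> = \<one>\<^bsub>H\<^esub>"
      using wreath_hom_one[OF H(2) G.is_group H.is_group] by (simp add: R_def ph1)
    have unit: "unital ?X K \<Phi>"
    proof -
      have "Q (\<one>\<^bsub>H\<^esub>, \<one>\<^bsub>G'\<^esub>) = \<one>\<^bsub>K\<^esub>"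
        using Qm[of "\<one>\<^bsub>H\<^esub>" "\<one>\<^bsub>G'\<^esub>" "\<one>\<^bsub>H\<^esub>" "\<one>\<^bsub>G'\<^esub>"] Qc[of "\<one>\<^bsub>H\<^esub>" "\<one>\<^bsub>G'\<^esub>"] by (simp add: K.l_cancel_one')
      then show ?thesis
        using R1 G'(3) by (simp add: unital_def \<Phi>_def semidirect_product_def)
    qed
    \<comment> \<open>\<open>\<phi> g\<close> permutes \<open>A\<close>, so as many points are sent
      outside \<open>S\<close> as lie outside \<open>S\<close>.\<close>
    have nS: "real (card {a \<in> A. \<phi> g a \<notin> S}) < e1 * real (card A)" if g: "g \<in> carrier \<Gamma>" for g
    proof -
      have "\<phi> g ` {a \<in> A. \<phi> g a \<notin> S} = A - S"
        using phA[OF g] S(1) by (auto simp: bij_betw_def)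
      moreover have inj: "inj_on (\<phi> g) {a \<in> A. \<phi> g a \<notin> S}"
        by (rule inj_on_subset[OF bij_betw_imp_inj_on[OF phA[OF g]]]) simp
      ultimately have "card {a \<in> A. \<phi> g a \<notin> S} = card (A - S)" using card_image[OF inj] by simp
      also have "\<dots> = card A - card S" using S(1) A by (simp add: card_Diff_subset finite_subset)
      finally show ?thesis using S card_mono[OF A S(1)] by (simp add: of_nat_diff algebra_simps)
    qed
    have mult: "eps_multiplicative ?X K k F \<epsilon> \<Phi>"
      unfolding eps_multiplicative_def
    proof safe
      fix h g h' g' assume xF: "(h, g) \<in> F" and yF: "(h', g') \<in> F"
        and "(h, g) \<otimes>\<^bsub>?X\<^esub> (h', g') \<in> F"
      then have zF: "(h \<otimes>\<^bsub>\<Delta>\<^esub> \<beta> g h', g \<otimes>\<^bsub>\<Gamma>\<^esub> g') \<in> F" by (simp add: semidirect_product_def)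
      note c = Fc[OF xF] Fc[OF yF] Fc[OF zF]
      have F1m: "g \<in> F1" "g' \<in> F1" "g \<otimes>\<^bsub>\<Gamma>\<^esub> g' \<in> F1"
        using xF yF zF unfolding F1_def by force+
      have fE: "h \<in> fst ` F" "h' \<in> fst ` F" "h \<otimes>\<^bsub>\<Delta>\<^esub> \<beta> g h' \<in> fst ` F" "g \<in> snd ` F"
        using xF yF zF by force+
      then have Em: "h \<in> E" "h' \<in> E" "h \<otimes>\<^bsub>\<Delta>\<^esub> \<beta> g h' \<in> E" "\<beta> g h' \<in> E"
        unfolding E_def by auto
      let ?x = "lab (h \<otimes>\<^bsub>\<Delta>\<^esub> \<beta> g h') (g \<otimes>\<^bsub>\<Gamma>\<^esub> g')"
      let ?y = "\<lambda>a. lab h g (\<phi> g' a) \<otimes>\<^bsub>G\<^esub> lab h' g' a"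
      let ?s = "\<phi> (g \<otimes>\<^bsub>\<Gamma>\<^esub> g')" and ?t = "\<phi> g \<otimes>\<^bsub>BijGroup A\<^esub> \<phi> g'"
      have tA: "?t a = \<phi> g (\<phi> g' a)" if "a \<in> A" for a
        using ph[of g] ph[of g'] c that by (simp add: BijGroup_def compose_def)
      \<comment> \<open>With b the image of a under \<open>\<phi> g'\<close>, equivariance replaces
        \<open>\<pi> b h'\<close> by \<open>\<pi> (\<phi> g b) (\<beta> g h')\<close>. Both factors
        are then values of the single partial homomorphism at \<open>\<phi> g b\<close>, and
        \<open>\<psi>\<close> is almost multiplicative on them.\<close>
      have good: "d (?x a) (?y a) < dw"
        if a: "a \<in> A" "?s a = ?t a" "\<phi> g' a \<in> S" "?s a \<in> S" for a
      proof -
        let ?b = "\<phi> g' a"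
        have s: "?s a = \<phi> g ?b" "\<phi> g ?b \<in> S" using a tA by simp_all
        have inv: "(inv\<^bsub>AutoGroup \<Delta>\<^esub> \<beta> g) (\<beta> g h') = h'" using b(5) c by simp
        have e: "\<pi> (\<phi> g ?b) (\<beta> g h') = \<pi> ?b h'"
          using eq[OF F1m(1) Em(4) a(3) s(2)] inv Em by simp
        have x: "?x a = \<psi> (\<pi> (\<phi> g ?b) h \<otimes>\<^bsub>\<Lambda>\<^esub> \<pi> ?b h')"
          using s Em pim[OF s(2) Em(1,4,3)] e by (simp add: lab_def)
        have y: "?y a = \<psi> (\<pi> (\<phi> g ?b) h) \<otimes>\<^bsub>G\<^esub> \<psi> (\<pi> ?b h')"
          using s a Em by (simp add: lab_def)
        have "\<pi> (\<phi> g ?b) h \<in> F2" "\<pi> ?b h' \<in> F2" "\<pi> (\<phi> g ?b) h \<otimes>\<^bsub>\<Lambda>\<^esub> \<pi> ?b h' \<in> F2"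
          using s a Em pim[OF s(2) Em(1,4,3)] e unfolding F2_def by (metis UN_I imageI)+
        then show ?thesis using G(4) unfolding x y eps_multiplicative_def by blast
      qed
      have yc: "?y \<in> A \<rightarrow> carrier G" using labc phm c by (auto simp: Pi_iff)
      have m1: "real (card {a \<in> A. ?s a \<noteq> ?t a}) < e1 * real (card A)"
      proof -
        have "hamming A ?s ?t < e1" using mu F1m unfolding eps_multiplicative_def by blast
        then have "real (card A) - real (card {a \<in> A. ?s a = ?t a}) < e1 * real (card A)"
          using cA by (simp add: hamming_def field_simps)
        moreover have "card A = card {a \<in> A. ?s a = ?t a} + card {a \<in> A. ?s a \<noteq> ?t a}"
        proof -
          have "{a \<in> A. ?s a \<noteq> ?t a} = A - {a \<in> A. ?s a = ?t a}" by blast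
          moreover have "card {a \<in> A. ?s a = ?t a} \<le> card A"
            using A by (simp add: card_mono)
          ultimately show ?thesis using A by (simp add: card_Diff_subset)
        qed
        ultimately show ?thesis by simp
      qed
      \<comment> \<open>The exceptional points: those where \<open>\<phi>\<close> fails to be
        multiplicative, those whose intermediate point leaves \<open>S\<close>, and those whose
        endpoint leaves \<open>S\<close>.\<close>
      have "{a \<in> A. \<not> (?s a = ?t a \<and> d (?x a) (?y a) < dw)}
          \<subseteq> {a \<in> A. ?s a \<noteq> ?t a} \<union> ({a \<in> A. \<phi> g' a \<notin> S} \<union> {a \<in> A. ?s a \<notin> S})" (is "?L \<subseteq> ?R")
        using good by blast
      then have "card ?L \<le> card ?R" using A by (intro card_mono) auto
      also have "\<dots> \<le> card {a \<in> A. ?s a \<noteq> ?t a} + (card {a \<in> A. \<phi> g' a \<notin> S} + card {a \<in> A. ?s a \<notin> S})"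
        by (intro order_trans[OF card_Un_le] add_left_mono card_Un_le)
      finally have "real (card ?L) < 3 * e1 * real (card A)"
        using m1 nS[of g'] nS[of "g \<otimes>\<^bsub>\<Gamma>\<^esub> g'"] c by linarith
      also have "\<dots> \<le> dw * real (card A)" using e1 by (intro mult_right_mono) auto
      finally have "e (P ?x ?s) (P ?y ?t) < dp"
        using labc yc ph c by (intro P1) auto
      then have 1: "e (R (h \<otimes>\<^bsub>\<Delta>\<^esub> \<beta> g h') (g \<otimes>\<^bsub>\<Gamma>\<^esub> g')) (R h g \<otimes>\<^bsub>H\<^esub> R h' g') < dp"
        using Pm[OF labc labc ph ph, of g g' h g h' g'] c by (simp add: R_def)
      have 2: "d' (\<theta> (g \<otimes>\<^bsub>\<Gamma>\<^esub> g')) (\<theta> g \<otimes>\<^bsub>G'\<^esub> \<theta> g') < dp"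
        using G'(4) F1m unfolding eps_multiplicative_def by blast
      have "k (Q (R (h \<otimes>\<^bsub>\<Delta>\<^esub> \<beta> g h') (g \<otimes>\<^bsub>\<Gamma>\<^esub> g'), \<theta> (g \<otimes>\<^bsub>\<Gamma>\<^esub> g')))
              (Q (R h g \<otimes>\<^bsub>H\<^esub> R h' g', \<theta> g \<otimes>\<^bsub>G'\<^esub> \<theta> g')) < \<epsilon>"
        using 1 2 Rc thc c by (intro Q1) auto
      then show "k (\<Phi> ((h, g) \<otimes>\<^bsub>?X\<^esub> (h', g'))) (\<Phi> (h, g) \<otimes>\<^bsub>K\<^esub> \<Phi> (h', g')) < \<epsilon>"
        using Qm Rc thc c by (simp add: \<Phi>_def semidirect_product_def)
    qed
    have sep: "separating ?X K k F c2 \<Phi>"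
      unfolding separating_def
    proof safe
      fix h g assume hF: "(h, g) \<in> F" and ne: "(h, g) \<noteq> \<one>\<^bsub>?X\<^esub>"
      note c = Fc[OF hF]
      have gF1: "g \<in> F1" and hE: "h \<in> E" using hF unfolding F1_def E_def by force+
      have "e (R h g) \<one>\<^bsub>H\<^esub> > c1 \<or> d' (\<theta> g) \<one>\<^bsub>G'\<^esub> > c0"
      proof (cases "g = \<one>\<^bsub>\<Gamma>\<^esub>")
        case False
        then show ?thesis using G'(5) gF1 unfolding separating_def by blast
      next
        case True
        then have h: "h \<noteq> \<one>\<^bsub>\<Delta>\<^esub>" using ne by (simp add: semidirect_product_def)
        have "d (lab h g a) \<one>\<^bsub>G\<^esub> > c0" if "a \<in> A" "\<phi> g a \<in> S" for a
        proof -
          \<comment> \<open>This is injectivity on \<open>E\<close>, applied to h and the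
            unit.\<close>
          have "\<pi> (\<phi> g a) h \<noteq> \<one>\<^bsub>\<Lambda>\<^esub>"
            using inj_onD[OF pi(2)[OF that(2)] _ hE oneE] h pi1[OF that(2)] by auto
          moreover have "\<pi> (\<phi> g a) h \<in> F2" using that hE unfolding F2_def by blast
          ultimately show ?thesis
            using G(5) that hE unfolding separating_def lab_def by simp
        qed
        then have "A - {a \<in> A. \<phi> g a \<notin> S} \<subseteq> {a \<in> A. d (lab h g a) \<one>\<^bsub>G\<^esub> > c0}" (is "_ \<subseteq> ?M") by blast
        then have "card (A - {a \<in> A. \<phi> g a \<notin> S}) \<le> card ?M" using A by (intro card_mono) auto
        moreover have "card (A - {a \<in> A. \<phi> g a \<notin> S}) = card A - card {a \<in> A. \<phi> g a \<notin> S}"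
          using A by (intro card_Diff_subset) auto
        moreover have "real (card {a \<in> A. \<phi> g a \<notin> S}) \<le> 1/2 * real (card A)"
          using nS[OF c(2)] mult_right_mono[OF e1(3), of "real (card A)"] by linarith
        ultimately have "2 * card ?M \<ge> card A" by linarith
        from P2[OF labc this] show ?thesis using True ph1 by (simp add: R_def)
      qed
      then show "k (\<Phi> (h, g)) \<one>\<^bsub>K\<^esub> > c2"
        using Q2[OF Rc[OF c(2)] thc[OF c(2)]] by (simp add: \<Phi>_def)
    qed
    have "\<Phi> \<in> carrier ?X \<rightarrow> carrier K"
      using Qc Rc thc by (auto simp: \<Phi>_def semidirect_product_def)
    then show ?thesis using K(1) unit mult sep by blast
  qed
  then show ?thesis
    using group_semidirect_product[OF \<Gamma>.is_group \<Delta>.is_group hom] c2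
    unfolding approximable_def by blast
qed

end

section \<open>Indexed families with wreath and tensor products\<close>

text \<open>The exponent is shifted: step k has k + 1 factors, so the recursion starts at
  \<open>x\<close> itself and the result has degree \<open>n ^ Suc k\<close>.\<close>

primrec tensor_power :: "(nat \<Rightarrow> nat \<Rightarrow> 'b \<Rightarrow> 'b \<Rightarrow> 'b) \<Rightarrow> nat \<Rightarrow> nat \<Rightarrow> 'b \<Rightarrow> 'b" where
  "tensor_power T n 0 x = x"
| "tensor_power T n (Suc k) x = T (n ^ Suc k) n (tensor_power T n k x) x"

text \<open>\<open>T m n\<close> models the tensor product of elements of degrees m and n, and
  \<open>W n A\<close> the representation of the wreath product on \<open>card A\<close> blocks of
  size n. Labels are plain functions whose identities often hold on \<open>A\<close> only;
  \<open>W_cong\<close> makes such identities usable.\<close>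

locale wreath_tensor_family =
  fixes G :: "nat \<Rightarrow> 'b monoid"
    and T :: "nat \<Rightarrow> nat \<Rightarrow> 'b \<Rightarrow> 'b \<Rightarrow> 'b"
    and W :: "nat \<Rightarrow> nat set \<Rightarrow> (nat \<Rightarrow> 'b) \<Rightarrow> (nat \<Rightarrow> nat) \<Rightarrow> 'b"
  assumes group: "n > 0 \<Longrightarrow> group (G n)"
    and T_closed: "m > 0 \<Longrightarrow> n > 0 \<Longrightarrow> x \<in> carrier (G m) \<Longrightarrow> y \<in> carrier (G n) \<Longrightarrow>
      T m n x y \<in> carrier (G (m * n))"
    and T_mult: "m > 0 \<Longrightarrow> n > 0 \<Longrightarrow> x \<in> carrier (G m) \<Longrightarrow> x' \<in> carrier (G m) \<Longrightarrow>
      y \<in> carrier (G n) \<Longrightarrow> y' \<in> carrier (G n) \<Longrightarrow>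
      T m n (x \<otimes>\<^bsub>G m\<^esub> x') (y \<otimes>\<^bsub>G n\<^esub> y') = T m n x y \<otimes>\<^bsub>G (m * n)\<^esub> T m n x' y'"
    and W_hom: "n > 0 \<Longrightarrow> finite A \<Longrightarrow> A \<noteq> {} \<Longrightarrow> wreath_hom (G n) A (G (card A * n)) (W n A)"
    and W_cong: "n > 0 \<Longrightarrow> finite A \<Longrightarrow> A \<noteq> {} \<Longrightarrow> (\<And>a. a \<in> A \<Longrightarrow> l a = l' a) \<Longrightarrow>
      s \<in> carrier (BijGroup A) \<Longrightarrow> W n A l s = W n A l' s"

text \<open>
  \<open>u\<close> is a normalized distance and \<open>\<Phi>\<close> turns it into the metric. The function \<open>\<rho>\<close> is a
  lower bound for \<open>u\<close> that grows along tensor powers: by \<open>rho_T\<close>, the quantity \<open>1 - 2\<rho>\<close> is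
  submultiplicative.
\<close>

locale indexed_family = wreath_tensor_family G T W
  for G :: "nat \<Rightarrow> 'b monoid" and T W +
  fixes d u :: "nat \<Rightarrow> 'b \<Rightarrow> 'b \<Rightarrow> real" and \<Phi> :: "real \<Rightarrow> real"
    and \<rho> :: "nat \<Rightarrow> 'b \<Rightarrow> real"
  assumes Phi_0: "\<Phi> 0 = 0"
    and Phi_less: "0 \<le> a \<Longrightarrow> a < b \<Longrightarrow> \<Phi> a < \<Phi> b"
    and Phi_cont: "\<epsilon> > 0 \<Longrightarrow> \<exists>\<delta>>0. \<forall>a\<ge>0. a < \<delta> \<longrightarrow> \<Phi> a < \<epsilon>"
    and d_u: "n > 0 \<Longrightarrow> x \<in> carrier (G n) \<Longrightarrow> y \<in> carrier (G n) \<Longrightarrow> d n x y = \<Phi> (u n x y)"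
    and u_nonneg: "n > 0 \<Longrightarrow> x \<in> carrier (G n) \<Longrightarrow> y \<in> carrier (G n) \<Longrightarrow> 0 \<le> u n x y"
    and u_le: "n > 0 \<Longrightarrow> x \<in> carrier (G n) \<Longrightarrow> y \<in> carrier (G n) \<Longrightarrow> u n x y \<le> 2"
    and u_refl: "n > 0 \<Longrightarrow> x \<in> carrier (G n) \<Longrightarrow> u n x x = 0"
    and T_unif: "\<epsilon> > 0 \<Longrightarrow> \<exists>\<delta>>0. \<forall>m>0. \<forall>n>0. \<forall>x\<in>carrier (G m). \<forall>x'\<in>carrier (G m).
      \<forall>y\<in>carrier (G n). \<forall>y'\<in>carrier (G n). u m x x' < \<delta> \<longrightarrow> u n y y' < \<delta> \<longrightarrow>
      u (m * n) (T m n x y) (T m n x' y') < \<epsilon>"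
    and T_left: "m > 0 \<Longrightarrow> n > 0 \<Longrightarrow> x \<in> carrier (G m) \<Longrightarrow>
      u m x \<one>\<^bsub>G m\<^esub> \<le> u (m * n) (T m n x \<one>\<^bsub>G n\<^esub>) \<one>\<^bsub>G (m * n)\<^esub>"
    and T_right: "m > 0 \<Longrightarrow> n > 0 \<Longrightarrow> y \<in> carrier (G n) \<Longrightarrow>
      u n y \<one>\<^bsub>G n\<^esub> \<le> u (m * n) (T m n \<one>\<^bsub>G m\<^esub> y) \<one>\<^bsub>G (m * n)\<^esub>"
    and W_upper: "n > 0 \<Longrightarrow> finite A \<Longrightarrow> A \<noteq> {} \<Longrightarrow>
      l \<in> A \<rightarrow> carrier (G n) \<Longrightarrow> l' \<in> A \<rightarrow> carrier (G n) \<Longrightarrow>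
      s \<in> carrier (BijGroup A) \<Longrightarrow> t \<in> carrier (BijGroup A) \<Longrightarrow>
      real (card A) * u (card A * n) (W n A l s) (W n A l' t)
        \<le> (\<Sum>a\<in>A. if s a = t a then u n (l a) (l' a) else 1)"
    and W_lower: "n > 0 \<Longrightarrow> finite A \<Longrightarrow> A \<noteq> {} \<Longrightarrow> l \<in> A \<rightarrow> carrier (G n) \<Longrightarrow>
      (\<Sum>a\<in>A. u n (l a) \<one>\<^bsub>G n\<^esub>)
        \<le> real (card A) * u (card A * n) (W n A l \<one>\<^bsub>BijGroup A\<^esub>) \<one>\<^bsub>G (card A * n)\<^esub>"
    and rho_le: "n > 0 \<Longrightarrow> x \<in> carrier (G n) \<Longrightarrow> \<rho> n x \<le> u n x \<one>\<^bsub>G n\<^esub>"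
    and rho_T: "m > 0 \<Longrightarrow> n > 0 \<Longrightarrow> x \<in> carrier (G m) \<Longrightarrow> y \<in> carrier (G n) \<Longrightarrow>
      \<rho> n y \<le> 1/2 \<Longrightarrow> \<rho> n y + \<rho> m x * (1 - 2 * \<rho> n y) \<le> \<rho> (m * n) (T m n x y)"
    and rho_start: "c > 0 \<Longrightarrow> \<exists>\<eta>>0. \<forall>n>0. \<forall>x\<in>carrier (G n).
      \<rho> (4 * n) (W n {..<4} (\<lambda>a. if a = 0 then x else \<one>\<^bsub>G n\<^esub>) \<one>\<^bsub>BijGroup {..<4}\<^esub>) \<le> 1/2 \<and>
      (u n x \<one>\<^bsub>G n\<^esub> > c \<longrightarrow>
        \<eta> \<le> \<rho> (4 * n) (W n {..<4} (\<lambda>a. if a = 0 then x else \<one>\<^bsub>G n\<^esub>) \<one>\<^bsub>BijGroup {..<4}\<^esub>))"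
begin

section \<open>Block-diagonal sums\<close>

lemma diagonal_hom:
  assumes n: "n > 0" and A: "finite A" "A \<noteq> {}" and f: "\<And>a. a \<in> A \<Longrightarrow> f a \<in> hom K (G n)"
  shows "(\<lambda>z. W n A (\<lambda>a. f a z) \<one>\<^bsub>BijGroup A\<^esub>) \<in> hom K (G (card A * n))"
proof (rule homI)
  interpret B: group "BijGroup A" by (rule group_BijGroup)
  have c: "(\<lambda>a. f a z) \<in> A \<rightarrow> carrier (G n)" if "z \<in> carrier K" for z
    using f that by (auto simp: hom_def)
  note wh = W_hom[OF n A, unfolded wreath_hom_def]
  fix z assume z: "z \<in> carrier K"
  show "W n A (\<lambda>a. f a z) \<one>\<^bsub>BijGroup A\<^esub> \<in> carrier (G (card A * n))"
    using wh c[OF z] B.one_closed by blast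
  fix z' assume z': "z' \<in> carrier K"
  let ?o = "\<one>\<^bsub>BijGroup A\<^esub>"
  have "W n A (\<lambda>a. f a z) ?o \<otimes>\<^bsub>G (card A * n)\<^esub> W n A (\<lambda>a. f a z') ?o
      = W n A (\<lambda>a. f (?o a) z \<otimes>\<^bsub>G n\<^esub> f a z') (?o \<otimes>\<^bsub>BijGroup A\<^esub> ?o)"
    by (rule conjunct2[OF wh, rule_format, OF c[OF z] c[OF z'] B.one_closed B.one_closed, symmetric])
  also have "\<dots> = W n A (\<lambda>a. f a (z \<otimes>\<^bsub>K\<^esub> z')) ?o"
    unfolding B.l_one[OF B.one_closed]
  proof (rule W_cong[OF n A])
    fix a assume a: "a \<in> A"
    \<comment> \<open>The unit of \<open>BijGroup A\<close> is the identity on \<open>A\<close>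
      only, which is why the two label functions are compared through \<open>W_cong\<close>.\<close>
    then have "?o a = a" by (simp add: BijGroup_def)
    then show "f (?o a) z \<otimes>\<^bsub>G n\<^esub> f a z' = f a (z \<otimes>\<^bsub>K\<^esub> z')"
      using hom_mult[OF f[OF a] z z'] by simp
  qed simp
  finally show "W n A (\<lambda>a. f a (z \<otimes>\<^bsub>K\<^esub> z')) ?o
    = W n A (\<lambda>a. f a z) ?o \<otimes>\<^bsub>G (card A * n)\<^esub> W n A (\<lambda>a. f a z') ?o" by simp
qed

text \<open>\<open>W_upper\<close> bounds the distance of two block sums by the mean of the
  distances of the blocks, and the mean over a finite nonempty set keeps a strict bound.\<close>

lemma diagonal_upper:
  assumes n: "n > 0" and A: "finite A" "A \<noteq> {}"
    and x: "x \<in> A \<rightarrow> carrier (G n)" "y \<in> A \<rightarrow> carrier (G n)"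
    and e: "\<And>a. a \<in> A \<Longrightarrow> u n (x a) (y a) < e"
  shows "u (card A * n) (W n A x \<one>\<^bsub>BijGroup A\<^esub>) (W n A y \<one>\<^bsub>BijGroup A\<^esub>) < e"
proof -
  interpret B: group "BijGroup A" by (rule group_BijGroup)
  have "real (card A) * u (card A * n) (W n A x \<one>\<^bsub>BijGroup A\<^esub>) (W n A y \<one>\<^bsub>BijGroup A\<^esub>)
      \<le> (\<Sum>a\<in>A. u n (x a) (y a))"
    using W_upper[OF n A x B.one_closed B.one_closed] by simp
  also have "\<dots> < (\<Sum>a\<in>A. e)" using A e by (intro sum_strict_mono) auto
  finally show ?thesis using A by (simp add: card_gt_0_iff)
qed

section \<open>Tensor powers\<close>

lemma tensor_power_hom:
  assumes n: "n > 0"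
  shows "tensor_power T n k \<in> hom (G n) (G (n ^ Suc k))"
proof (induction k)
  case 0
  then show ?case by (auto intro!: homI)
next
  case (Suc k)
  interpret Gn: group "G n" using group n by blast
  have p: "n ^ Suc k > 0" using n by simp
  have e: "n ^ Suc (Suc k) = n ^ Suc k * n" by simp
  show ?case
    unfolding e
  proof (rule homI)
    fix x assume x: "x \<in> carrier (G n)"
    note xc = hom_in_carrier[OF Suc x]
    show "tensor_power T n (Suc k) x \<in> carrier (G (n ^ Suc k * n))"
      using T_closed[OF p n xc x] by simp
    fix y assume y: "y \<in> carrier (G n)"
    note yc = hom_in_carrier[OF Suc y]
    show "tensor_power T n (Suc k) (x \<otimes>\<^bsub>G n\<^esub> y)
        = tensor_power T n (Suc k) x \<otimes>\<^bsub>G (n ^ Suc k * n)\<^esub> tensor_power T n (Suc k) y"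
      using T_mult[OF p n xc yc x y] hom_mult[OF Suc x y] by simp
  qed
qed

text \<open>Induction on the number of factors: the closeness that the last tensor step demands is
  passed on to the shorter power. The resulting \<open>\<delta>\<close> depends on \<open>k\<close>
  but not on the degree \<open>n\<close>.\<close>

lemma tensor_power_unif:
  assumes "\<epsilon> > 0"
  shows "\<exists>\<delta>>0. \<forall>n>0. \<forall>x\<in>carrier (G n). \<forall>y\<in>carrier (G n). u n x y < \<delta> \<longrightarrow>
    u (n ^ Suc k) (tensor_power T n k x) (tensor_power T n k y) < \<epsilon>"
  using assms
proof (induction k arbitrary: \<epsilon>)
  case 0
  then show ?case by auto
next
  case (Suc k)
  obtain d1 where d1: "d1 > 0" "\<And>m n x x' y y'. m > 0 \<Longrightarrow> n > 0 \<Longrightarrow> x \<in> carrier (G m) \<Longrightarrow>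
      x' \<in> carrier (G m) \<Longrightarrow> y \<in> carrier (G n) \<Longrightarrow> y' \<in> carrier (G n) \<Longrightarrow> u m x x' < d1 \<Longrightarrow>
      u n y y' < d1 \<Longrightarrow> u (m * n) (T m n x y) (T m n x' y') < \<epsilon>"
    using T_unif[OF Suc.prems] by metis
  obtain d2 where d2: "d2 > 0" "\<And>n x y. n > 0 \<Longrightarrow> x \<in> carrier (G n) \<Longrightarrow> y \<in> carrier (G n) \<Longrightarrow>
      u n x y < d2 \<Longrightarrow> u (n ^ Suc k) (tensor_power T n k x) (tensor_power T n k y) < d1"
    using Suc.IH[OF d1(1)] by metis
  have "u (n ^ Suc (Suc k)) (tensor_power T n (Suc k) x) (tensor_power T n (Suc k) y) < \<epsilon>"
    if n: "n > 0" and x: "x \<in> carrier (G n)" and y: "y \<in> carrier (G n)" and l: "u n x y < min d1 d2"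
    for n x y
  proof -
    have "u (n ^ Suc k) (tensor_power T n k x) (tensor_power T n k y) < d1"
      using d2(2)[OF n x y] l by simp
    moreover have "n ^ Suc (Suc k) = n ^ Suc k * n" by simp
    moreover have "n ^ Suc k > 0" using n by simp
    ultimately show ?thesis
      using d1(2)[OF _ n hom_in_carrier[OF tensor_power_hom[OF n] x]
          hom_in_carrier[OF tensor_power_hom[OF n] y] x y] l
      unfolding tensor_power.simps by (metis min_less_iff_conj)
  qed
  then show ?case using d1(1) d2(1) by (intro exI[of _ "min d1 d2"]) auto
qed

text \<open>\<open>rho_T\<close> says that 1 - 2 \<open>\<rho>\<close> of x (x) y is at most the
  product of the values for x and y. The bound 1/2 concerns the factor that is adjoined, which is
  \<open>x\<close> in every step, so the induction carries no bound on the powers.\<close>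

lemma rho_tensor_power:
  assumes n: "n > 0" and x: "x \<in> carrier (G n)" and s: "\<rho> n x \<le> 1/2"
  shows "(1 - (1 - 2 * \<rho> n x) ^ Suc k) / 2 \<le> \<rho> (n ^ Suc k) (tensor_power T n k x)"
proof (induction k)
  case (Suc k)
  let ?q = "(1 - 2 * \<rho> n x) ^ Suc k"
  have "(1 - (1 - 2 * \<rho> n x) ^ Suc (Suc k)) / 2 = \<rho> n x + (1 - ?q) / 2 * (1 - 2 * \<rho> n x)"
    by (simp add: field_simps)
  also have "\<dots> \<le> \<rho> n x + \<rho> (n ^ Suc k) (tensor_power T n k x) * (1 - 2 * \<rho> n x)"
    using Suc s by (intro add_left_mono mult_right_mono) auto
  also have "\<dots> \<le> \<rho> (n ^ Suc k * n) (T (n ^ Suc k) n (tensor_power T n k x) x)"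
    using n s x hom_in_carrier[OF tensor_power_hom[OF n] x] by (intro rho_T) auto
  finally show ?case by (simp add: mult.commute)
qed simp

lemma Phi_mono: "0 \<le> a \<Longrightarrow> a \<le> b \<Longrightarrow> \<Phi> a \<le> \<Phi> b"
  using Phi_less[of a b] by (cases "a = b") auto

lemma d_less_iff:
  assumes "n > 0" "x \<in> carrier (G n)" "y \<in> carrier (G n)" "0 \<le> a"
  shows "d n x y < \<Phi> a \<longleftrightarrow> u n x y < a" and "\<Phi> a < d n x y \<longleftrightarrow> a < u n x y"
  using assms d_u[of n x y] u_nonneg[of n x y] Phi_less Phi_mono
  by (metis linorder_not_less)+

section \<open>Amplification, products and wreath products for the normalized distance\<close>

lemma amplify_u:
  assumes c: "c > 0" and e: "\<epsilon> > 0"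
  shows "\<exists>\<delta>>0. \<forall>n>0. \<exists>m>0. \<exists>P. amplification (G n) (u n) (G m) (u m) \<delta> \<epsilon> c (1/4) P"
proof -
  \<comment> \<open>The direct sum of x with three units; \<open>rho_start\<close> keeps its
    \<open>\<rho>\<close> at most 1/2, and above a positive \<open>\<eta>\<close> when x is farther
    than \<open>c\<close> from the unit.\<close>
  define Y where "Y n x = W n {..<4} (\<lambda>a. if a = 0 then x else \<one>\<^bsub>G n\<^esub>) \<one>\<^bsub>BijGroup {..<4}\<^esub>" for n x
  obtain \<eta> where eta: "\<eta> > 0" "\<And>n x. n > 0 \<Longrightarrow> x \<in> carrier (G n) \<Longrightarrow> \<rho> (4 * n) (Y n x) \<le> 1/2"
    "\<And>n x. n > 0 \<Longrightarrow> x \<in> carrier (G n) \<Longrightarrow> u n x \<one>\<^bsub>G n\<^esub> > c \<Longrightarrow> \<eta> \<le> \<rho> (4 * n) (Y n x)"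
    using rho_start[OF c] unfolding Y_def by metis
  \<comment> \<open>Capped at 1/4, so that 1 - 2h lies in [1/2, 1) and its powers decrease to
    0.\<close>
  define h where "h = min \<eta> (1/4)"
  have h: "h > 0" "h \<le> \<eta>" "h \<le> 1/4" using eta(1) by (auto simp: h_def)
  \<comment> \<open>Once the power is below 1/2, \<open>\<rho>\<close> exceeds (1 - 1/2) / 2 = 1/4.
    Since \<open>k0\<close> does not depend on the degree, one \<open>\<delta>\<close> serves all
    degrees.\<close>
  obtain k0 where k0: "(1 - 2 * h) ^ k0 < 1/2"
    using real_arch_pow_inv[of "1/2" "1 - 2 * h"] h by auto
  obtain \<delta> where de: "\<delta> > 0" "\<And>n x y. n > 0 \<Longrightarrow> x \<in> carrier (G n) \<Longrightarrow> y \<in> carrier (G n) \<Longrightarrow>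
      u n x y < \<delta> \<Longrightarrow> u (n ^ Suc k0) (tensor_power T n k0 x) (tensor_power T n k0 y) < \<epsilon>"
    using tensor_power_unif[OF e] by metis
  have "\<exists>m>0. \<exists>P. amplification (G n) (u n) (G m) (u m) \<delta> \<epsilon> c (1/4) P" if n: "n > 0" for n
  proof -
    interpret Gn: group "G n" using group n by blast
    let ?L = "\<lambda>x a. if a = (0::nat) then x else \<one>\<^bsub>G n\<^esub>"
    have A4: "{..<4::nat} \<noteq> {}" by (auto simp: lessThan_empty_iff)
    have "(\<lambda>x. W n {..<4} (\<lambda>a. (if a = 0 then (\<lambda>x. x) else (\<lambda>_. \<one>\<^bsub>G n\<^esub>)) x) \<one>\<^bsub>BijGroup {..<4}\<^esub>)
        \<in> hom (G n) (G (card {..<4::nat} * n))"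
      using A4 by (intro diagonal_hom[OF n]) (auto intro!: homI)
    moreover have "(\<lambda>x. W n {..<4} (\<lambda>a. (if a = 0 then (\<lambda>x. x) else (\<lambda>_. \<one>\<^bsub>G n\<^esub>)) x)
        \<one>\<^bsub>BijGroup {..<4}\<^esub>) = Y n"
      unfolding Y_def by (intro ext arg_cong2[where f = "W n {..<4}"]) auto
    ultimately have Yh: "Y n \<in> hom (G n) (G (4 * n))" by simp
    note Yc = hom_in_carrier[OF Yh]
    have n4: "4 * n > 0" using n by simp
    let ?m = "(4 * n) ^ Suc k0" and ?P = "tensor_power T (4 * n) k0 \<circ> Y n"
    have m: "?m > 0" using n by simp
    have Ph: "?P \<in> hom (G n) (G ?m)"
      by (rule hom_compose[OF Yh tensor_power_hom[OF n4]])
    have "u ?m (?P x) (?P y) < \<epsilon>" if x: "x \<in> carrier (G n)" and y: "y \<in> carrier (G n)"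
      and l: "u n x y < \<delta>" for x y
    proof -
      have "u (card {..<4::nat} * n) (W n {..<4} (?L x) \<one>\<^bsub>BijGroup {..<4}\<^esub>)
          (W n {..<4} (?L y) \<one>\<^bsub>BijGroup {..<4}\<^esub>) < \<delta>"
        using x y l de(1) n u_refl[OF n, of "\<one>\<^bsub>G n\<^esub>"] A4 by (intro diagonal_upper) auto
      then have "u (4 * n) (Y n x) (Y n y) < \<delta>" by (simp add: Y_def)
      then show ?thesis using de(2)[OF n4 Yc[OF x] Yc[OF y]] by simp
    qed
    moreover have "u ?m (?P x) \<one>\<^bsub>G ?m\<^esub> > 1/4" if x: "x \<in> carrier (G n)"
      and l: "u n x \<one>\<^bsub>G n\<^esub> > c" for x
    proof -
      let ?s = "\<rho> (4 * n) (Y n x)"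
      have s: "h \<le> ?s" "?s \<le> 1/2" using eta(3)[OF n x l] eta(2)[OF n x] h by auto
      have "(1 - 2 * ?s) ^ Suc k0 \<le> (1 - 2 * h) ^ Suc k0" using s by (intro power_mono) auto
      also have "\<dots> \<le> (1 - 2 * h) ^ k0" using h by (intro power_decreasing) auto
      finally have "1/4 < (1 - (1 - 2 * ?s) ^ Suc k0) / 2" using k0 by simp
      also have "\<dots> \<le> \<rho> ?m (?P x)" using rho_tensor_power[OF n4 Yc[OF x] s(2)] by simp
      also have "\<dots> \<le> u ?m (?P x) \<one>\<^bsub>G ?m\<^esub>" using rho_le[OF m hom_in_carrier[OF Ph x]] .
      finally show ?thesis .
    qed
    ultimately show ?thesis using m Ph unfolding amplification_def by blast
  qed
  then show ?thesis using de(1) by blast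
qed

text \<open>The pair is mapped to the block sum of x (x) 1 and 1 (x) x', not to x (x) x', where the
  two could cancel. The distance to the unit is at least the mean of the two distances, and half of
  the smaller threshold 1/8 is 1/16.\<close>

lemma product_u:
  assumes e: "\<epsilon> > 0"
  shows "\<exists>\<delta>>0. \<forall>m>0. \<forall>n>0. \<exists>k>0. \<exists>P.
    joining (G m) (u m) (G n) (u n) (G k) (u k) \<delta> \<epsilon> (1/8) (1/4) (1/16) P"
proof -
  obtain \<delta> where de: "\<delta> > 0" "\<And>m n x x' y y'. m > 0 \<Longrightarrow> n > 0 \<Longrightarrow> x \<in> carrier (G m) \<Longrightarrow>
      x' \<in> carrier (G m) \<Longrightarrow> y \<in> carrier (G n) \<Longrightarrow> y' \<in> carrier (G n) \<Longrightarrow> u m x x' < \<delta> \<Longrightarrow>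
      u n y y' < \<delta> \<Longrightarrow> u (m * n) (T m n x y) (T m n x' y') < \<epsilon>"
    using T_unif[OF e] by metis
  have "\<exists>k>0. \<exists>P. joining (G m) (u m) (G n) (u n) (G k) (u k) \<delta> \<epsilon> (1/8) (1/4) (1/16) P"
    if m: "m > 0" and n: "n > 0" for m n
  proof -
    interpret Gm: group "G m" using group m by blast
    interpret Gn: group "G n" using group n by blast
    let ?A = "{..<2::nat}"
    have A: "finite ?A" "?A \<noteq> {}" "card ?A = 2" by (auto simp: lessThan_empty_iff)
    have mn: "m * n > 0" using m n by simp
    define f where "f a = (if a = (0::nat) then (\<lambda>(x, x'). T m n x \<one>\<^bsub>G n\<^esub>)
      else (\<lambda>(x, x'). T m n \<one>\<^bsub>G m\<^esub> x'))" for a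
    have f: "f a \<in> hom (G m \<times>\<times> G n) (G (m * n))" for a
    proof (rule homI)
      fix z assume z: "z \<in> carrier (G m \<times>\<times> G n)"
      then show "f a z \<in> carrier (G (m * n))"
        using T_closed[OF m n] by (auto simp: f_def DirProd_def)
      fix z' assume z': "z' \<in> carrier (G m \<times>\<times> G n)"
      obtain x x' y y' where p: "z = (x, x')" "z' = (y, y')" by (metis surj_pair)
      show "f a (z \<otimes>\<^bsub>G m \<times>\<times> G n\<^esub> z') = f a z \<otimes>\<^bsub>G (m * n)\<^esub> f a z'"
        using z z' T_mult[OF m n, of x y "\<one>\<^bsub>G n\<^esub>" "\<one>\<^bsub>G n\<^esub>"] T_mult[OF m n, of "\<one>\<^bsub>G m\<^esub>" "\<one>\<^bsub>G m\<^esub>" x' y']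
        by (simp add: f_def p)
    qed
    let ?P = "\<lambda>z. W (m * n) ?A (\<lambda>a. f a z) \<one>\<^bsub>BijGroup ?A\<^esub>" and ?k = "card ?A * (m * n)"
    have k: "?k > 0" using m n by simp
    have Ph: "?P \<in> hom (G m \<times>\<times> G n) (G ?k)" by (rule diagonal_hom[OF mn A(1,2) f])
    have fc: "(\<lambda>a. f a (x, x')) \<in> ?A \<rightarrow> carrier (G (m * n))"
      if "x \<in> carrier (G m)" "x' \<in> carrier (G n)" for x x'
      using hom_in_carrier[OF f, of "(x, x')"] that by (simp add: DirProd_def)
    have up: "u ?k (?P (x, x')) (?P (y, y')) < \<epsilon>"
      if x: "x \<in> carrier (G m)" "y \<in> carrier (G m)" "x' \<in> carrier (G n)" "y' \<in> carrier (G n)"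
      and l: "u m x y < \<delta>" "u n x' y' < \<delta>" for x y x' y'
    proof -
      have "u (m * n) (f a (x, x')) (f a (y, y')) < \<epsilon>" for a
        using de x l m n u_refl[OF m, of "\<one>\<^bsub>G m\<^esub>"] u_refl[OF n, of "\<one>\<^bsub>G n\<^esub>"] by (simp add: f_def)
      then show ?thesis using fc x by (intro diagonal_upper[OF mn A(1,2)]) auto
    qed
    have low: "u ?k (?P (x, x')) \<one>\<^bsub>G ?k\<^esub> > 1/16"
      if x: "x \<in> carrier (G m)" "x' \<in> carrier (G n)"
      and l: "u m x \<one>\<^bsub>G m\<^esub> > 1/8 \<or> u n x' \<one>\<^bsub>G n\<^esub> > 1/4" for x x'
    proof -
      have "(\<Sum>a\<in>?A. u (m * n) (f a (x, x')) \<one>\<^bsub>G (m * n)\<^esub>) \<le> 2 * u ?k (?P (x, x')) \<one>\<^bsub>G ?k\<^esub>"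
        using W_lower[OF mn A(1,2) fc[OF x]] A(3) by simp
      moreover have "(\<Sum>a\<in>?A. u (m * n) (f a (x, x')) \<one>\<^bsub>G (m * n)\<^esub>) =
          u (m * n) (T m n x \<one>\<^bsub>G n\<^esub>) \<one>\<^bsub>G (m * n)\<^esub> + u (m * n) (T m n \<one>\<^bsub>G m\<^esub> x') \<one>\<^bsub>G (m * n)\<^esub>"
        by (simp add: f_def numeral_2_eq_2)
      moreover have "u m x \<one>\<^bsub>G m\<^esub> \<ge> 0" "u n x' \<one>\<^bsub>G n\<^esub> \<ge> 0" using u_nonneg m n x by auto
      ultimately show ?thesis using T_left[OF m n x(1)] T_right[OF m n x(2)] l by linarith
    qed
    have "joining (G m) (u m) (G n) (u n) (G ?k) (u ?k) \<delta> \<epsilon> (1/8) (1/4) (1/16) ?P"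
      unfolding joining_def using Ph up low by blast
    then show ?thesis using k by blast
  qed
  then show ?thesis using de(1) by blast
qed

lemma wreath_u:
  assumes e: "\<epsilon> > 0"
  shows "\<exists>\<delta>>0. \<forall>n>0. \<forall>A. finite A \<and> A \<noteq> {} \<longrightarrow>
    wreath_map (G n) (u n) A (G (card A * n)) (u (card A * n)) \<delta> \<epsilon> (1/4) (1/8) (W n A)"
  unfolding wreath_map_def
\<comment> \<open>Each point contributes at most \<open>\<epsilon>\<close> / 3, and the bad ones, a
  proportion below \<open>\<epsilon>\<close> / 3, at most 2 more by \<open>u_le\<close>.\<close>
proof (rule exI[of _ "\<epsilon> / 3"], intro conjI allI impI ballI)
  show "\<epsilon> / 3 > 0" using e by simp
  fix n :: nat and A :: "nat set" and x
  assume n: "n > 0" and A: "finite A \<and> A \<noteq> {}"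
  then show "wreath_hom (G n) A (G (card A * n)) (W n A)" by (simp add: W_hom)
  assume x: "x \<in> A \<rightarrow> carrier (G n)"
  interpret Gn: group "G n" using group n by blast
  have cA: "card A > 0" using A by (simp add: card_gt_0_iff)
  {
    fix y and s t :: "nat \<Rightarrow> nat"
    let ?B = "{a \<in> A. \<not> (s a = t a \<and> u n (x a) (y a) < \<epsilon> / 3)}"
    assume y: "y \<in> A \<rightarrow> carrier (G n)" and st: "s \<in> carrier (BijGroup A)" "t \<in> carrier (BijGroup A)"
      and l: "real (card ?B) < \<epsilon> / 3 * real (card A)"
    have "real (card A) * u (card A * n) (W n A x s) (W n A y t)
        \<le> (\<Sum>a\<in>A. if s a = t a then u n (x a) (y a) else 1)"
      using W_upper n A x y st by blast
    also have "\<dots> \<le> (\<Sum>a\<in>A. \<epsilon> / 3 + (if a \<in> ?B then 2 else 0))"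
    proof (rule sum_mono)
      fix a assume a: "a \<in> A"
      then show "(if s a = t a then u n (x a) (y a) else 1) \<le> \<epsilon> / 3 + (if a \<in> ?B then 2 else 0)"
        using u_le[OF n, of "x a" "y a"] x y e by (auto simp: Pi_iff)
    qed
    also have "\<dots> = \<epsilon> / 3 * real (card A) + 2 * real (card ?B)"
      using A by (simp add: sum.distrib sum.If_cases Int_def conj_commute)
    also have "\<dots> < \<epsilon> * real (card A)" using l by linarith
    finally show "u (card A * n) (W n A x s) (W n A y t) < \<epsilon>"
      using cA by (simp add: mult.commute)
  }
  let ?C = "{a \<in> A. u n (x a) \<one>\<^bsub>G n\<^esub> > 1/4}"
  assume l: "2 * card ?C \<ge> card A"
  \<comment> \<open>Nonemptiness makes the comparison of sums below strict; with half of the labels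
    beyond 1/4, the mean exceeds 1/8.\<close>
  then have C0: "?C \<noteq> {}" using cA by (metis card.empty mult_0_right not_le)
  have "1/4 * real (card ?C) = (\<Sum>a\<in>?C. 1/4)" by simp
  also have "\<dots> < (\<Sum>a\<in>?C. u n (x a) \<one>\<^bsub>G n\<^esub>)" using C0 A by (intro sum_strict_mono) auto
  also have "\<dots> \<le> (\<Sum>a\<in>A. u n (x a) \<one>\<^bsub>G n\<^esub>)"
    using A x u_nonneg[OF n] by (intro sum_mono2) (auto simp: Pi_iff)
  also have "\<dots> \<le> real (card A) * u (card A * n) (W n A x \<one>\<^bsub>BijGroup A\<^esub>) \<one>\<^bsub>G (card A * n)\<^esub>"
    using W_lower n A x by blast
  finally have "1/8 * real (card A) < real (card A) * u (card A * n) (W n A x \<one>\<^bsub>BijGroup A\<^esub>) \<one>\<^bsub>G (card A * n)\<^esub>"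
    using l by linarith
  then show "u (card A * n) (W n A x \<one>\<^bsub>BijGroup A\<^esub>) \<one>\<^bsub>G (card A * n)\<^esub> > 1/8"
    using cA by (simp add: mult.commute)
qed

section \<open>From the normalized distance to the metric\<close>

lemma Phi_cont_ge:
  assumes "c > 0"
  obtains a where "a > 0" "\<Phi> a < c"
proof -
  obtain \<delta> where "\<delta> > 0" "\<forall>a\<ge>0. a < \<delta> \<longrightarrow> \<Phi> a < c" using Phi_cont[OF assms] by blast
  then show thesis by (intro that[of "\<delta> / 2"]) auto
qed

lemma Phi_pos: "a > 0 \<Longrightarrow> \<Phi> a > 0"
  using Phi_less[of 0 a] Phi_0 by simp

abbreviation family :: "('b monoid \<times> ('b \<Rightarrow> 'b \<Rightarrow> real)) set" where
  "family \<equiv> {(G n, d n) | n. n > 0}"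

lemma ball_family: "(\<forall>(K, e)\<in>family. Q K e) \<longleftrightarrow> (\<forall>n>0. Q (G n) (d n))"
  and bex_family: "(\<exists>(K, e)\<in>family. Q K e) \<longleftrightarrow> (\<exists>n>0. Q (G n) (d n))"
  by auto

text \<open>\<open>\<Phi>\<close> is not assumed to be onto, so the thresholds of the metric are
  replaced by smaller values of \<open>\<Phi>\<close>: distance above \<open>c\<close> forces
  \<open>u\<close> above \<open>c'\<close>, and \<open>u\<close> below \<open>e'\<close> forces
  distance below \<open>\<epsilon>\<close>.\<close>

lemma amplify_d:
  assumes c: "c > 0" and e: "\<epsilon> > 0"
  shows "\<exists>\<delta>>0. \<forall>(K, d)\<in>family. \<exists>(H, e)\<in>family. \<exists>P. amplification K d H e \<delta> \<epsilon> c (\<Phi> (1/4)) P"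
proof -
  obtain c' where c': "c' > 0" "\<Phi> c' < c" using Phi_cont_ge[OF c] .
  obtain e' where e': "e' > 0" "\<Phi> e' < \<epsilon>" using Phi_cont_ge[OF e] .
  obtain \<delta> where de: "\<delta> > 0"
    and H: "\<And>n. n > 0 \<Longrightarrow> \<exists>m>0. \<exists>P. amplification (G n) (u n) (G m) (u m) \<delta> e' c' (1/4) P"
    using amplify_u[OF c'(1) e'(1)] by blast
  have "\<exists>m>0. \<exists>P. amplification (G n) (d n) (G m) (d m) (\<Phi> \<delta>) \<epsilon> c (\<Phi> (1/4)) P" if n: "n > 0" for n
  proof -
    obtain m P where m: "m > 0" and P: "P \<in> hom (G n) (G m)"
      and 1: "\<And>x y. x \<in> carrier (G n) \<Longrightarrow> y \<in> carrier (G n) \<Longrightarrow> u n x y < \<delta> \<Longrightarrow> u m (P x) (P y) < e'"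
      and 2: "\<And>x. x \<in> carrier (G n) \<Longrightarrow> u n x \<one>\<^bsub>G n\<^esub> > c' \<Longrightarrow> u m (P x) \<one>\<^bsub>G m\<^esub> > 1/4"
      using H[OF n] unfolding amplification_def by blast
    interpret Gn: group "G n" using group n by blast
    interpret Gm: group "G m" using group m by blast
    note Pc = hom_in_carrier[OF P]
    have "d m (P x) (P y) < \<epsilon>" if x: "x \<in> carrier (G n)" "y \<in> carrier (G n)" "d n x y < \<Phi> \<delta>" for x y
    proof -
      have "d m (P x) (P y) < \<Phi> e'"
        using 1[OF x(1,2)] x d_less_iff(1)[OF n x(1,2)] d_less_iff(1)[OF m Pc[OF x(1)] Pc[OF x(2)]] de e'
        by simp
      then show ?thesis using e' by simp
    qed
    moreover have "d m (P x) \<one>\<^bsub>G m\<^esub> > \<Phi> (1/4)" if x: "x \<in> carrier (G n)" "d n x \<one>\<^bsub>G n\<^esub> > c" for x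
      using 2[OF x(1)] x d_less_iff(2)[OF n x(1) Gn.one_closed, of c'] c'
        d_less_iff(2)[OF m Pc[OF x(1)] Gm.one_closed, of "1/4"] by simp
    ultimately show ?thesis using m P unfolding amplification_def by blast
  qed
  then show ?thesis
    unfolding ball_family bex_family using Phi_pos[OF de] by blast
qed

lemma product_d:
  assumes e: "\<epsilon> > 0"
  shows "\<exists>\<delta>>0. \<forall>(K, d)\<in>family. \<forall>(K', d')\<in>family. \<exists>(H, e)\<in>family. \<exists>P.
    joining K d K' d' H e \<delta> \<epsilon> (\<Phi> (1/8)) (\<Phi> (1/4)) (\<Phi> (1/16)) P"
proof -
  obtain e' where e': "e' > 0" "\<Phi> e' < \<epsilon>" using Phi_cont_ge[OF e] .
  obtain \<delta> where de: "\<delta> > 0" and H: "\<And>m n. m > 0 \<Longrightarrow> n > 0 \<Longrightarrow>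
      \<exists>k>0. \<exists>P. joining (G m) (u m) (G n) (u n) (G k) (u k) \<delta> e' (1/8) (1/4) (1/16) P"
    using product_u[OF e'(1)] by blast
  have "\<exists>k>0. \<exists>P. joining (G m) (d m) (G n) (d n) (G k) (d k) (\<Phi> \<delta>) \<epsilon> (\<Phi> (1/8)) (\<Phi> (1/4)) (\<Phi> (1/16)) P"
    if m: "m > 0" and n: "n > 0" for m n
  proof -
    obtain k P where k: "k > 0" and P: "P \<in> hom (G m \<times>\<times> G n) (G k)"
      and 1: "\<And>x y x' y'. x \<in> carrier (G m) \<Longrightarrow> y \<in> carrier (G m) \<Longrightarrow> x' \<in> carrier (G n) \<Longrightarrow>
        y' \<in> carrier (G n) \<Longrightarrow> u m x y < \<delta> \<Longrightarrow> u n x' y' < \<delta> \<Longrightarrow> u k (P (x, x')) (P (y, y')) < e'"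
      and 2: "\<And>x x'. x \<in> carrier (G m) \<Longrightarrow> x' \<in> carrier (G n) \<Longrightarrow>
        u m x \<one>\<^bsub>G m\<^esub> > 1/8 \<or> u n x' \<one>\<^bsub>G n\<^esub> > 1/4 \<Longrightarrow> u k (P (x, x')) \<one>\<^bsub>G k\<^esub> > 1/16"
      using H[OF m n] unfolding joining_def by blast
    interpret Gm: group "G m" using group m by blast
    interpret Gn: group "G n" using group n by blast
    interpret Gk: group "G k" using group k by blast
    have Pc: "P (x, x') \<in> carrier (G k)" if "x \<in> carrier (G m)" "x' \<in> carrier (G n)" for x x'
      using hom_in_carrier[OF P, of "(x, x')"] that by (simp add: DirProd_def)
    have "d k (P (x, x')) (P (y, y')) < \<epsilon>"
      if x: "x \<in> carrier (G m)" "y \<in> carrier (G m)" "x' \<in> carrier (G n)" "y' \<in> carrier (G n)"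
        "d m x y < \<Phi> \<delta>" "d n x' y' < \<Phi> \<delta>" for x y x' y'
    proof -
      have "d k (P (x, x')) (P (y, y')) < \<Phi> e'"
        using 1[OF x(1-4)] x d_less_iff(1)[OF m x(1,2)] d_less_iff(1)[OF n x(3,4)]
          d_less_iff(1)[OF k Pc[OF x(1,3)] Pc[OF x(2,4)]] de e' by simp
      then show ?thesis using e' by simp
    qed
    moreover have "d k (P (x, x')) \<one>\<^bsub>G k\<^esub> > \<Phi> (1/16)"
      if x: "x \<in> carrier (G m)" "x' \<in> carrier (G n)"
        "d m x \<one>\<^bsub>G m\<^esub> > \<Phi> (1/8) \<or> d n x' \<one>\<^bsub>G n\<^esub> > \<Phi> (1/4)" for x x'
    proof -
      have "u m x \<one>\<^bsub>G m\<^esub> > 1/8 \<or> u n x' \<one>\<^bsub>G n\<^esub> > 1/4"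
        using x(3) d_less_iff(2)[OF m x(1) Gm.one_closed, of "1/8"]
          d_less_iff(2)[OF n x(2) Gn.one_closed, of "1/4"] by simp
      then show ?thesis using 2[OF x(1,2)] d_less_iff(2)[OF k Pc[OF x(1,2)] Gk.one_closed] by simp
    qed
    ultimately show ?thesis using k P unfolding joining_def by blast
  qed
  then show ?thesis
    unfolding ball_family bex_family using Phi_pos[OF de] by blast
qed

lemma wreath_d:
  assumes e: "\<epsilon> > 0"
  shows "\<exists>\<delta>>0. \<forall>(K, d)\<in>family. \<forall>A :: nat set. finite A \<and> A \<noteq> {} \<longrightarrow>
    (\<exists>(H, e)\<in>family. \<exists>P. wreath_map K d A H e \<delta> \<epsilon> (\<Phi> (1/4)) (\<Phi> (1/8)) P)"
proof -
  obtain e' where e': "e' > 0" "\<Phi> e' < \<epsilon>" using Phi_cont_ge[OF e] .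
  obtain \<delta> where de: "\<delta> > 0" and H: "\<And>n A. n > 0 \<Longrightarrow> finite A \<and> A \<noteq> {} \<Longrightarrow>
      wreath_map (G n) (u n) A (G (card A * n)) (u (card A * n)) \<delta> e' (1/4) (1/8) (W n A)"
    using wreath_u[OF e'(1)] by blast
  \<comment> \<open>In \<open>wreath_map\<close> the tolerance occurs twice: as a distance between
    labels, where \<open>\<delta>\<close> for \<open>u\<close> corresponds to
    \<open>\<Phi> \<delta>\<close> for \<open>d\<close>, and as a proportion of points, where it
    stays \<open>\<delta>\<close>.\<close>
  define \<delta>' where "\<delta>' = min (\<Phi> \<delta>) \<delta>"
  have de': "\<delta>' > 0" "\<delta>' \<le> \<delta>" "\<delta>' \<le> \<Phi> \<delta>" using de Phi_pos[OF de] by (auto simp: \<delta>'_def)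
  have W: "wreath_map (G n) (d n) A (G (card A * n)) (d (card A * n)) \<delta>' \<epsilon> (\<Phi> (1/4)) (\<Phi> (1/8)) (W n A)"
    if n: "n > 0" and A: "finite A" "A \<noteq> {}" for n and A :: "nat set"
    unfolding wreath_map_def
  proof (intro conjI ballI impI)
    show "wreath_hom (G n) A (G (card A * n)) (W n A)" by (rule W_hom[OF n A])
    have H1: "u (card A * n) (W n A x s) (W n A y t) < e'"
      if "x \<in> A \<rightarrow> carrier (G n)" "y \<in> A \<rightarrow> carrier (G n)"
        "s \<in> carrier (BijGroup A)" "t \<in> carrier (BijGroup A)"
        "real (card {a \<in> A. \<not> (s a = t a \<and> u n (x a) (y a) < \<delta>)}) < \<delta> * real (card A)" for x y s t
      using H[OF n conjI[OF A]] that unfolding wreath_map_def by blast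
    have H2: "u (card A * n) (W n A x \<one>\<^bsub>BijGroup A\<^esub>) \<one>\<^bsub>G (card A * n)\<^esub> > 1/8"
      if "x \<in> A \<rightarrow> carrier (G n)" "2 * card {a \<in> A. u n (x a) \<one>\<^bsub>G n\<^esub> > 1/4} \<ge> card A" for x
      using H[OF n conjI[OF A]] that unfolding wreath_map_def by blast
    interpret Gn: group "G n" using group n by blast
    interpret B: group "BijGroup A" by (rule group_BijGroup)
    have k: "card A * n > 0" using n A by (simp add: card_gt_0_iff)
    interpret Gk: group "G (card A * n)" using group k by blast
    have Wc: "W n A x s \<in> carrier (G (card A * n))"
      if "x \<in> A \<rightarrow> carrier (G n)" "s \<in> carrier (BijGroup A)" for x s
      using W_hom[OF n A] that unfolding wreath_hom_def by blast
    {
      fix x y s t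
      assume x: "x \<in> A \<rightarrow> carrier (G n)" and y: "y \<in> A \<rightarrow> carrier (G n)"
        and s: "s \<in> carrier (BijGroup A)" and t: "t \<in> carrier (BijGroup A)"
        and l: "real (card {a \<in> A. \<not> (s a = t a \<and> d n (x a) (y a) < \<delta>')}) < \<delta>' * real (card A)"
      have "u n (x a) (y a) < \<delta>" if "a \<in> A" "d n (x a) (y a) < \<delta>'" for a
        using that d_less_iff(1)[OF n, of "x a" "y a" \<delta>] x y de de' by (auto simp: Pi_iff)
      then have "card {a \<in> A. \<not> (s a = t a \<and> u n (x a) (y a) < \<delta>)}
          \<le> card {a \<in> A. \<not> (s a = t a \<and> d n (x a) (y a) < \<delta>')}"
        using A by (intro card_mono) auto
      moreover have "\<delta>' * real (card A) \<le> \<delta> * real (card A)" using de' by (intro mult_right_mono) auto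
      ultimately have "u (card A * n) (W n A x s) (W n A y t) < e'"
        using l by (intro H1[OF x y s t]) linarith
      then have "d (card A * n) (W n A x s) (W n A y t) < \<Phi> e'"
        using d_less_iff(1)[OF k Wc[OF x s] Wc[OF y t]] e' by simp
      then show "d (card A * n) (W n A x s) (W n A y t) < \<epsilon>" using e' by simp
    }
    fix x assume x: "x \<in> A \<rightarrow> carrier (G n)"
      and l: "2 * card {a \<in> A. d n (x a) \<one>\<^bsub>G n\<^esub> > \<Phi> (1/4)} \<ge> card A"
    have "{a \<in> A. d n (x a) \<one>\<^bsub>G n\<^esub> > \<Phi> (1/4)} = {a \<in> A. u n (x a) \<one>\<^bsub>G n\<^esub> > 1/4}"
      using d_less_iff(2)[OF n _ Gn.one_closed, of _ "1/4"] x by (auto simp: Pi_iff)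
    then have "u (card A * n) (W n A x \<one>\<^bsub>BijGroup A\<^esub>) \<one>\<^bsub>G (card A * n)\<^esub> > 1/8"
      using H2[OF x] l by simp
    then show "d (card A * n) (W n A x \<one>\<^bsub>BijGroup A\<^esub>) \<one>\<^bsub>G (card A * n)\<^esub> > \<Phi> (1/8)"
      using d_less_iff(2)[OF k Wc[OF x B.one_closed] Gk.one_closed, of "1/8"] by simp
  qed
  have "\<exists>m>0. \<exists>P. wreath_map (G n) (d n) A (G m) (d m) \<delta>' \<epsilon> (\<Phi> (1/4)) (\<Phi> (1/8)) P"
    if n: "n > 0" and A: "finite A \<and> A \<noteq> {}" for n and A :: "nat set"
    using W[OF n conjunct1[OF A] conjunct2[OF A]] n A card_gt_0_iff[of A] by (metis nat_0_less_mult_iff)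
  then show ?thesis unfolding ball_family bex_family using de'(1) by blast
qed

lemma group_family: "(K, e) \<in> family \<Longrightarrow> Group.group K"
  using group by auto

theorem permanence: "permanence_family family (\<Phi> (1/4)) (\<Phi> (1/8)) (\<Phi> (1/16))"
proof (rule permanence_family.intro)
  show "\<Phi> (1/16) > 0" by (rule Phi_pos) simp
qed (erule group_family, erule (1) amplify_d, erule product_d, erule wreath_d)

end

section \<open>Families with a multiplicative kernel\<close>

text \<open>|1 - z|^2 = 1 - 2 Re z + |z|^2. Thus in the unit disc the real part alone controls the
  distance to 1.\<close>

lemma norm_one_minus_square_le:
  fixes z :: complex assumes "cmod z \<le> 1"
  shows "(cmod (1 - z))\<^sup>2 \<le> 2 * (1 - Re z)"
proof -
  have "(Re z)\<^sup>2 + (Im z)\<^sup>2 \<le> 1" using assms by (simp add: cmod_def)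
  then show ?thesis unfolding cmod_power2 by (simp add: power2_eq_square algebra_simps)
qed

text \<open>The real part is not multiplicative, so both factors are first compared with 1 in
  modulus: the bound \<open>\<epsilon>\<^sup>2 / 8\<close> puts each within
  \<open>\<epsilon>\<close> / 2 of 1.\<close>

lemma one_minus_Re_mult_less:
  fixes z w :: complex
  assumes "cmod z \<le> 1" "cmod w \<le> 1" "\<epsilon> > 0" "1 - Re z < \<epsilon>\<^sup>2 / 8" "1 - Re w < \<epsilon>\<^sup>2 / 8"
  shows "1 - Re (z * w) < \<epsilon>"
proof -
  have h: "cmod (1 - v) < \<epsilon> / 2" if "cmod v \<le> 1" "1 - Re v < \<epsilon>\<^sup>2 / 8" for v
  proof (rule power2_less_imp_less)
    show "(cmod (1 - v))\<^sup>2 < (\<epsilon> / 2)\<^sup>2"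
      using norm_one_minus_square_le[OF that(1)] that(2) by (simp add: power_divide)
  qed (use assms in auto)
  have "1 - Re (z * w) \<le> cmod (1 - z * w)" using complex_Re_le_cmod[of "1 - z * w"] by simp
  also have "1 - z * w = (1 - z) + z * (1 - w)" by (simp add: algebra_simps)
  also have "cmod \<dots> \<le> cmod (1 - z) + cmod z * cmod (1 - w)"
    by (metis norm_mult norm_triangle_ineq)
  also have "\<dots> \<le> cmod (1 - z) + 1 * cmod (1 - w)"
    using assms by (intro add_left_mono mult_right_mono) auto
  also have "\<dots> < \<epsilon>" using h[of z] h[of w] assms by simp
  finally show ?thesis .
qed

text \<open>\<open>\<kappa>\<close> is a normalized inner product: the proportion of agreement for
  permutations, the normalized trace of x times the adjoint of y for unitary matrices. Blocks that
  two wreath elements send to different places are orthogonal, hence the 0 in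
  \<open>kernel_W\<close>.\<close>

locale kernel_family = wreath_tensor_family G T W
  for G :: "nat \<Rightarrow> 'b monoid" and T W +
  fixes d :: "nat \<Rightarrow> 'b \<Rightarrow> 'b \<Rightarrow> real" and \<Phi> :: "real \<Rightarrow> real"
    and \<kappa> :: "nat \<Rightarrow> 'b \<Rightarrow> 'b \<Rightarrow> complex"
  assumes Phi_0: "\<Phi> 0 = 0"
    and Phi_less: "0 \<le> a \<Longrightarrow> a < b \<Longrightarrow> \<Phi> a < \<Phi> b"
    and Phi_cont: "\<epsilon> > 0 \<Longrightarrow> \<exists>\<delta>>0. \<forall>a\<ge>0. a < \<delta> \<longrightarrow> \<Phi> a < \<epsilon>"
    and d_kernel: "n > 0 \<Longrightarrow> x \<in> carrier (G n) \<Longrightarrow> y \<in> carrier (G n) \<Longrightarrow> d n x y = \<Phi> (1 - Re (\<kappa> n x y))"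
    and kernel_le: "n > 0 \<Longrightarrow> x \<in> carrier (G n) \<Longrightarrow> y \<in> carrier (G n) \<Longrightarrow> cmod (\<kappa> n x y) \<le> 1"
    and kernel_refl: "n > 0 \<Longrightarrow> x \<in> carrier (G n) \<Longrightarrow> \<kappa> n x x = 1"
    and kernel_T: "m > 0 \<Longrightarrow> n > 0 \<Longrightarrow> x \<in> carrier (G m) \<Longrightarrow> x' \<in> carrier (G m) \<Longrightarrow>
      y \<in> carrier (G n) \<Longrightarrow> y' \<in> carrier (G n) \<Longrightarrow>
      \<kappa> (m * n) (T m n x y) (T m n x' y') = \<kappa> m x x' * \<kappa> n y y'"
    and kernel_W: "n > 0 \<Longrightarrow> finite A \<Longrightarrow> A \<noteq> {} \<Longrightarrow>
      l \<in> A \<rightarrow> carrier (G n) \<Longrightarrow> l' \<in> A \<rightarrow> carrier (G n) \<Longrightarrow>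
      s \<in> carrier (BijGroup A) \<Longrightarrow> t \<in> carrier (BijGroup A) \<Longrightarrow>
      of_nat (card A) * \<kappa> (card A * n) (W n A l s) (W n A l' t)
        = (\<Sum>a\<in>A. if s a = t a then \<kappa> n (l a) (l' a) else 0)"
begin

lemma T_one:
  assumes "m > 0" "n > 0"
  shows "T m n \<one>\<^bsub>G m\<^esub> \<one>\<^bsub>G n\<^esub> = \<one>\<^bsub>G (m * n)\<^esub>"
proof -
  interpret Gm: group "G m" using group assms by blast
  interpret Gn: group "G n" using group assms by blast
  interpret Gmn: group "G (m * n)" using group assms by simp
  show ?thesis
    using T_mult[OF assms, of "\<one>\<^bsub>G m\<^esub>" "\<one>\<^bsub>G m\<^esub>" "\<one>\<^bsub>G n\<^esub>" "\<one>\<^bsub>G n\<^esub>"]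
      T_closed[OF assms, of "\<one>\<^bsub>G m\<^esub>" "\<one>\<^bsub>G n\<^esub>"] by (simp add: Gmn.l_cancel_one')
qed

lemma kernel_W_one:
  assumes n: "n > 0" and A: "finite A" "A \<noteq> {}" and l: "l \<in> A \<rightarrow> carrier (G n)"
  shows "of_nat (card A) * \<kappa> (card A * n) (W n A l \<one>\<^bsub>BijGroup A\<^esub>) \<one>\<^bsub>G (card A * n)\<^esub>
    = (\<Sum>a\<in>A. \<kappa> n (l a) \<one>\<^bsub>G n\<^esub>)"
proof -
  have k: "card A * n > 0" using n A by (simp add: card_gt_0_iff)
  interpret Gn: group "G n" using group n by blast
  interpret B: group "BijGroup A" by (rule group_BijGroup)
  show ?thesis
    using kernel_W[OF n A l, of "\<lambda>_. \<one>\<^bsub>G n\<^esub>" "\<one>\<^bsub>BijGroup A\<^esub>" "\<one>\<^bsub>BijGroup A\<^esub>"]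
      wreath_hom_one[OF W_hom[OF n A] group[OF n] group[OF k]] by simp
qed

text \<open>The metric is read off from the real part of the kernel, but it is the modulus that is
  multiplicative. Hence \<open>\<rho>\<close> is 1 minus the modulus, a lower bound since Re z \<le>
  |z|.\<close>

theorem indexed_family: "indexed_family G T W d (\<lambda>n x y. 1 - Re (\<kappa> n x y)) \<Phi>
    (\<lambda>n x. 1 - cmod (\<kappa> n x \<one>\<^bsub>G n\<^esub>))"
proof (intro indexed_family.intro indexed_family_axioms.intro)
  show "wreath_tensor_family G T W" by (rule wreath_tensor_family_axioms)
  show "\<Phi> 0 = 0" by (rule Phi_0)
  show "\<Phi> a < \<Phi> b" if "0 \<le> a" "a < b" for a b using that by (rule Phi_less)
  show "\<exists>\<delta>>0. \<forall>a\<ge>0. a < \<delta> \<longrightarrow> \<Phi> a < \<epsilon>" if "\<epsilon> > 0" for \<epsilon> using that by (rule Phi_cont)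
next
  fix n :: nat and x y assume n: "n > 0" and x: "x \<in> carrier (G n)"
  interpret Gn: group "G n" using group n by blast
  show "1 - Re (\<kappa> n x x) = 0" using kernel_refl[OF n x] by simp
  show "1 - cmod (\<kappa> n x \<one>\<^bsub>G n\<^esub>) \<le> 1 - Re (\<kappa> n x \<one>\<^bsub>G n\<^esub>)" by (simp add: complex_Re_le_cmod)
  assume y: "y \<in> carrier (G n)"
  show "d n x y = \<Phi> (1 - Re (\<kappa> n x y))" using n x y by (rule d_kernel)
  have "\<bar>Re (\<kappa> n x y)\<bar> \<le> 1" using abs_Re_le_cmod kernel_le[OF n x y] by (rule order_trans)
  then show "0 \<le> 1 - Re (\<kappa> n x y)" "1 - Re (\<kappa> n x y) \<le> 2" by auto
next
  fix \<epsilon> :: real assume e: "\<epsilon> > 0"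
  show "\<exists>\<delta>>0. \<forall>m>0. \<forall>n>0. \<forall>x\<in>carrier (G m). \<forall>x'\<in>carrier (G m).
      \<forall>y\<in>carrier (G n). \<forall>y'\<in>carrier (G n). 1 - Re (\<kappa> m x x') < \<delta> \<longrightarrow> 1 - Re (\<kappa> n y y') < \<delta> \<longrightarrow>
      1 - Re (\<kappa> (m * n) (T m n x y) (T m n x' y')) < \<epsilon>"
  proof (rule exI[of _ "\<epsilon>\<^sup>2 / 8"], intro conjI allI impI ballI)
    show "\<epsilon>\<^sup>2 / 8 > 0" using e by simp
    fix m n :: nat and x x' y y'
    assume h: "m > 0" "n > 0" "x \<in> carrier (G m)" "x' \<in> carrier (G m)"
      "y \<in> carrier (G n)" "y' \<in> carrier (G n)" "1 - Re (\<kappa> m x x') < \<epsilon>\<^sup>2 / 8" "1 - Re (\<kappa> n y y') < \<epsilon>\<^sup>2 / 8"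
    show "1 - Re (\<kappa> (m * n) (T m n x y) (T m n x' y')) < \<epsilon>"
      unfolding kernel_T[OF h(1-6)] using kernel_le h e by (intro one_minus_Re_mult_less) auto
  qed
next
  fix m n :: nat and x assume m: "m > 0" and n: "n > 0"
  interpret Gm: group "G m" using group m by blast
  interpret Gn: group "G n" using group n by blast
  note o = T_one[OF m n, symmetric]
  show "1 - Re (\<kappa> n y \<one>\<^bsub>G n\<^esub>) \<le> 1 - Re (\<kappa> (m * n) (T m n \<one>\<^bsub>G m\<^esub> y) \<one>\<^bsub>G (m * n)\<^esub>)"
    if "y \<in> carrier (G n)" for y
    unfolding o using m n that by (simp add: kernel_T kernel_refl)
  assume x: "x \<in> carrier (G m)"
  show "1 - Re (\<kappa> m x \<one>\<^bsub>G m\<^esub>) \<le> 1 - Re (\<kappa> (m * n) (T m n x \<one>\<^bsub>G n\<^esub>) \<one>\<^bsub>G (m * n)\<^esub>)"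
    unfolding o using m n x by (simp add: kernel_T kernel_refl)
  fix y assume y: "y \<in> carrier (G n)"
  let ?a = "1 - cmod (\<kappa> m x \<one>\<^bsub>G m\<^esub>)" and ?b = "1 - cmod (\<kappa> n y \<one>\<^bsub>G n\<^esub>)"
  have "0 \<le> ?a * ?b" using kernel_le m n x y by (intro mult_nonneg_nonneg) auto
  \<comment> \<open>Multiplicativity gives a + b - ab exactly, which exceeds the required a + b -
    2ab by the nonnegative product ab.\<close>
  then have "?b + ?a * (1 - 2 * ?b) \<le> 1 - (1 - ?a) * (1 - ?b)" by (simp add: algebra_simps)
  also have "\<dots> = 1 - cmod (\<kappa> (m * n) (T m n x y) \<one>\<^bsub>G (m * n)\<^esub>)"
    unfolding o using m n x y by (simp add: kernel_T norm_mult)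
  finally show "?b + ?a * (1 - 2 * ?b) \<le> 1 - cmod (\<kappa> (m * n) (T m n x y) \<one>\<^bsub>G (m * n)\<^esub>)" .
next
  fix n :: nat and A :: "nat set" and l l' s t
  assume n: "n > 0" and A: "finite A" "A \<noteq> {}" and l: "l \<in> A \<rightarrow> carrier (G n)"
  have "real (card A) * (1 - Re (\<kappa> (card A * n) (W n A l \<one>\<^bsub>BijGroup A\<^esub>) \<one>\<^bsub>G (card A * n)\<^esub>))
      = real (card A) - Re (\<Sum>a\<in>A. \<kappa> n (l a) \<one>\<^bsub>G n\<^esub>)"
    unfolding kernel_W_one[OF n A l, symmetric] by (simp add: algebra_simps)
  also have "\<dots> = (\<Sum>a\<in>A. 1 - Re (\<kappa> n (l a) \<one>\<^bsub>G n\<^esub>))" by (simp add: sum_subtractf)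
  finally show "(\<Sum>a\<in>A. 1 - Re (\<kappa> n (l a) \<one>\<^bsub>G n\<^esub>))
      \<le> real (card A) * (1 - Re (\<kappa> (card A * n) (W n A l \<one>\<^bsub>BijGroup A\<^esub>) \<one>\<^bsub>G (card A * n)\<^esub>))"
    by simp
  assume l': "l' \<in> A \<rightarrow> carrier (G n)" and s: "s \<in> carrier (BijGroup A)" and t: "t \<in> carrier (BijGroup A)"
  have "real (card A) * (1 - Re (\<kappa> (card A * n) (W n A l s) (W n A l' t)))
      = real (card A) - Re (\<Sum>a\<in>A. if s a = t a then \<kappa> n (l a) (l' a) else 0)"
    unfolding kernel_W[OF n A l l' s t, symmetric] by (simp add: algebra_simps)
  also have "\<dots> = (\<Sum>a\<in>A. 1 - Re (if s a = t a then \<kappa> n (l a) (l' a) else 0))"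
    by (simp add: sum_subtractf)
  also have "\<dots> = (\<Sum>a\<in>A. if s a = t a then 1 - Re (\<kappa> n (l a) (l' a)) else 1)"
    by (intro sum.cong) auto
  finally show "real (card A) * (1 - Re (\<kappa> (card A * n) (W n A l s) (W n A l' t)))
      \<le> (\<Sum>a\<in>A. if s a = t a then 1 - Re (\<kappa> n (l a) (l' a)) else 1)" by simp
next
  fix c :: real assume c: "c > 0"
  let ?Y = "\<lambda>n x. W n {..<4} (\<lambda>a. if a = 0 then x else \<one>\<^bsub>G n\<^esub>) \<one>\<^bsub>BijGroup {..<4}\<^esub>"
  have Y: "\<kappa> (4 * n) (?Y n x) \<one>\<^bsub>G (4 * n)\<^esub> = (3 + \<kappa> n x \<one>\<^bsub>G n\<^esub>) / 4"
    if n: "n > 0" and x: "x \<in> carrier (G n)" for n x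
  proof -
    interpret Gn: group "G n" using group n by blast
    have A: "finite {..<4::nat}" "{..<4::nat} \<noteq> {}" by (auto simp: lessThan_empty_iff)
    have "4 * \<kappa> (4 * n) (?Y n x) \<one>\<^bsub>G (4 * n)\<^esub> = (\<Sum>a<4::nat. \<kappa> n (if a = 0 then x else \<one>\<^bsub>G n\<^esub>) \<one>\<^bsub>G n\<^esub>)"
      using kernel_W_one[OF n A, of "\<lambda>a. if a = 0 then x else \<one>\<^bsub>G n\<^esub>"] x by simp
    also have "\<dots> = \<kappa> n x \<one>\<^bsub>G n\<^esub> + 3" using n by (simp add: eval_nat_numeral kernel_refl)
    finally show ?thesis by (simp add: field_simps)
  qed
  have "1 - cmod ((3 + z) / 4) \<le> 1/2" if "cmod z \<le> 1" for z :: complex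
    using that norm_diff_ineq[of 3 z] by (simp add: norm_divide)
  \<comment> \<open>For |z| \<le> 1 one has |3 + z|^2 = 9 + 6 Re z + |z|^2 \<le> 10 + 6 Re z < 16 -
    6c, and division by 16 gives the radicand. The modulus of z itself could be 1 at any distance
    from 1.\<close>
  moreover have "1 - sqrt (1 - 3 * c / 8) \<le> 1 - cmod ((3 + z) / 4)" if z: "cmod z \<le> 1" "1 - Re z > c" for z
  proof -
    have "(Re z)\<^sup>2 + (Im z)\<^sup>2 \<le> 1" using z by (simp add: cmod_def)
    then have "(cmod (3 + z))\<^sup>2 \<le> 10 + 6 * Re z"
      unfolding cmod_power2 by (simp add: power2_eq_square algebra_simps)
    then have "(cmod ((3 + z) / 4))\<^sup>2 \<le> 1 - 3 * c / 8"
      using z by (simp add: norm_divide power_divide)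
    from real_le_rsqrt[OF this] show ?thesis by linarith
  qed
  moreover have "1 - sqrt (1 - 3 * c / 8) > 0" using c by simp
  moreover have "cmod (\<kappa> n x \<one>\<^bsub>G n\<^esub>) \<le> 1" if "n > 0" "x \<in> carrier (G n)" for n x
  proof -
    interpret Gn: group "G n" using group that by blast
    show ?thesis using kernel_le that by simp
  qed
  ultimately show "\<exists>\<eta>>0. \<forall>n>0. \<forall>x\<in>carrier (G n).
      1 - cmod (\<kappa> (4 * n) (?Y n x) \<one>\<^bsub>G (4 * n)\<^esub>) \<le> 1/2 \<and>
      (1 - Re (\<kappa> n x \<one>\<^bsub>G n\<^esub>) > c \<longrightarrow> \<eta> \<le> 1 - cmod (\<kappa> (4 * n) (?Y n x) \<one>\<^bsub>G (4 * n)\<^esub>))"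
    by (intro exI[of _ "1 - sqrt (1 - 3 * c / 8)"] conjI allI impI ballI) (simp_all only: Y)
qed

lemmas permanence = indexed_family.permanence[OF indexed_family]

end

section \<open>Symmetric groups\<close>

text \<open>An arbitrary but fixed numbering of a finite index set. Permutations and matrices
  indexed by pairs are described over that set and transported along the numbering, which replaces
  index arithmetic of the form a n + j.\<close>

definition enum :: "'i set \<Rightarrow> nat \<Rightarrow> 'i" where
  "enum I = (SOME b. bij_betw b {..<card I} I)"

lemma enum_bij: "finite I \<Longrightarrow> bij_betw (enum I) {..<card I} I"
  unfolding enum_def using ex_bij_betw_nat_finite[of I] unfolding atLeast0LessThan
  by (rule someI_ex)

lemma enum_mem: "finite I \<Longrightarrow> p < card I \<Longrightarrow> enum I p \<in> I"
  using enum_bij[of I] by (auto simp: bij_betw_def)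

text \<open>Conjugation by the numbering, cut off outside \<open>{..<card I}\<close> because the
  elements of \<open>BijGroup\<close> are extensional.\<close>

definition perm_on :: "'i set \<Rightarrow> ('i \<Rightarrow> 'i) \<Rightarrow> nat \<Rightarrow> nat" where
  "perm_on I f = (\<lambda>p\<in>{..<card I}. inv_into {..<card I} (enum I) (f (enum I p)))"

lemma perm_on_enum:
  assumes I: "finite I" and f: "f \<in> I \<rightarrow> I" and p: "p < card I"
  shows "perm_on I f p < card I" "enum I (perm_on I f p) = f (enum I p)"
proof -
  have e: "enum I p \<in> I" using enum_bij[OF I] p by (auto simp: bij_betw_def)
  then have "f (enum I p) \<in> enum I ` {..<card I}" using f enum_bij[OF I] by (auto simp: bij_betw_def)
  from inv_into_into[OF this] f_inv_into_f[OF this] show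
    "perm_on I f p < card I" "enum I (perm_on I f p) = f (enum I p)"
    using p by (auto simp: perm_on_def)
qed

lemma perm_on_cong: "finite I \<Longrightarrow> (\<And>i. i \<in> I \<Longrightarrow> f i = g i) \<Longrightarrow> perm_on I f = perm_on I g"
  unfolding perm_on_def by (rule restrict_ext) (simp add: enum_mem)

lemma perm_on_Bij:
  assumes I: "finite I" and f: "bij_betw f I I"
  shows "perm_on I f \<in> carrier (BijGroup {..<card I})"
proof -
  have fI: "f \<in> I \<rightarrow> I" using f by (auto simp: bij_betw_def)
  have "inj_on (perm_on I f) {..<card I}"
  proof (rule inj_onI)
    fix p q assume p: "p \<in> {..<card I}" and q: "q \<in> {..<card I}" and "perm_on I f p = perm_on I f q"
    then have "f (enum I p) = f (enum I q)" using perm_on_enum(2)[OF I fI] by (metis lessThan_iff)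
    then have "enum I p = enum I q"
      using inj_onD[OF bij_betw_imp_inj_on[OF f]] enum_mem[OF I] p q by simp
    then show "p = q" using inj_onD[OF bij_betw_imp_inj_on[OF enum_bij[OF I]]] p q by simp
  qed
  moreover have "perm_on I f ` {..<card I} \<subseteq> {..<card I}" using perm_on_enum(1)[OF I fI] by auto
  ultimately have "bij_betw (perm_on I f) {..<card I} {..<card I}"
    by (simp add: bij_betw_def endo_inj_surj)
  then show ?thesis by (auto simp: BijGroup_def Bij_def perm_on_def)
qed

lemma perm_on_comp:
  assumes I: "finite I" and f: "bij_betw f I I" and g: "bij_betw g I I"
  shows "perm_on I (\<lambda>i. f (g i)) = perm_on I f \<otimes>\<^bsub>BijGroup {..<card I}\<^esub> perm_on I g"
proof -
  have "g \<in> I \<rightarrow> I" using g by (auto simp: bij_betw_def)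
  then have "perm_on I (\<lambda>i. f (g i)) = compose {..<card I} (perm_on I f) (perm_on I g)"
    using perm_on_enum[OF I, of g] by (auto simp: fun_eq_iff compose_def perm_on_def)
  then show ?thesis
    using perm_on_Bij[OF I f] perm_on_Bij[OF I g] by (simp add: BijGroup_def)
qed

text \<open>The numbering matches the points of agreement, so Hamming distances can be counted in
  \<open>I\<close>.\<close>

lemma perm_on_agree:
  assumes I: "finite I" and f: "f \<in> I \<rightarrow> I" and g: "g \<in> I \<rightarrow> I"
  shows "card {p \<in> {..<card I}. perm_on I f p = perm_on I g p} = card {i \<in> I. f i = g i}"
proof (rule bij_betw_same_card[of "enum I"])
  have e: "inj_on (enum I) {..<card I}" "enum I ` {..<card I} = I"
    using enum_bij[OF I] by (auto simp: bij_betw_def)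
  have eq: "perm_on I f p = perm_on I g p \<longleftrightarrow> f (enum I p) = g (enum I p)" if p: "p < card I" for p
    using perm_on_enum[OF I f p] perm_on_enum[OF I g p] inj_on_eq_iff[OF e(1)] by (metis lessThan_iff)
  have "{i \<in> I. f i = g i} = enum I ` {p \<in> {..<card I}. f (enum I p) = g (enum I p)}"
  proof (intro equalityI subsetI)
    fix i assume i: "i \<in> {i \<in> I. f i = g i}"
    then have "i \<in> enum I ` {..<card I}" by (simp add: e(2))
    then show "i \<in> enum I ` {p \<in> {..<card I}. f (enum I p) = g (enum I p)}" using i by auto
  qed (use enum_mem[OF I] in auto)
  also have "{p \<in> {..<card I}. f (enum I p) = g (enum I p)}
      = {p \<in> {..<card I}. perm_on I f p = perm_on I g p}" using eq by auto
  finally have "enum I ` {p \<in> {..<card I}. perm_on I f p = perm_on I g p} = {i \<in> I. f i = g i}" by (rule sym)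
  then show "bij_betw (enum I) {p \<in> {..<card I}. perm_on I f p = perm_on I g p} {i \<in> I. f i = g i}"
    by (intro bij_betw_imageI[OF inj_on_subset[OF e(1)]]) auto
qed

section \<open>The imprimitive action of the wreath product\<close>

definition wreath_perm :: "nat \<Rightarrow> nat set \<Rightarrow> (nat \<Rightarrow> nat \<Rightarrow> nat) \<Rightarrow> (nat \<Rightarrow> nat) \<Rightarrow> nat \<Rightarrow> nat" where
  "wreath_perm n A x s = perm_on (A \<times> {..<n}) (\<lambda>(a, j). (s a, x a j))"

lemma wreath_perm_bij:
  assumes "s \<in> carrier (BijGroup A)" "\<And>a. a \<in> A \<Longrightarrow> x a \<in> carrier (BijGroup B)"
  shows "bij_betw (\<lambda>(a, j). (s a, x a j)) (A \<times> B) (A \<times> B)"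
proof -
  have s: "inj_on s A" "s ` A = A" using assms(1) by (auto simp: BijGroup_def Bij_def bij_betw_def)
  have x: "inj_on (x a) B" "x a ` B = B" if "a \<in> A" for a
    using assms(2)[OF that] by (auto simp: BijGroup_def Bij_def bij_betw_def)
  have "inj_on (\<lambda>(a, j). (s a, x a j)) (A \<times> B)"
    using s(1) x(1) by (auto simp: inj_on_def)
  moreover have "(\<lambda>(a, j). (s a, x a j)) ` (A \<times> B) = A \<times> B"
  proof (intro equalityI subsetI)
    fix z assume "z \<in> A \<times> B"
    then obtain b k where z: "z = (b, k)" "b \<in> A" "k \<in> B" by blast
    obtain a where a: "a \<in> A" "b = s a" using s(2) z(2) by blast
    obtain j where "j \<in> B" "k = x a j" using x(2)[OF a(1)] z(3) by blast
    then show "z \<in> (\<lambda>(a, j). (s a, x a j)) ` (A \<times> B)" using z a by force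
  next
    fix z assume "z \<in> (\<lambda>(a, j). (s a, x a j)) ` (A \<times> B)"
    then obtain a j where z: "z = (s a, x a j)" "a \<in> A" "j \<in> B" by auto
    then show "z \<in> A \<times> B" using s(2) x(2)[OF z(2)] by blast
  qed
  ultimately show ?thesis by (simp add: bij_betw_def)
qed

lemma wreath_perm_hom:
  assumes A: "finite A"
  shows "wreath_hom (BijGroup {..<n}) A (BijGroup {..<card A * n}) (wreath_perm n A)"
  unfolding wreath_hom_def
proof (intro conjI ballI)
  have I: "finite (A \<times> {..<n})" "card (A \<times> {..<n}) = card A * n" using A by simp_all
  fix x s assume x: "x \<in> A \<rightarrow> carrier (BijGroup {..<n})" and s: "s \<in> carrier (BijGroup A)"
  have bx: "bij_betw (\<lambda>(a, j). (s a, x a j)) (A \<times> {..<n}) (A \<times> {..<n})"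
    using x s by (intro wreath_perm_bij) auto
  show "wreath_perm n A x s \<in> carrier (BijGroup {..<card A * n})"
    using perm_on_Bij[OF I(1) bx] I(2) by (simp add: wreath_perm_def)
  fix y t assume y: "y \<in> A \<rightarrow> carrier (BijGroup {..<n})" and t: "t \<in> carrier (BijGroup A)"
  have bij: "bij_betw (\<lambda>(a, j). (t a, y a j)) (A \<times> {..<n}) (A \<times> {..<n})"
    using y t by (intro wreath_perm_bij) auto
  have tA: "t a \<in> A" if "a \<in> A" for a using t that by (auto simp: BijGroup_def Bij_def bij_betw_def)
  have "wreath_perm n A (\<lambda>a. x (t a) \<otimes>\<^bsub>BijGroup {..<n}\<^esub> y a) (s \<otimes>\<^bsub>BijGroup A\<^esub> t)
      = perm_on (A \<times> {..<n}) (\<lambda>z. (\<lambda>(a, j). (s a, x a j)) ((\<lambda>(a, j). (t a, y a j)) z))"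
    unfolding wreath_perm_def
  proof (rule perm_on_cong[OF I(1)])
    fix z assume "z \<in> A \<times> {..<n}"
    then obtain a j where z: "z = (a, j)" "a \<in> A" "j < n" by blast
    have "x (t a) \<in> Bij {..<n}" "y a \<in> Bij {..<n}" "s \<in> Bij A" "t \<in> Bij A"
      using x y s t z tA by (auto simp: BijGroup_def Pi_iff)
    then show "(case z of (a, j) \<Rightarrow> ((s \<otimes>\<^bsub>BijGroup A\<^esub> t) a, (x (t a) \<otimes>\<^bsub>BijGroup {..<n}\<^esub> y a) j))
        = (\<lambda>(a, j). (s a, x a j)) ((\<lambda>(a, j). (t a, y a j)) z)"
      using z by (simp add: BijGroup_def compose_def)
  qed
  also have "\<dots> = wreath_perm n A x s \<otimes>\<^bsub>BijGroup {..<card A * n}\<^esub> wreath_perm n A y t"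
    unfolding perm_on_comp[OF I(1) bx bij] by (simp add: wreath_perm_def I(2))
  finally show "wreath_perm n A (\<lambda>a. x (t a) \<otimes>\<^bsub>BijGroup {..<n}\<^esub> y a) (s \<otimes>\<^bsub>BijGroup A\<^esub> t)
      = wreath_perm n A x s \<otimes>\<^bsub>BijGroup {..<card A * n}\<^esub> wreath_perm n A y t" .
qed

text \<open>For permutations, this is the normalized trace of the permutation matrix of
  \<open>\<sigma>\<close> composed with the inverse of \<open>\<tau>\<close>; it is complex in order
  to fit \<open>kernel_family\<close>.\<close>

definition agreement :: "nat \<Rightarrow> (nat \<Rightarrow> nat) \<Rightarrow> (nat \<Rightarrow> nat) \<Rightarrow> complex" where
  "agreement n \<sigma> \<tau> = of_nat (card {p \<in> {..<n}. \<sigma> p = \<tau> p}) / of_nat n"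

text \<open>Agreement at (a, j) means that the points s a and t a coincide and that the labels agree
  at j. So the fibre over a contributes either the agreement of its labels or nothing.\<close>

lemma agreement_wreath_perm:
  assumes A: "finite A" and n: "n > 0"
    and x: "x \<in> A \<rightarrow> carrier (BijGroup {..<n})" and y: "y \<in> A \<rightarrow> carrier (BijGroup {..<n})"
    and s: "s \<in> carrier (BijGroup A)" and t: "t \<in> carrier (BijGroup A)"
  shows "of_nat (card A) * agreement (card A * n) (wreath_perm n A x s) (wreath_perm n A y t)
    = (\<Sum>a\<in>A. if s a = t a then agreement n (x a) (y a) else 0)"
proof (cases "A = {}")
  case False
  then have cA: "card A > 0" using A by (simp add: card_gt_0_iff)
  have I: "finite (A \<times> {..<n})" "card (A \<times> {..<n}) = card A * n" using A by simp_all
  have mem: "(\<lambda>(a, j). (s a, x a j)) \<in> A \<times> {..<n} \<rightarrow> A \<times> {..<n}"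
    if "x \<in> A \<rightarrow> carrier (BijGroup {..<n})" "s \<in> carrier (BijGroup A)" for x s
    by (rule bij_betw_imp_funcset[OF wreath_perm_bij[OF that(2)]]) (use that(1) in blast)
  have "card {p \<in> {..<card A * n}. wreath_perm n A x s p = wreath_perm n A y t p}
      = card {z \<in> A \<times> {..<n}. (\<lambda>(a, j). (s a, x a j)) z = (\<lambda>(a, j). (t a, y a j)) z}"
    using perm_on_agree[OF I(1) mem[OF x s] mem[OF y t]] unfolding I(2) wreath_perm_def .
  also have "{z \<in> A \<times> {..<n}. (\<lambda>(a, j). (s a, x a j)) z = (\<lambda>(a, j). (t a, y a j)) z}
      = (SIGMA a:A. {j \<in> {..<n}. s a = t a \<and> x a j = y a j})" by auto
  also have "card \<dots> = (\<Sum>a\<in>A. card {j \<in> {..<n}. s a = t a \<and> x a j = y a j})"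
    using A by (intro card_SigmaI) auto
  also have "\<dots> = (\<Sum>a\<in>A. if s a = t a then card {j \<in> {..<n}. x a j = y a j} else 0)"
    by (intro sum.cong) auto
  finally have "of_nat (card A) * agreement (card A * n) (wreath_perm n A x s) (wreath_perm n A y t)
      = of_nat (\<Sum>a\<in>A. if s a = t a then card {j \<in> {..<n}. x a j = y a j} else 0) / of_nat n"
    unfolding agreement_def using cA by simp
  also have "\<dots> = (\<Sum>a\<in>A. if s a = t a then agreement n (x a) (y a) else 0)"
    unfolding agreement_def of_nat_sum sum_divide_distrib by (intro sum.cong) simp_all
  finally show ?thesis .
qed simp

text \<open>The product action of x and y on pairs is the imprimitive action with constant label y.
  Its points of agreement form a product set, which makes \<open>agreement\<close>
  multiplicative.\<close>

lemma kernel_family_Sym: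
  "kernel_family (\<lambda>n. BijGroup {..<n}) (\<lambda>m n x y. wreath_perm n {..<m} (\<lambda>_. y) x) wreath_perm
    (\<lambda>n. hamming {..<n}) (\<lambda>a. a) agreement"
proof (intro kernel_family.intro wreath_tensor_family.intro kernel_family_axioms.intro)
  fix n :: nat
  show "group (BijGroup {..<n})" by (rule group_BijGroup)
  show "wreath_hom (BijGroup {..<n}) A (BijGroup {..<card A * n}) (wreath_perm n A)"
    if "finite A" for A using that by (rule wreath_perm_hom)
  show "wreath_perm n A l s = wreath_perm n A l' s"
    if "finite A" "\<And>a. a \<in> A \<Longrightarrow> l a = l' a" for A l l' s
    unfolding wreath_perm_def using that by (intro perm_on_cong) auto
  show "of_nat (card A) * agreement (card A * n) (wreath_perm n A l s) (wreath_perm n A l' t)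
        = (\<Sum>a\<in>A. if s a = t a then agreement n (l a) (l' a) else 0)"
    if "n > 0" "finite A" "l \<in> A \<rightarrow> carrier (BijGroup {..<n})" "l' \<in> A \<rightarrow> carrier (BijGroup {..<n})"
      "s \<in> carrier (BijGroup A)" "t \<in> carrier (BijGroup A)" for A l l' s t
    using that by (intro agreement_wreath_perm)
next
  fix m n :: nat and x x' y y'
  assume m: "m > 0" and n: "n > 0" and x: "x \<in> carrier (BijGroup {..<m})"
    and y: "y \<in> carrier (BijGroup {..<n})"
  note wh = wreath_perm_hom[of "{..<m}" n, unfolded wreath_hom_def]
  have cy: "(\<lambda>_. y) \<in> {..<m} \<rightarrow> carrier (BijGroup {..<n})" using y by simp
  show "wreath_perm n {..<m} (\<lambda>_. y) x \<in> carrier (BijGroup {..<m * n})"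
    using conjunct1[OF wh, rule_format, OF _ cy x] by simp
  assume x': "x' \<in> carrier (BijGroup {..<m})" and y': "y' \<in> carrier (BijGroup {..<n})"
  have cy': "(\<lambda>_. y') \<in> {..<m} \<rightarrow> carrier (BijGroup {..<n})" using y' by simp
  show "wreath_perm n {..<m} (\<lambda>_. y \<otimes>\<^bsub>BijGroup {..<n}\<^esub> y') (x \<otimes>\<^bsub>BijGroup {..<m}\<^esub> x')
      = wreath_perm n {..<m} (\<lambda>_. y) x \<otimes>\<^bsub>BijGroup {..<m * n}\<^esub> wreath_perm n {..<m} (\<lambda>_. y') x'"
    using conjunct2[OF wh, rule_format, OF _ cy cy' x x'] by simp
  have "of_nat m * agreement (m * n) (wreath_perm n {..<m} (\<lambda>_. y) x) (wreath_perm n {..<m} (\<lambda>_. y') x')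
      = (\<Sum>a<m. if x a = x' a then agreement n y y' else 0)"
    using agreement_wreath_perm[OF _ n cy cy' x x'] by simp
  also have "\<dots> = of_nat (card {a \<in> {..<m}. x a = x' a}) * agreement n y y'"
    by (simp add: sum.If_cases Int_def)
  also have "\<dots> = of_nat m * (agreement m x x' * agreement n y y')"
    using m by (simp add: agreement_def[of m])
  finally show "agreement (m * n) (wreath_perm n {..<m} (\<lambda>_. y) x) (wreath_perm n {..<m} (\<lambda>_. y') x')
      = agreement m x x' * agreement n y y'" using m by simp
next
  fix n :: nat and x y assume n: "n > 0"
  show "hamming {..<n} x y = 1 - Re (agreement n x y)"
    by (simp add: hamming_def agreement_def flip: of_nat_mult)
  show "agreement n x x = 1" using n by (simp add: agreement_def)
  have "card {p \<in> {..<n}. x p = y p} \<le> card {..<n}" by (intro card_mono) auto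
  then show "cmod (agreement n x y) \<le> 1" using n by (simp add: agreement_def norm_divide)
qed (auto intro: exI)

lemmas permanence_Sym = kernel_family.permanence[OF kernel_family_Sym]

section \<open>Matrices over finite index sets\<close>

text \<open>All matrices over \<open>I\<close> use the same numbering, so products, differences and
  adjoints can be computed with indices in \<open>I\<close>.\<close>

definition fmat :: "'i set \<Rightarrow> ('i \<Rightarrow> 'i \<Rightarrow> 'k) \<Rightarrow> 'k mat" where
  "fmat I F = mat (card I) (card I) (\<lambda>(p, q). F (enum I p) (enum I q))"

lemma fmat_carrier [simp]: "fmat I F \<in> carrier_mat (card I) (card I)"
  by (simp add: fmat_def)

lemma dim_fmat [simp]: "dim_row (fmat I F) = card I" "dim_col (fmat I F) = card I"
  by (simp_all add: fmat_def)

lemma fmat_index [simp]: "p < card I \<Longrightarrow> q < card I \<Longrightarrow> fmat I F $$ (p, q) = F (enum I p) (enum I q)"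
  by (simp add: fmat_def)

lemma fmat_cong: "finite I \<Longrightarrow> (\<And>i j. i \<in> I \<Longrightarrow> j \<in> I \<Longrightarrow> F i j = F' i j) \<Longrightarrow> fmat I F = fmat I F'"
  by (rule eq_matI) (simp_all add: fmat_def enum_mem)

lemma sum_enum: "finite I \<Longrightarrow> (\<Sum>p<card I. h (enum I p)) = sum h I"
  by (rule sum.reindex_bij_betw[OF enum_bij])

lemma fmat_mult:
  fixes F F' :: "'i \<Rightarrow> 'i \<Rightarrow> 'k::semiring_0"
  assumes "finite I"
  shows "fmat I F * fmat I F' = fmat I (\<lambda>i j. \<Sum>k\<in>I. F i k * F' k j)"
proof (rule eq_matI)
  fix p q assume "p < dim_row (fmat I (\<lambda>i j. \<Sum>k\<in>I. F i k * F' k j))"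
    "q < dim_col (fmat I (\<lambda>i j. \<Sum>k\<in>I. F i k * F' k j))"
  then have p: "p < card I" "q < card I" by (simp_all add: fmat_def)
  have "(fmat I F * fmat I F') $$ (p, q) = (\<Sum>r<card I. F (enum I p) (enum I r) * F' (enum I r) (enum I q))"
    using p by (simp add: fmat_def scalar_prod_def atLeast0LessThan)
  also have "\<dots> = (\<Sum>k\<in>I. F (enum I p) k * F' k (enum I q))"
    using sum_enum[OF assms, of "\<lambda>k. F (enum I p) k * F' k (enum I q)"] .
  finally show "(fmat I F * fmat I F') $$ (p, q) = fmat I (\<lambda>i j. \<Sum>k\<in>I. F i k * F' k j) $$ (p, q)"
    using p by simp
qed (simp_all add: fmat_def)

lemma fmat_one:
  assumes "finite I" shows "fmat I (\<lambda>i j. if i = j then 1 else 0) = 1\<^sub>m (card I)"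
proof (rule eq_matI)
  fix p q assume "p < dim_row (1\<^sub>m (card I))" "q < dim_col (1\<^sub>m (card I))"
  then show "fmat I (\<lambda>i j. if i = j then 1 else 0) $$ (p, q) = 1\<^sub>m (card I) $$ (p, q)"
    using inj_on_eq_iff[OF bij_betw_imp_inj_on[OF enum_bij[OF assms]], of p q] by simp
qed (simp_all add: fmat_def)

section \<open>Tensor products and monomial block matrices\<close>

lemma mat_mult_index:
  fixes A B :: "'k::semiring_0 mat"
  assumes "A \<in> carrier_mat n n" "B \<in> carrier_mat n n" "i < n" "j < n"
  shows "(A * B) $$ (i, j) = (\<Sum>k<n. A $$ (i, k) * B $$ (k, j))"
  using assms by (simp add: scalar_prod_def atLeast0LessThan)

definition tensor_mat :: "nat \<Rightarrow> nat \<Rightarrow> 'k::comm_ring_1 mat \<Rightarrow> 'k mat \<Rightarrow> 'k mat" where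
  "tensor_mat m n x y = fmat ({..<m} \<times> {..<n}) (\<lambda>(i, k) (j, l). x $$ (i, j) * y $$ (k, l))"

text \<open>The column block b has a single block that may be nonzero, x b, in the row block s b:
  the label sits at the source, as in \<open>wreath_hom\<close>.\<close>

definition wreath_mat :: "nat \<Rightarrow> nat set \<Rightarrow> (nat \<Rightarrow> 'k::comm_ring_1 mat) \<Rightarrow> (nat \<Rightarrow> nat) \<Rightarrow> 'k mat" where
  "wreath_mat n A x s = fmat (A \<times> {..<n}) (\<lambda>(a, i) (b, j). if a = s b then x b $$ (i, j) else 0)"

lemma tensor_mat_carrier [simp]: "tensor_mat m n x y \<in> carrier_mat (m * n) (m * n)"
  using fmat_carrier[of "{..<m} \<times> {..<n}"] by (simp add: tensor_mat_def)

lemma wreath_mat_carrier [simp]: "finite A \<Longrightarrow> wreath_mat n A x s \<in> carrier_mat (card A * n) (card A * n)"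
  using fmat_carrier[of "A \<times> {..<n}"] by (simp add: wreath_mat_def)

lemma tensor_mat_mult:
  assumes x: "x \<in> carrier_mat m m" "x' \<in> carrier_mat m m" and y: "y \<in> carrier_mat n n" "y' \<in> carrier_mat n n"
  shows "tensor_mat m n (x * x') (y * y') = tensor_mat m n x y * tensor_mat m n x' y'"
  unfolding tensor_mat_def fmat_mult[OF finite_cartesian_product[OF finite_lessThan finite_lessThan]]
proof (rule fmat_cong)
  fix z w assume "z \<in> {..<m} \<times> {..<n}" "w \<in> {..<m} \<times> {..<n}"
  then obtain i k j l where z: "z = (i, k)" "w = (j, l)" "i < m" "k < n" "j < m" "l < n" by blast
  have "(x * x') $$ (i, j) * (y * y') $$ (k, l)
      = (\<Sum>a<m. \<Sum>b<n. x $$ (i, a) * x' $$ (a, j) * (y $$ (k, b) * y' $$ (b, l)))"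
    using z by (simp only: mat_mult_index[OF x] mat_mult_index[OF y] sum_product)
  also have "\<dots> = (\<Sum>(a, b)\<in>{..<m} \<times> {..<n}. x $$ (i, a) * y $$ (k, b) * (x' $$ (a, j) * y' $$ (b, l)))"
    by (simp add: sum.cartesian_product[symmetric] mult_ac)
  finally show "(case z of (i, k) \<Rightarrow> \<lambda>(j, l). (x * x') $$ (i, j) * (y * y') $$ (k, l)) w =
      (\<Sum>c\<in>{..<m} \<times> {..<n}. (case z of (i, k) \<Rightarrow> \<lambda>(j, l). x $$ (i, j) * y $$ (k, l)) c *
        (case c of (i, k) \<Rightarrow> \<lambda>(j, l). x' $$ (i, j) * y' $$ (k, l)) w)"
    using z by (simp add: case_prod_unfold)
qed simp

lemma tensor_mat_one: "tensor_mat m n (1\<^sub>m m) (1\<^sub>m n) = 1\<^sub>m (m * n)"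
proof -
  have "tensor_mat m n (1\<^sub>m m) (1\<^sub>m n) = fmat ({..<m} \<times> {..<n}) (\<lambda>z w. if z = w then 1 else 0)"
    unfolding tensor_mat_def by (intro fmat_cong) (auto split: if_split_asm)
  then show ?thesis by (simp add: fmat_one)
qed

lemma BijGroup_apply:
  assumes "s \<in> carrier (BijGroup A)"
  shows "a \<in> A \<Longrightarrow> s a \<in> A"
    and "t \<in> carrier (BijGroup A) \<Longrightarrow> a \<in> A \<Longrightarrow> (s \<otimes>\<^bsub>BijGroup A\<^esub> t) a = s (t a)"
    and "a \<in> A \<Longrightarrow> (inv\<^bsub>BijGroup A\<^esub> s) (s a) = a"
    and "a \<in> A \<Longrightarrow> s ((inv\<^bsub>BijGroup A\<^esub> s) a) = a"
proof -
  interpret B: group "BijGroup A" by (rule group_BijGroup)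
  have m: "(u \<otimes>\<^bsub>BijGroup A\<^esub> t) a = u (t a)"
    if "u \<in> carrier (BijGroup A)" "t \<in> carrier (BijGroup A)" "a \<in> A" for u t a
    using that by (simp add: BijGroup_def compose_def)
  have o: "\<one>\<^bsub>BijGroup A\<^esub> a = a" if "a \<in> A" for a using that by (simp add: BijGroup_def)
  show "a \<in> A \<Longrightarrow> s a \<in> A" using assms by (auto simp: BijGroup_def Bij_def bij_betw_def)
  show "t \<in> carrier (BijGroup A) \<Longrightarrow> a \<in> A \<Longrightarrow> (s \<otimes>\<^bsub>BijGroup A\<^esub> t) a = s (t a)"
    using assms by (rule m)
  show "a \<in> A \<Longrightarrow> (inv\<^bsub>BijGroup A\<^esub> s) (s a) = a"
    using m[OF B.inv_closed[OF assms] assms] o B.l_inv[OF assms] by simp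
  show "a \<in> A \<Longrightarrow> s ((inv\<^bsub>BijGroup A\<^esub> s) a) = a"
    using m[OF assms B.inv_closed[OF assms]] o B.r_inv[OF assms] by simp
qed

lemma wreath_mat_mult:
  assumes A: "finite A" and x: "\<And>a. a \<in> A \<Longrightarrow> x a \<in> carrier_mat n n"
    and y: "\<And>a. a \<in> A \<Longrightarrow> y a \<in> carrier_mat n n"
    and s: "s \<in> carrier (BijGroup A)" and t: "t \<in> carrier (BijGroup A)"
  shows "wreath_mat n A (\<lambda>a. x (t a) * y a) (s \<otimes>\<^bsub>BijGroup A\<^esub> t) = wreath_mat n A x s * wreath_mat n A y t"
  unfolding wreath_mat_def fmat_mult[OF finite_cartesian_product[OF A finite_lessThan]]
proof (rule fmat_cong)
  fix z w assume "z \<in> A \<times> {..<n}" "w \<in> A \<times> {..<n}"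
  then obtain a i b j where z: "z = (a, i)" "w = (b, j)" "a \<in> A" "i < n" "b \<in> A" "j < n" by blast
  have tb: "t b \<in> A" using BijGroup_apply(1)[OF t] z by blast
  have "(\<Sum>(c, k)\<in>A \<times> {..<n}. (if a = s c then x c $$ (i, k) else 0) * (if c = t b then y b $$ (k, j) else 0))
      = (\<Sum>c\<in>A. if c = t b then (if a = s c then (\<Sum>k<n. x c $$ (i, k) * y b $$ (k, j)) else 0) else 0)"
    unfolding sum.cartesian_product[symmetric] by (intro sum.cong) auto
  \<comment> \<open>Column block b of the second factor is supported in row block t b, so a single
    intermediate block survives, with labels x (t b) and y b.\<close>
  also have "\<dots> = (if a = s (t b) then (\<Sum>k<n. x (t b) $$ (i, k) * y b $$ (k, j)) else 0)"
    using A tb by (simp add: sum.delta')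
  also have "\<dots> = (if a = (s \<otimes>\<^bsub>BijGroup A\<^esub> t) b then (x (t b) * y b) $$ (i, j) else 0)"
    unfolding BijGroup_apply(2)[OF s t z(5)] mat_mult_index[OF x[OF tb] y[OF z(5)] z(4,6)] by simp
  finally show "(case z of (a, i) \<Rightarrow> \<lambda>(b, j). if a = (s \<otimes>\<^bsub>BijGroup A\<^esub> t) b then (x (t b) * y b) $$ (i, j) else 0) w =
      (\<Sum>c\<in>A \<times> {..<n}. (case z of (a, i) \<Rightarrow> \<lambda>(b, j). if a = s b then x b $$ (i, j) else 0) c *
        (case c of (a, i) \<Rightarrow> \<lambda>(b, j). if a = t b then y b $$ (i, j) else 0) w)"
    unfolding z case_prod_unfold fst_conv snd_conv by (rule sym)
qed (simp add: A)

lemma wreath_mat_cong: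
  "finite A \<Longrightarrow> (\<And>a. a \<in> A \<Longrightarrow> x a = x' a) \<Longrightarrow> wreath_mat n A x s = wreath_mat n A x' s"
  unfolding wreath_mat_def by (intro fmat_cong) auto

lemma wreath_mat_one:
  assumes "finite A" "\<And>a. a \<in> A \<Longrightarrow> x a = 1\<^sub>m n"
  shows "wreath_mat n A x \<one>\<^bsub>BijGroup A\<^esub> = 1\<^sub>m (card A * n)"
proof -
  have "wreath_mat n A x \<one>\<^bsub>BijGroup A\<^esub> = fmat (A \<times> {..<n}) (\<lambda>z w. if z = w then 1 else 0)"
    unfolding wreath_mat_def using assms by (intro fmat_cong) (auto simp: BijGroup_def split: if_split_asm)
  then show ?thesis using assms by (simp add: fmat_one card_cartesian_product)
qed

section \<open>Invertibility of tensor products and monomial block matrices\<close>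

lemma GL_simps [simp]: "monoid.mult (GL ty n) = (*)" "one (GL ty n) = 1\<^sub>m n"
  by (auto simp: GL_def units_of_def ring_mat_def)

lemma GL_carrier_iff:
  "x \<in> carrier (GL (ty :: 'k::field itself) n) \<longleftrightarrow>
    x \<in> carrier_mat n n \<and> (\<exists>y\<in>carrier_mat n n. y * x = 1\<^sub>m n \<and> x * y = 1\<^sub>m n)"
  by (auto simp: GL_def units_of_def Units_def ring_mat_def)

lemma group_GL: "group (GL (ty :: 'k::field itself) n)"
proof -
  interpret R: semiring "ring_mat ty n ()" using semiring_mat[where 'a = 'k] by (simp add: ring_mat_def)
  show ?thesis unfolding GL_def by (rule R.units_group)
qed

lemma tensor_mat_GL:
  assumes "x \<in> carrier (GL (ty :: 'k::field itself) m)" "y \<in> carrier (GL ty n)"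
  shows "tensor_mat m n x y \<in> carrier (GL ty (m * n))"
proof -
  obtain x' y' where x: "x \<in> carrier_mat m m" "x' \<in> carrier_mat m m" "x' * x = 1\<^sub>m m" "x * x' = 1\<^sub>m m"
    and y: "y \<in> carrier_mat n n" "y' \<in> carrier_mat n n" "y' * y = 1\<^sub>m n" "y * y' = 1\<^sub>m n"
    using assms unfolding GL_carrier_iff by blast
  show ?thesis unfolding GL_carrier_iff
    using tensor_mat_mult[OF x(1,2) y(1,2)] tensor_mat_mult[OF x(2,1) y(2,1)] x y
    by (auto simp: tensor_mat_one intro!: bexI[of _ "tensor_mat m n x' y'"])
qed

text \<open>The inverse belongs to the inverse permutation t and has at a the inverse of x (t a),
  the label of the block that s sends to a.\<close>

lemma wreath_mat_GL:
  assumes A: "finite A" and x: "x \<in> A \<rightarrow> carrier (GL (ty :: 'k::field itself) n)"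
    and s: "s \<in> carrier (BijGroup A)"
  shows "wreath_mat n A x s \<in> carrier (GL ty (card A * n))"
proof -
  interpret B: group "BijGroup A" by (rule group_BijGroup)
  let ?t = "inv\<^bsub>BijGroup A\<^esub> s"
  have t: "?t \<in> carrier (BijGroup A)" using s by simp
  have tA: "?t a \<in> A" if "a \<in> A" for a using BijGroup_apply(1)[OF t that] .
  have "\<forall>a\<in>A. \<exists>y. y \<in> carrier_mat n n \<and> y * x a = 1\<^sub>m n \<and> x a * y = 1\<^sub>m n"
    using x unfolding Pi_iff GL_carrier_iff by blast
  then obtain y where y: "\<And>a. a \<in> A \<Longrightarrow> y a \<in> carrier_mat n n" "\<And>a. a \<in> A \<Longrightarrow> y a * x a = 1\<^sub>m n"
    "\<And>a. a \<in> A \<Longrightarrow> x a * y a = 1\<^sub>m n" by metis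
  have xc: "x a \<in> carrier_mat n n" if "a \<in> A" for a using x that unfolding Pi_iff GL_carrier_iff by blast
  have "wreath_mat n A (\<lambda>a. x (?t a) * y (?t a)) (s \<otimes>\<^bsub>BijGroup A\<^esub> ?t)
      = wreath_mat n A x s * wreath_mat n A (\<lambda>a. y (?t a)) ?t"
    using A xc y(1) tA s t by (intro wreath_mat_mult) auto
  moreover have "wreath_mat n A (\<lambda>a. y (?t (s a)) * x a) (?t \<otimes>\<^bsub>BijGroup A\<^esub> s)
      = wreath_mat n A (\<lambda>a. y (?t a)) ?t * wreath_mat n A x s"
    using A xc y(1) tA s t by (intro wreath_mat_mult) auto
  moreover have "wreath_mat n A (\<lambda>a. x (?t a) * y (?t a)) \<one>\<^bsub>BijGroup A\<^esub> = 1\<^sub>m (card A * n)"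
    using A y(3) tA by (intro wreath_mat_one) auto
  moreover have "wreath_mat n A (\<lambda>a. y (?t (s a)) * x a) \<one>\<^bsub>BijGroup A\<^esub> = 1\<^sub>m (card A * n)"
    using A y(2) BijGroup_apply(3)[OF s] by (intro wreath_mat_one) auto
  ultimately have "wreath_mat n A (\<lambda>a. y (?t a)) ?t * wreath_mat n A x s = 1\<^sub>m (card A * n)"
    "wreath_mat n A x s * wreath_mat n A (\<lambda>a. y (?t a)) ?t = 1\<^sub>m (card A * n)"
    using s by simp_all
  then show ?thesis
    unfolding GL_carrier_iff using A by (intro conjI bexI[of _ "wreath_mat n A (\<lambda>a. y (?t a)) ?t"]) simp_all
qed

lemma wreath_tensor_family_GL: "wreath_tensor_family (GL (ty :: 'k::field itself)) tensor_mat wreath_mat"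
proof (rule wreath_tensor_family.intro)
  have c: "x \<in> carrier (GL ty n) \<Longrightarrow> x \<in> carrier_mat n n" for x :: "'k mat" and n
    unfolding GL_carrier_iff by blast
  show "group (GL ty n)" for n by (rule group_GL)
  show "tensor_mat m n x y \<in> carrier (GL ty (m * n))"
    if "x \<in> carrier (GL ty m)" "y \<in> carrier (GL ty n)" for m n and x y :: "'k mat"
    using that by (rule tensor_mat_GL)
  show "tensor_mat m n (x \<otimes>\<^bsub>GL ty m\<^esub> x') (y \<otimes>\<^bsub>GL ty n\<^esub> y')
      = tensor_mat m n x y \<otimes>\<^bsub>GL ty (m * n)\<^esub> tensor_mat m n x' y'"
    if "x \<in> carrier (GL ty m)" "x' \<in> carrier (GL ty m)" "y \<in> carrier (GL ty n)" "y' \<in> carrier (GL ty n)"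
    for m n and x x' y y' :: "'k mat"
    using that c by (simp add: tensor_mat_mult)
  show "wreath_hom (GL ty n) A (GL ty (card A * n)) (wreath_mat n A)" if A: "finite A" for n A
    unfolding wreath_hom_def
  proof (intro conjI ballI)
    fix x s assume x: "x \<in> A \<rightarrow> carrier (GL ty n)" and s: "s \<in> carrier (BijGroup A)"
    show "wreath_mat n A x s \<in> carrier (GL ty (card A * n))" using A x s by (rule wreath_mat_GL)
    fix y t assume y: "y \<in> A \<rightarrow> carrier (GL ty n)" and t: "t \<in> carrier (BijGroup A)"
    show "wreath_mat n A (\<lambda>a. x (t a) \<otimes>\<^bsub>GL ty n\<^esub> y a) (s \<otimes>\<^bsub>BijGroup A\<^esub> t)
        = wreath_mat n A x s \<otimes>\<^bsub>GL ty (card A * n)\<^esub> wreath_mat n A y t"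
      unfolding GL_simps using x y c by (intro wreath_mat_mult[OF A _ _ s t]) auto
  qed
  show "wreath_mat n A l s = wreath_mat n A l' s"
    if "finite A" "\<And>a. a \<in> A \<Longrightarrow> l a = l' a" for n A s and l l' :: "nat \<Rightarrow> 'k mat"
    using that by (rule wreath_mat_cong)
qed

section \<open>Unitary groups\<close>

lemma sum_swap_mult:
  "(\<Sum>(i, k)\<in>A \<times> B. \<Sum>(j, l)\<in>A \<times> B. f i j * g k l)
    = (\<Sum>i\<in>A. \<Sum>j\<in>A. f i j) * (\<Sum>k\<in>B. \<Sum>l\<in>B. g k l :: 'k::comm_semiring_0)"
proof -
  have "(\<Sum>(i, k)\<in>A \<times> B. \<Sum>(j, l)\<in>A \<times> B. f i j * g k l) = (\<Sum>i\<in>A. \<Sum>k\<in>B. (\<Sum>j\<in>A. f i j) * (\<Sum>l\<in>B. g k l))"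
    by (simp add: sum.cartesian_product[symmetric] sum_product)
  then show ?thesis by (simp add: sum_product)
qed

lemma unitary_simps [simp]: "monoid.mult (unitary_group n) = (*)" "one (unitary_group n) = 1\<^sub>m n"
  by (simp_all add: unitary_group_def)

lemma unitary_carrier_iff:
  "U \<in> carrier (unitary_group n) \<longleftrightarrow>
    U \<in> carrier_mat n n \<and> U * mat_adjoint U = 1\<^sub>m n \<and> mat_adjoint U * U = 1\<^sub>m n"
  by (simp add: unitary_group_def)

lemma mat_adjoint_index:
  assumes "U \<in> carrier_mat n n" "i < n" "j < n"
  shows "mat_adjoint U $$ (i, j) = cnj (U $$ (j, i))"
  using assms by (simp add: mat_adjoint_def mat_of_rows_def)

lemma mat_adjoint_carrier: "U \<in> carrier_mat n n \<Longrightarrow> mat_adjoint U \<in> carrier_mat n n"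
  unfolding mat_adjoint_def by auto

lemma mat_adjoint_mult:
  fixes U V :: "complex mat"
  assumes U: "U \<in> carrier_mat n n" and V: "V \<in> carrier_mat n n"
  shows "mat_adjoint (U * V) = mat_adjoint V * mat_adjoint U"
proof (rule eq_matI)
  have UV: "U * V \<in> carrier_mat n n" using U V by simp
  note c = mat_adjoint_carrier[OF U] mat_adjoint_carrier[OF V] mat_adjoint_carrier[OF UV]
  show "dim_row (mat_adjoint (U * V)) = dim_row (mat_adjoint V * mat_adjoint U)"
    "dim_col (mat_adjoint (U * V)) = dim_col (mat_adjoint V * mat_adjoint U)" using c by auto
  fix i j assume "i < dim_row (mat_adjoint V * mat_adjoint U)" "j < dim_col (mat_adjoint V * mat_adjoint U)"
  then have i: "i < n" "j < n" using c by auto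
  show "mat_adjoint (U * V) $$ (i, j) = (mat_adjoint V * mat_adjoint U) $$ (i, j)"
    unfolding mat_adjoint_index[OF UV i] mat_mult_index[OF U V i(2,1)] mat_mult_index[OF c(2,1) i]
    using i by (simp add: mat_adjoint_index[OF U] mat_adjoint_index[OF V] mult.commute)
qed

lemma fmat_adjoint: "finite I \<Longrightarrow> mat_adjoint (fmat I F) = fmat I (\<lambda>i j. cnj (F j i))"
proof (rule eq_matI)
  note c = mat_adjoint_carrier[OF fmat_carrier[of I F]]
  show "dim_row (mat_adjoint (fmat I F)) = dim_row (fmat I (\<lambda>i j. cnj (F j i)))"
    "dim_col (mat_adjoint (fmat I F)) = dim_col (fmat I (\<lambda>i j. cnj (F j i)))" using c by auto
  fix p q assume "p < dim_row (fmat I (\<lambda>i j. cnj (F j i)))" "q < dim_col (fmat I (\<lambda>i j. cnj (F j i)))"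
  then have "p < card I" "q < card I" by simp_all
  then show "mat_adjoint (fmat I F) $$ (p, q) = fmat I (\<lambda>i j. cnj (F j i)) $$ (p, q)"
    by (simp add: mat_adjoint_index[OF fmat_carrier])
qed

lemma group_unitary: "group (unitary_group n)"
proof -
  let ?C = "carrier (unitary_group n)"
  interpret G: group "GL TYPE(complex) n" by (rule group_GL)
  have aa: "mat_adjoint (mat_adjoint U) = U" if "U \<in> carrier_mat n n" for U :: "complex mat"
    by (rule eq_matI) (use that mat_adjoint_carrier[OF that] mat_adjoint_carrier[OF mat_adjoint_carrier[OF that]]
        in \<open>auto simp: mat_adjoint_index[OF mat_adjoint_carrier[OF that]] mat_adjoint_index[OF that]\<close>)
  have a1: "mat_adjoint (1\<^sub>m n) = (1\<^sub>m n :: complex mat)"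
    by (rule eq_matI) (use mat_adjoint_carrier[OF one_carrier_mat[of n]] in
        \<open>auto simp: mat_adjoint_index[OF one_carrier_mat]\<close>)
  show ?thesis
  proof (rule groupI)
    show "\<one>\<^bsub>unitary_group n\<^esub> \<in> ?C" by (simp add: unitary_carrier_iff a1)
    fix U assume U: "U \<in> ?C"
    then have Uc: "U \<in> carrier_mat n n" by (simp add: unitary_carrier_iff)
    note Ac = mat_adjoint_carrier[OF Uc]
    show "\<one>\<^bsub>unitary_group n\<^esub> \<otimes>\<^bsub>unitary_group n\<^esub> U = U" using Uc by simp
    have "mat_adjoint U \<in> ?C" using U Ac aa[OF Uc] by (simp add: unitary_carrier_iff)
    then show "\<exists>V\<in>?C. V \<otimes>\<^bsub>unitary_group n\<^esub> U = \<one>\<^bsub>unitary_group n\<^esub>"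
      using U by (auto simp: unitary_carrier_iff)
    fix V assume V: "V \<in> ?C"
    then have Vc: "V \<in> carrier_mat n n" by (simp add: unitary_carrier_iff)
    note Bc = mat_adjoint_carrier[OF Vc]
    have "U * V * (mat_adjoint V * mat_adjoint U) = U * ((V * mat_adjoint V) * mat_adjoint U)"
      using Uc Vc Ac Bc by (simp add: assoc_mult_mat[of _ n n _ n _ n])
    also have "\<dots> = 1\<^sub>m n" using U V Ac by (simp add: unitary_carrier_iff)
    finally have 1: "U * V * (mat_adjoint V * mat_adjoint U) = 1\<^sub>m n" .
    have "mat_adjoint V * mat_adjoint U * (U * V) = mat_adjoint V * ((mat_adjoint U * U) * V)"
      using Uc Vc Ac Bc by (simp add: assoc_mult_mat[of _ n n _ n _ n])
    also have "\<dots> = 1\<^sub>m n" using U V Vc by (simp add: unitary_carrier_iff)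
    finally show "U \<otimes>\<^bsub>unitary_group n\<^esub> V \<in> ?C"
      using 1 Uc Vc by (simp add: unitary_carrier_iff mat_adjoint_mult[OF Uc Vc])
    fix X assume "X \<in> ?C"
    then have "X \<in> carrier_mat n n" by (simp add: unitary_carrier_iff)
    then show "U \<otimes>\<^bsub>unitary_group n\<^esub> V \<otimes>\<^bsub>unitary_group n\<^esub> X = U \<otimes>\<^bsub>unitary_group n\<^esub> (V \<otimes>\<^bsub>unitary_group n\<^esub> X)"
      using Uc Vc by (simp add: assoc_mult_mat[of _ n n _ n _ n])
  qed
qed

lemma tensor_mat_adjoint:
  fixes x y :: "complex mat"
  assumes "x \<in> carrier_mat m m" "y \<in> carrier_mat n n"
  shows "mat_adjoint (tensor_mat m n x y) = tensor_mat m n (mat_adjoint x) (mat_adjoint y)"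
  unfolding tensor_mat_def fmat_adjoint[OF finite_cartesian_product[OF finite_lessThan finite_lessThan]]
  using assms by (intro fmat_cong) (auto simp: mat_adjoint_index)

text \<open>Transposition exchanges source and target of a block, so the label of the adjoint at a
  comes from the point that s sends to a.\<close>

lemma wreath_mat_adjoint:
  fixes x :: "nat \<Rightarrow> complex mat"
  assumes A: "finite A" and x: "\<And>a. a \<in> A \<Longrightarrow> x a \<in> carrier_mat n n" and s: "s \<in> carrier (BijGroup A)"
  shows "mat_adjoint (wreath_mat n A x s)
    = wreath_mat n A (\<lambda>a. mat_adjoint (x ((inv\<^bsub>BijGroup A\<^esub> s) a))) (inv\<^bsub>BijGroup A\<^esub> s)"
  unfolding wreath_mat_def fmat_adjoint[OF finite_cartesian_product[OF A finite_lessThan]]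
proof (rule fmat_cong)
  interpret B: group "BijGroup A" by (rule group_BijGroup)
  let ?t = "inv\<^bsub>BijGroup A\<^esub> s"
  fix z w assume "z \<in> A \<times> {..<n}" "w \<in> A \<times> {..<n}"
  then obtain a i b j where z: "z = (a, i)" "w = (b, j)" "a \<in> A" "i < n" "b \<in> A" "j < n" by blast
  have "b = s a \<longleftrightarrow> a = ?t b" using BijGroup_apply[OF s] z by metis
  then show "cnj ((case w of (a, i) \<Rightarrow> \<lambda>(b, j). if a = s b then x b $$ (i, j) else 0) z) =
      (case z of (a, i) \<Rightarrow> \<lambda>(b, j). if a = ?t b then mat_adjoint (x (?t b)) $$ (i, j) else 0) w"
    using z mat_adjoint_index[OF x z(4,6)] by auto
qed (simp add: A)

lemma tensor_mat_unitary:
  assumes "x \<in> carrier (unitary_group m)" "y \<in> carrier (unitary_group n)"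
  shows "tensor_mat m n x y \<in> carrier (unitary_group (m * n))"
proof -
  have c: "x \<in> carrier_mat m m" "y \<in> carrier_mat n n" using assms by (simp_all add: unitary_carrier_iff)
  note a = mat_adjoint_carrier[OF c(1)] mat_adjoint_carrier[OF c(2)]
  show ?thesis
    using assms tensor_mat_mult[OF c(1) a(1) c(2) a(2)] tensor_mat_mult[OF a(1) c(1) a(2) c(2)]
    by (simp add: unitary_carrier_iff tensor_mat_adjoint tensor_mat_one)
qed

lemma wreath_mat_unitary:
  assumes A: "finite A" and x: "x \<in> A \<rightarrow> carrier (unitary_group n)" and s: "s \<in> carrier (BijGroup A)"
  shows "wreath_mat n A x s \<in> carrier (unitary_group (card A * n))"
proof -
  interpret B: group "BijGroup A" by (rule group_BijGroup)
  let ?t = "inv\<^bsub>BijGroup A\<^esub> s"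
  have t: "?t \<in> carrier (BijGroup A)" using s by simp
  have tA: "?t a \<in> A" if "a \<in> A" for a using BijGroup_apply(1)[OF t that] .
  have xu: "x a \<in> carrier_mat n n" "x a * mat_adjoint (x a) = 1\<^sub>m n" "mat_adjoint (x a) * x a = 1\<^sub>m n"
    if "a \<in> A" for a using x that by (auto simp: unitary_carrier_iff)
  note xa = mat_adjoint_carrier[OF xu(1)]
  have adj: "mat_adjoint (wreath_mat n A x s) = wreath_mat n A (\<lambda>a. mat_adjoint (x (?t a))) ?t"
    using A xu(1) s by (intro wreath_mat_adjoint) auto
  have "wreath_mat n A (\<lambda>a. x (?t a) * mat_adjoint (x (?t a))) (s \<otimes>\<^bsub>BijGroup A\<^esub> ?t)
      = wreath_mat n A x s * mat_adjoint (wreath_mat n A x s)"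
    unfolding adj using A xu(1) xa tA s t by (intro wreath_mat_mult) auto
  moreover have "wreath_mat n A (\<lambda>a. mat_adjoint (x (?t (s a))) * x a) (?t \<otimes>\<^bsub>BijGroup A\<^esub> s)
      = mat_adjoint (wreath_mat n A x s) * wreath_mat n A x s"
    unfolding adj using A xu(1) xa tA s t by (intro wreath_mat_mult) auto
  moreover have "wreath_mat n A (\<lambda>a. x (?t a) * mat_adjoint (x (?t a))) \<one>\<^bsub>BijGroup A\<^esub> = 1\<^sub>m (card A * n)"
    using A xu(2) tA by (intro wreath_mat_one) auto
  moreover have "wreath_mat n A (\<lambda>a. mat_adjoint (x (?t (s a))) * x a) \<one>\<^bsub>BijGroup A\<^esub> = 1\<^sub>m (card A * n)"
    using A xu(3) BijGroup_apply(3)[OF s] by (intro wreath_mat_one) auto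
  ultimately show ?thesis using s A by (simp add: unitary_carrier_iff)
qed

text \<open>The normalized trace of U times the adjoint of V, by
  \<open>mat_trace_mult_adjoint\<close>; written in entries it can be summed over any index
  set.\<close>

definition trace_kernel :: "nat \<Rightarrow> complex mat \<Rightarrow> complex mat \<Rightarrow> complex" where
  "trace_kernel n U V = (\<Sum>i<n. \<Sum>j<n. U $$ (i, j) * cnj (V $$ (i, j))) / of_nat n"

lemma mat_trace_mult_adjoint:
  assumes "U \<in> carrier_mat n n" "V \<in> carrier_mat n n"
  shows "mat_trace (U * mat_adjoint V) = (\<Sum>i<n. \<Sum>j<n. U $$ (i, j) * cnj (V $$ (i, j)))"
proof -
  have "mat_trace (U * mat_adjoint V) = (\<Sum>i<n. (U * mat_adjoint V) $$ (i, i))"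
    using assms mat_adjoint_carrier[OF assms(2)]
    by (simp add: mat_trace_def diag_mat_def interv_sum_list_conv_sum_set_nat atLeast0LessThan)
  also have "\<dots> = (\<Sum>i<n. \<Sum>j<n. U $$ (i, j) * cnj (V $$ (i, j)))"
    using assms by (intro sum.cong refl)
      (simp add: mat_mult_index[OF assms(1) mat_adjoint_carrier[OF assms(2)]] mat_adjoint_index)
  finally show ?thesis .
qed

lemma trace_kernel_refl:
  assumes "n > 0" "U \<in> carrier (unitary_group n)"
  shows "trace_kernel n U U = 1"
proof -
  have U: "U \<in> carrier_mat n n" "U * mat_adjoint U = 1\<^sub>m n" using assms by (simp_all add: unitary_carrier_iff)
  have "mat_trace (1\<^sub>m n :: complex mat) = of_nat n"
    by (simp add: mat_trace_def diag_mat_def interv_sum_list_conv_sum_set_nat)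
  then show ?thesis
    unfolding trace_kernel_def mat_trace_mult_adjoint[OF U(1) U(1), symmetric] U(2) using assms by simp
qed

lemma sum_norm_square_unitary:
  assumes "n > 0" "U \<in> carrier (unitary_group n)"
  shows "(\<Sum>i<n. \<Sum>j<n. (cmod (U $$ (i, j)))\<^sup>2) = real n"
proof -
  have "complex_of_real (\<Sum>i<n. \<Sum>j<n. (cmod (U $$ (i, j)))\<^sup>2) = of_nat n * trace_kernel n U U"
    unfolding of_real_sum complex_norm_square trace_kernel_def using assms(1) by simp
  also have "\<dots> = complex_of_real (real n)" using trace_kernel_refl[OF assms] by simp
  finally show ?thesis unfolding of_real_eq_iff .
qed

text \<open>The squared moduli of the entries sum to n for both matrices. For vectors of equal norm
  the termwise inequality 2|uv| \<le> |u|^2 + |v|^2 already yields the Cauchy-Schwarz bound.\<close>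

lemma trace_kernel_le:
  assumes "n > 0" "U \<in> carrier (unitary_group n)" "V \<in> carrier (unitary_group n)"
  shows "cmod (trace_kernel n U V) \<le> 1"
proof -
  have "cmod (\<Sum>i<n. \<Sum>j<n. U $$ (i, j) * cnj (V $$ (i, j)))
      \<le> (\<Sum>i<n. \<Sum>j<n. ((cmod (U $$ (i, j)))\<^sup>2 + (cmod (V $$ (i, j)))\<^sup>2) / 2)"
  proof (intro order_trans[OF norm_sum] sum_mono)
    fix i j
    have "0 \<le> (cmod (U $$ (i, j)) - cmod (V $$ (i, j)))\<^sup>2" by simp
    then show "cmod (U $$ (i, j) * cnj (V $$ (i, j))) \<le> ((cmod (U $$ (i, j)))\<^sup>2 + (cmod (V $$ (i, j)))\<^sup>2) / 2"
      by (simp add: norm_mult power2_eq_square algebra_simps)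
  qed
  also have "\<dots> = ((\<Sum>i<n. \<Sum>j<n. (cmod (U $$ (i, j)))\<^sup>2) + (\<Sum>i<n. \<Sum>j<n. (cmod (V $$ (i, j)))\<^sup>2)) / 2"
    by (simp only: sum_divide_distrib[symmetric] sum.distrib)
  also have "\<dots> = real n" using assms by (simp add: sum_norm_square_unitary)
  finally show ?thesis using assms by (simp add: trace_kernel_def norm_divide)
qed

text \<open>Expanding |u - v|^2 entrywise, the two square sums give n each and the mixed term gives
  the kernel. This is the origin of sqrt (2a) as the function \<open>\<Phi>\<close> for unitary
  groups.\<close>

lemma hs_dist_trace_kernel:
  assumes n: "n > 0" and U: "U \<in> carrier (unitary_group n)" and V: "V \<in> carrier (unitary_group n)"
  shows "hs_dist n U V = sqrt (2 * (1 - Re (trace_kernel n U V)))"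
proof -
  have c: "U \<in> carrier_mat n n" "V \<in> carrier_mat n n" using U V by (simp_all add: unitary_carrier_iff)
  have "Re (mat_trace ((U - V) * mat_adjoint (U - V)))
      = (\<Sum>i<n. \<Sum>j<n. (cmod (U $$ (i, j) - V $$ (i, j)))\<^sup>2)"
  proof -
    have "mat_trace ((U - V) * mat_adjoint (U - V))
        = (\<Sum>i<n. \<Sum>j<n. (U - V) $$ (i, j) * cnj ((U - V) $$ (i, j)))"
      using c by (intro mat_trace_mult_adjoint) auto
    also have "\<dots> = (\<Sum>i<n. \<Sum>j<n. complex_of_real ((cmod (U $$ (i, j) - V $$ (i, j)))\<^sup>2))"
      unfolding complex_norm_square using c by (intro sum.cong refl) auto
    finally show ?thesis by (simp flip: of_real_sum of_real_power)
  qed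
  also have "\<dots> = (\<Sum>i<n. \<Sum>j<n. (cmod (U $$ (i, j)))\<^sup>2 + (cmod (V $$ (i, j)))\<^sup>2 -
      2 * Re (U $$ (i, j) * cnj (V $$ (i, j))))"
    unfolding cmod_power2 by (simp add: power2_eq_square algebra_simps)
  also have "\<dots> = real n + real n - 2 * Re (\<Sum>i<n. \<Sum>j<n. U $$ (i, j) * cnj (V $$ (i, j)))"
    unfolding sum_subtractf sum.distrib sum_distrib_left[symmetric] Re_sum
      sum_norm_square_unitary[OF n U] sum_norm_square_unitary[OF n V] ..
  finally show ?thesis using n by (simp add: hs_dist_def trace_kernel_def field_simps)
qed

lemma trace_kernel_fmat:
  assumes I: "finite I"
  shows "of_nat (card I) * trace_kernel (card I) (fmat I F) (fmat I F') = (\<Sum>i\<in>I. \<Sum>j\<in>I. F i j * cnj (F' i j))"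
proof (cases "card I = 0")
  case False
  have "(\<Sum>i\<in>I. \<Sum>j\<in>I. F i j * cnj (F' i j))
      = (\<Sum>p<card I. \<Sum>q<card I. F (enum I p) (enum I q) * cnj (F' (enum I p) (enum I q)))"
    unfolding sum_enum[OF I, symmetric] ..
  then show ?thesis using False by (simp add: trace_kernel_def)
qed (use I in simp)

lemma trace_kernel_tensor_mat:
  assumes "m > 0" "n > 0"
  shows "trace_kernel (m * n) (tensor_mat m n x y) (tensor_mat m n x' y') = trace_kernel m x x' * trace_kernel n y y'"
proof -
  let ?I = "{..<m} \<times> {..<n}"
  have "of_nat (m * n) * trace_kernel (m * n) (tensor_mat m n x y) (tensor_mat m n x' y')
      = (\<Sum>(i, k)\<in>?I. \<Sum>(j, l)\<in>?I. (x $$ (i, j) * cnj (x' $$ (i, j))) * (y $$ (k, l) * cnj (y' $$ (k, l))))"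
    unfolding tensor_mat_def using trace_kernel_fmat[of ?I, unfolded card_cartesian_product card_lessThan]
    by (simp add: case_prod_unfold mult_ac)
  also have "\<dots> = of_nat (m * n) * (trace_kernel m x x' * trace_kernel n y y')"
    unfolding sum_swap_mult using assms by (simp add: trace_kernel_def)
  finally show ?thesis using assms by simp
qed

lemma trace_kernel_wreath_mat:
  assumes A: "finite A" "A \<noteq> {}" and n: "n > 0" and s: "s \<in> carrier (BijGroup A)"
  shows "of_nat (card A) * trace_kernel (card A * n) (wreath_mat n A x s) (wreath_mat n A y t)
    = (\<Sum>a\<in>A. if s a = t a then trace_kernel n (x a) (y a) else 0)"
proof -
  let ?I = "A \<times> {..<n}"
  have "of_nat (card A * n) * trace_kernel (card A * n) (wreath_mat n A x s) (wreath_mat n A y t)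
      = (\<Sum>(a, i)\<in>?I. \<Sum>(b, j)\<in>?I. (if a = s b then x b $$ (i, j) else 0) * cnj (if a = t b then y b $$ (i, j) else 0))"
    unfolding wreath_mat_def
    using A trace_kernel_fmat[of ?I, unfolded card_cartesian_product card_lessThan]
    by (simp add: case_prod_unfold)
  \<comment> \<open>With the columns outside, the sum over row blocks collapses: the first matrix
    meets column block b in row block s b only, the second in t b only.\<close>
  also have "\<dots> = (\<Sum>(b, j)\<in>?I. \<Sum>(a, i)\<in>?I. (if a = s b then x b $$ (i, j) else 0) * cnj (if a = t b then y b $$ (i, j) else 0))"
    unfolding case_prod_unfold by (rule sum.swap)
  also have "\<dots> = (\<Sum>b\<in>A. \<Sum>j<n. \<Sum>a\<in>A. if a = s b then (if s b = t b then \<Sum>i<n. x b $$ (i, j) * cnj (y b $$ (i, j)) else 0) else 0)"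
    unfolding sum.cartesian_product[symmetric] by (intro sum.cong) auto
  also have "\<dots> = (\<Sum>b\<in>A. \<Sum>j<n. if s b = t b then \<Sum>i<n. x b $$ (i, j) * cnj (y b $$ (i, j)) else 0)"
    using A BijGroup_apply(1)[OF s] by (intro sum.cong refl) simp
  also have "\<dots> = (\<Sum>b\<in>A. if s b = t b then of_nat n * trace_kernel n (x b) (y b) else 0)"
    using n by (intro sum.cong refl) (auto simp: trace_kernel_def intro: sum.swap)
  also have "\<dots> = of_nat n * (\<Sum>a\<in>A. if s a = t a then trace_kernel n (x a) (y a) else 0)"
    unfolding sum_distrib_left by (intro sum.cong) auto
  finally show ?thesis using n by (simp add: mult_ac)
qed

lemma kernel_family_unitary:
  "kernel_family unitary_group tensor_mat wreath_mat hs_dist (\<lambda>a. sqrt (2 * a)) trace_kernel"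
proof (intro kernel_family.intro wreath_tensor_family.intro kernel_family_axioms.intro)
  have c: "x \<in> carrier (unitary_group n) \<Longrightarrow> x \<in> carrier_mat n n" for x n
    by (simp add: unitary_carrier_iff)
  fix n :: nat
  show "group (unitary_group n)" by (rule group_unitary)
  show "wreath_hom (unitary_group n) A (unitary_group (card A * n)) (wreath_mat n A)"
    if A: "finite A" for A
    unfolding wreath_hom_def
  proof (intro conjI ballI)
    fix x s assume x: "x \<in> A \<rightarrow> carrier (unitary_group n)" and s: "s \<in> carrier (BijGroup A)"
    show "wreath_mat n A x s \<in> carrier (unitary_group (card A * n))" using A x s by (rule wreath_mat_unitary)
    fix y t assume y: "y \<in> A \<rightarrow> carrier (unitary_group n)" and t: "t \<in> carrier (BijGroup A)"
    show "wreath_mat n A (\<lambda>a. x (t a) \<otimes>\<^bsub>unitary_group n\<^esub> y a) (s \<otimes>\<^bsub>BijGroup A\<^esub> t)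
        = wreath_mat n A x s \<otimes>\<^bsub>unitary_group (card A * n)\<^esub> wreath_mat n A y t"
      unfolding unitary_simps using x y c by (intro wreath_mat_mult[OF A _ _ s t]) auto
  qed
  show "wreath_mat n A l s = wreath_mat n A l' s"
    if "finite A" "\<And>a. a \<in> A \<Longrightarrow> l a = l' a" for A s and l l' :: "nat \<Rightarrow> complex mat"
    using that by (rule wreath_mat_cong)
  show "of_nat (card A) * trace_kernel (card A * n) (wreath_mat n A l s) (wreath_mat n A l' t)
        = (\<Sum>a\<in>A. if s a = t a then trace_kernel n (l a) (l' a) else 0)"
    if "n > 0" "finite A" "A \<noteq> {}" "s \<in> carrier (BijGroup A)" for A l l' s t
    using that by (intro trace_kernel_wreath_mat)
  fix m and x x' y y' :: "complex mat"
  show "trace_kernel (m * n) (tensor_mat m n x y) (tensor_mat m n x' y') = trace_kernel m x x' * trace_kernel n y y'"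
    if "m > 0" "n > 0" using that by (rule trace_kernel_tensor_mat)
  assume x: "x \<in> carrier (unitary_group m)" and y: "y \<in> carrier (unitary_group n)"
  show "tensor_mat m n x y \<in> carrier (unitary_group (m * n))" using x y by (rule tensor_mat_unitary)
  assume "x' \<in> carrier (unitary_group m)" "y' \<in> carrier (unitary_group n)"
  then show "tensor_mat m n (x \<otimes>\<^bsub>unitary_group m\<^esub> x') (y \<otimes>\<^bsub>unitary_group n\<^esub> y')
      = tensor_mat m n x y \<otimes>\<^bsub>unitary_group (m * n)\<^esub> tensor_mat m n x' y'"
    using x y c by (simp add: tensor_mat_mult)
next
  show "\<exists>\<delta>>0. \<forall>a\<ge>0. a < \<delta> \<longrightarrow> sqrt (2 * a) < \<epsilon>" if "\<epsilon> > 0" for \<epsilon>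
    using that by (intro exI[of _ "\<epsilon>\<^sup>2 / 2"]) (auto intro: real_less_lsqrt)
qed (simp_all add: trace_kernel_refl trace_kernel_le hs_dist_trace_kernel)

lemmas permanence_unitary = kernel_family.permanence[OF kernel_family_unitary]

section \<open>Matrix rank and bilinear forms\<close>

text \<open>Each column of \<open>A * B\<close> is A applied to a column of B, hence lies in the
  column space of A.\<close>

lemma (in vec_space) rank_mult_le:
  assumes A: "A \<in> carrier_mat n m" and B: "B \<in> carrier_mat m k"
  shows "rank (A * B) \<le> rank A"
proof -
  have AB: "A * B \<in> carrier_mat n k" using A B by simp
  have cA: "set (cols A) \<subseteq> carrier_vec n" using A cols_dim by blast
  have cAB: "set (cols (A * B)) \<subseteq> carrier_vec n" using AB cols_dim by blast
  have "set (cols (A * B)) \<subseteq> span (set (cols A))"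
  proof
    fix x assume "x \<in> set (cols (A * B))"
    then obtain i where i: "i < k" "x = col (A * B) i"
      using AB by (metis carrier_matD(2) cols_length cols_nth in_set_conv_nth)
    then have "x = A *\<^sub>v col B i" using A B by (simp add: mult_mat_vec_def)
    moreover have "col B i \<in> carrier_vec m" using B by (simp add: carrier_vecI)
    moreover have "A *\<^sub>v col B i \<in> carrier_vec n" using A B by (simp add: carrier_vecI)
    ultimately have "x \<in> col_space A" using col_space_eq[OF A] A by auto
    then show "x \<in> span (set (cols A))" by (simp add: col_space_def)
  qed
  moreover have sA: "subspace class_ring (span (set (cols A))) V" using cA by (rule span_is_subspace)
  ultimately have "span (set (cols (A * B))) \<subseteq> span (set (cols A))"
    using cA by (simp add: span_is_subset span_is_submodule)
  from nested_subspaces[OF sA span_is_subspace[OF cAB] this]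
  show ?thesis
    unfolding rank_def
    using vectorspace.subspace_dim[OF subspace_is_vs[OF sA]] fin_dim_span_cols[OF A] fin_dim_span_cols[OF AB]
    by auto
qed

text \<open>A left inverse makes the kernel trivial, so the k columns are independent.\<close>

lemma (in vec_space) rank_ge_left_inverse:
  assumes M: "M \<in> carrier_mat n k" and U: "U \<in> carrier_mat k n" and UM: "U * M = 1\<^sub>m k"
  shows "rank M = k"
proof -
  have z: "v = 0\<^sub>v k" if v: "v \<in> carrier_vec k" "M *\<^sub>v v = 0\<^sub>v n" for v
  proof -
    have "v = (U * M) *\<^sub>v v" using v UM by simp
    also have "\<dots> = U *\<^sub>v (M *\<^sub>v v)" using U M v by (intro assoc_mult_mat_vec) auto
    also have "\<dots> = 0\<^sub>v k" using U v by auto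
    finally show ?thesis .
  qed
  \<comment> \<open>Independence is a property of the set of columns, in which repetitions would be
    lost; so distinctness is a separate claim.\<close>
  have d: "distinct (cols M)"
    unfolding distinct_conv_nth
  proof (intro allI impI)
    fix i j assume "i < length (cols M)" "j < length (cols M)" and ij: "i \<noteq> j"
    then have b: "i < k" "j < k" using M by auto
    show "cols M ! i \<noteq> cols M ! j"
    proof
      assume "cols M ! i = cols M ! j"
      then have c: "col M i = col M j" using b M by auto
      have "col (U * M) i = U *\<^sub>v col M i" "col (U * M) j = U *\<^sub>v col M j"
        using U M b by (simp_all add: mult_mat_vec_def)
      then have "col (1\<^sub>m k :: 'a mat) i = col (1\<^sub>m k) j" using c UM by simp
      then have "(1\<^sub>m k :: 'a mat) $$ (i, i) = 1\<^sub>m k $$ (i, j)"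
        using b by (metis index_col index_one_mat(2,3))
      then show False using b ij by simp
    qed
  qed
  have "lin_indpt (set (cols M))"
    using lin_depE[OF M _ d] z by metis
  then show ?thesis by (rule lin_indpt_full_rank[OF M d])
qed

section \<open>Bilinear forms and dual systems\<close>

definition bilin :: "nat \<Rightarrow> 'k::comm_ring_1 mat \<Rightarrow> (nat \<Rightarrow> 'k) \<Rightarrow> (nat \<Rightarrow> 'k) \<Rightarrow> 'k" where
  "bilin n M x y = (\<Sum>i<n. \<Sum>j<n. x i * M $$ (i, j) * y j)"

definition unit_fun :: "nat \<Rightarrow> nat \<Rightarrow> 'k::comm_ring_1" where
  "unit_fun i = (\<lambda>j. if j = i then 1 else 0)"

lemma bilin_linear:
  "bilin n M (\<lambda>i. x i - x' i) y = bilin n M x y - bilin n M x' y"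
  "bilin n M x (\<lambda>i. y i - y' i) = bilin n M x y - bilin n M x y'"
  "bilin n M (\<lambda>i. c * x i) y = c * bilin n M x y"
  "bilin n M x (\<lambda>i. c * y i) = c * bilin n M x y"
  by (simp_all add: bilin_def sum_subtractf[symmetric] sum_distrib_left algebra_simps)

lemma bilin_sum:
  "bilin n M (\<lambda>i. \<Sum>l\<in>L. f l i) y = (\<Sum>l\<in>L. bilin n M (f l) y)"
  "bilin n M x (\<lambda>i. \<Sum>l\<in>L. f l i) = (\<Sum>l\<in>L. bilin n M x (f l))"
proof -
  have "bilin n M (\<lambda>i. \<Sum>l\<in>L. f l i) y = (\<Sum>i<n. \<Sum>j<n. \<Sum>l\<in>L. f l i * M $$ (i, j) * y j)"
    by (simp add: bilin_def sum_distrib_right)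
  also have "\<dots> = (\<Sum>i<n. \<Sum>l\<in>L. \<Sum>j<n. f l i * M $$ (i, j) * y j)"
    by (intro sum.cong refl sum.swap)
  also have "\<dots> = (\<Sum>l\<in>L. bilin n M (f l) y)" unfolding bilin_def by (rule sum.swap)
  finally show "bilin n M (\<lambda>i. \<Sum>l\<in>L. f l i) y = (\<Sum>l\<in>L. bilin n M (f l) y)" .
  have "bilin n M x (\<lambda>i. \<Sum>l\<in>L. f l i) = (\<Sum>i<n. \<Sum>j<n. \<Sum>l\<in>L. x i * M $$ (i, j) * f l j)"
    by (simp add: bilin_def sum_distrib_left)
  also have "\<dots> = (\<Sum>i<n. \<Sum>l\<in>L. \<Sum>j<n. x i * M $$ (i, j) * f l j)"
    by (intro sum.cong refl sum.swap)
  also have "\<dots> = (\<Sum>l\<in>L. bilin n M x (f l))" unfolding bilin_def by (rule sum.swap)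
  finally show "bilin n M x (\<lambda>i. \<Sum>l\<in>L. f l i) = (\<Sum>l\<in>L. bilin n M x (f l))" .
qed

lemma bilin_unit:
  assumes "i < n" "j < n"
  shows "bilin n M (unit_fun i) (unit_fun j) = M $$ (i, j)"
proof -
  have "bilin n M (unit_fun i) (unit_fun j) = (\<Sum>a<n. \<Sum>b<n. if b = j then (if a = i then M $$ (a, b) else 0) else 0)"
    unfolding bilin_def unit_fun_def by (intro sum.cong) auto
  also have "\<dots> = M $$ (i, j)" using assms by simp
  finally show ?thesis .
qed

text \<open>Call u and v dual if their pairings under \<open>bilin n M\<close> form the unit matrix.
  With the u as rows of U and the v as columns of B this reads U (M B) = 1; so M B has rank k, and M
  has at least that rank.\<close>

lemma rank_ge_bilin_nat:
  fixes M :: "'k::field mat"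
  assumes M: "M \<in> carrier_mat n n"
    and uv: "\<And>l l'. l < k \<Longrightarrow> l' < k \<Longrightarrow> bilin n M (u l) (v l') = (if l = l' then 1 else 0)"
  shows "k \<le> vec_space.rank n M"
proof -
  interpret V: vec_space "TYPE('k)" n .
  define U where "U = mat k n (\<lambda>(l, i). u l i)"
  define B where "B = mat n k (\<lambda>(j, l). v l j)"
  have c: "U \<in> carrier_mat k n" "B \<in> carrier_mat n k" by (simp_all add: U_def B_def)
  have MB: "M * B \<in> carrier_mat n k" using M c by simp
  have "U * (M * B) = 1\<^sub>m k"
  proof (rule eq_matI)
    fix l l' assume "l < dim_row (1\<^sub>m k :: 'k mat)" "l' < dim_col (1\<^sub>m k :: 'k mat)"
    then have l: "l < k" "l' < k" by simp_all
    have "(U * (M * B)) $$ (l, l') = (\<Sum>i<n. u l i * (\<Sum>j<n. M $$ (i, j) * v l' j))"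
      using l M by (simp add: U_def B_def scalar_prod_def atLeast0LessThan)
    also have "\<dots> = bilin n M (u l) (v l')" by (simp add: bilin_def sum_distrib_left mult.assoc)
    finally show "(U * (M * B)) $$ (l, l') = 1\<^sub>m k $$ (l, l')" using uv l by simp
  qed (use c in auto)
  then have "k = V.rank (M * B)" using V.rank_ge_left_inverse[OF MB c(1)] by simp
  also have "\<dots> \<le> V.rank M" using M c(2) by (rule V.rank_mult_le)
  finally show ?thesis .
qed

text \<open>Arbitrary finite index sets allow dual systems to be combined along products and
  disjoint sums.\<close>

lemma rank_ge_bilin:
  fixes M :: "'k::field mat"
  assumes M: "M \<in> carrier_mat n n" and L: "finite L"
    and uv: "\<And>l l'. l \<in> L \<Longrightarrow> l' \<in> L \<Longrightarrow> bilin n M (u l) (v l') = (if l = l' then 1 else 0)"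
  shows "card L \<le> vec_space.rank n M"
  using M
proof (rule rank_ge_bilin_nat[where u = "\<lambda>l. u (enum L l)" and v = "\<lambda>l. v (enum L l)"])
  fix l l' assume "l < card L" "l' < card L"
  then show "bilin n M (u (enum L l)) (v (enum L l')) = (if l = l' then 1 else 0)"
    using uv enum_mem[OF L] inj_on_eq_iff[OF bij_betw_imp_inj_on[OF enum_bij[OF L]], of l l'] by simp
qed

text \<open>A sum of \<open>card L\<close> matrices of rank at most one, by subadditivity. This is
  the counterpart of \<open>rank_ge_bilin\<close> for upper bounds.\<close>

lemma rank_le_card:
  fixes M :: "'k::field mat"
  assumes "M \<in> carrier_mat n n" "finite L"
    and "\<And>i j. i < n \<Longrightarrow> j < n \<Longrightarrow> M $$ (i, j) = (\<Sum>l\<in>L. p l i * q l j)"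
  shows "vec_space.rank n M \<le> card L"
  using assms(2,1,3)
proof (induction L arbitrary: M rule: finite_induct)
  case empty
  interpret V: vec_space "TYPE('k)" n .
  have "M = 0\<^sub>m n n" using empty by (intro eq_matI) auto
  then show ?case by (simp add: V.rank_0I)
next
  case (insert l L)
  interpret V: vec_space "TYPE('k)" n .
  let ?A = "mat n n (\<lambda>(i, j). p l i * q l j)" and ?B = "mat n n (\<lambda>(i, j). \<Sum>l\<in>L. p l i * q l j)"
  have "M = ?A + ?B" using insert by (intro eq_matI) auto
  then have "V.rank M \<le> V.rank ?A + V.rank ?B" using V.rank_subadditive[of ?A n ?B] by simp
  also have "V.rank ?A \<le> 1" by (rule V.rank_le_1_product_entries[of _ n "p l" "q l"]) auto
  also have "V.rank ?B \<le> card L" by (rule insert.IH) auto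
  finally show ?case using insert by simp
qed

text \<open>A dual system of maximal size k satisfies M = \<Sum> (M v_l) (u_l^T M), as a nonzero
  entry of the difference would enlarge it. The expansion has k terms, so k is the rank, and the
  same vectors certify it from both sides.\<close>

lemma rank_data:
  fixes M :: "'k::field mat"
  assumes M: "M \<in> carrier_mat n n"
  shows "\<exists>u v. (\<forall>l<vec_space.rank n M. \<forall>l'<vec_space.rank n M.
      bilin n M (u l) (v l') = (if l = l' then 1 else 0)) \<and>
    (\<forall>i<n. \<forall>j<n. M $$ (i, j) =
      (\<Sum>l<vec_space.rank n M. bilin n M (unit_fun i) (v l) * bilin n M (u l) (unit_fun j)))"
proof -
  define P :: "nat \<Rightarrow> bool" where "P k \<longleftrightarrow> (\<exists>u v. \<forall>l<k. \<forall>l'<k. bilin n M (u l) (v l') = (if l = l' then 1 else 0))" for k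
  have P0: "P 0" by (simp add: P_def)
  have Pb: "\<forall>k. P k \<longrightarrow> k \<le> vec_space.rank n M"
    using rank_ge_bilin_nat[OF M] unfolding P_def by blast
  define k where "k = (GREATEST k. P k)"
  have Pk: "P k" unfolding k_def using GreatestI_nat[of P 0 "vec_space.rank n M"] P0 Pb by blast
  have nP: "\<not> P (Suc k)"
  proof
    assume "P (Suc k)"
    then have "Suc k \<le> (GREATEST k. P k)"
      using Greatest_le_nat[of P "Suc k" "vec_space.rank n M"] Pb by blast
    then show False by (simp add: k_def)
  qed
  obtain u v where uv: "\<And>l l'. l < k \<Longrightarrow> l' < k \<Longrightarrow> bilin n M (u l) (v l') = (if l = l' then 1 else 0)"
    using Pk unfolding P_def by blast
  have eq: "M $$ (i, j) = (\<Sum>l<k. bilin n M (unit_fun i) (v l) * bilin n M (u l) (unit_fun j))"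
    if i: "i < n" and j: "j < n" for i j
  proof (rule ccontr)
    txt \<open>Otherwise a biorthogonalization step as in Gram-Schmidt extends the dual systems.\<close>
    let ?e = "unit_fun i" and ?f = "unit_fun j"
    let ?c = "M $$ (i, j) - (\<Sum>l<k. bilin n M ?e (v l) * bilin n M (u l) ?f)"
    assume "M $$ (i, j) \<noteq> (\<Sum>l<k. bilin n M ?e (v l) * bilin n M (u l) ?f)"
    then have c: "?c \<noteq> 0" by simp
    define w where "w = (\<lambda>a. ?e a - (\<Sum>l<k. bilin n M ?e (v l) * u l a))"
    \<comment> \<open>\<open>?c\<close> is the pairing of the two corrected unit vectors, so its
      inverse makes the new pair normalized.\<close>
    define z where "z = (\<lambda>a. inverse ?c * (?f a - (\<Sum>l<k. bilin n M (u l) ?f * v l a)))"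
    have bz: "bilin n M x z = inverse ?c * (bilin n M x ?f - (\<Sum>l<k. bilin n M (u l) ?f * bilin n M x (v l)))" for x
      unfolding z_def bilin_linear bilin_sum ..
    have bw: "bilin n M w y = bilin n M ?e y - (\<Sum>l<k. bilin n M ?e (v l) * bilin n M (u l) y)" for y
      unfolding w_def bilin_linear bilin_sum ..
    have uz: "bilin n M (u m) z = 0" if "m < k" for m
    proof -
      have "(\<Sum>l<k. bilin n M (u l) ?f * bilin n M (u m) (v l)) = (\<Sum>l<k. if l = m then bilin n M (u l) ?f else 0)"
        using that uv by (intro sum.cong) auto
      then show ?thesis using that by (simp add: bz)
    qed
    have wv: "bilin n M w (v m) = 0" if "m < k" for m
    proof -
      have "(\<Sum>l<k. bilin n M ?e (v l) * bilin n M (u l) (v m)) = (\<Sum>l<k. if l = m then bilin n M ?e (v l) else 0)"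
        using that uv by (intro sum.cong) auto
      then show ?thesis using that by (simp add: bw)
    qed
    have "bilin n M w z = bilin n M ?e z" using uz by (simp add: bw)
    also have "\<dots> = inverse ?c * ?c" by (simp add: bz bilin_unit[OF i j] mult.commute)
    finally have wz: "bilin n M w z = 1" using c by simp
    have "bilin n M ((u(k := w)) l) ((v(k := z)) l') = (if l = l' then 1 else 0)" if "l < Suc k" "l' < Suc k" for l l'
      using that uv[of l l'] uz[of l] wv[of l'] wz by (auto simp: less_Suc_eq)
    then have "P (Suc k)" unfolding P_def by blast
    then show False using nP by blast
  qed
  have "vec_space.rank n M \<le> card {..<k}" using M finite_lessThan eq by (rule rank_le_card)
  then have k: "vec_space.rank n M = k" using Pb Pk by (simp add: antisym)
  show ?thesis unfolding k by (rule exI[of _ u], rule exI[of _ v]) (use uv eq in blast)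
qed

section \<open>Rank of matrix products\<close>

lemma bilin_mult:
  assumes A: "A \<in> carrier_mat n n" and B: "B \<in> carrier_mat n n"
  shows "bilin n (A * B) x y = bilin n A x (\<lambda>i. \<Sum>j<n. B $$ (i, j) * y j)"
    and "bilin n (A * B) x y = bilin n B (\<lambda>j. \<Sum>i<n. x i * A $$ (i, j)) y"
proof -
  have e: "bilin n (A * B) x y = (\<Sum>i<n. \<Sum>j<n. \<Sum>k<n. x i * A $$ (i, k) * B $$ (k, j) * y j)"
    unfolding bilin_def
    by (intro sum.cong refl) (simp add: mat_mult_index[OF A B] sum_distrib_left sum_distrib_right mult.assoc)
  also have "\<dots> = (\<Sum>i<n. \<Sum>k<n. \<Sum>j<n. x i * A $$ (i, k) * B $$ (k, j) * y j)"
    by (intro sum.cong refl sum.swap)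
  finally have e2: "bilin n (A * B) x y = (\<Sum>i<n. \<Sum>k<n. \<Sum>j<n. x i * A $$ (i, k) * B $$ (k, j) * y j)" .
  then show "bilin n (A * B) x y = bilin n A x (\<lambda>i. \<Sum>j<n. B $$ (i, j) * y j)"
    by (simp add: bilin_def sum_distrib_left mult.assoc)
  have "(\<Sum>i<n. \<Sum>k<n. \<Sum>j<n. x i * A $$ (i, k) * B $$ (k, j) * y j)
      = (\<Sum>k<n. \<Sum>i<n. \<Sum>j<n. x i * A $$ (i, k) * B $$ (k, j) * y j)" by (rule sum.swap)
  also have "\<dots> = (\<Sum>k<n. \<Sum>j<n. \<Sum>i<n. x i * A $$ (i, k) * B $$ (k, j) * y j)"
    by (intro sum.cong refl sum.swap)
  finally show "bilin n (A * B) x y = bilin n B (\<lambda>j. \<Sum>i<n. x i * A $$ (i, j)) y"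
    using e2 by (simp add: bilin_def sum_distrib_right)
qed

text \<open>A can be absorbed into the left vectors of a dual system for \<open>A * B\<close>, which
  turns it into one for B.\<close>

lemma rank_mult_le_right:
  fixes A B :: "'k::field mat"
  assumes A: "A \<in> carrier_mat n n" and B: "B \<in> carrier_mat n n"
  shows "vec_space.rank n (A * B) \<le> vec_space.rank n B"
proof -
  obtain u v where "\<And>l l'. l < vec_space.rank n (A * B) \<Longrightarrow> l' < vec_space.rank n (A * B) \<Longrightarrow>
      bilin n (A * B) (u l) (v l') = (if l = l' then 1 else 0)"
    using rank_data[OF mult_carrier_mat[OF A B]] by blast
  then show ?thesis unfolding bilin_mult(2)[OF A B] by (rule rank_ge_bilin_nat[OF B])
qed

lemma rank_mult_le_left:
  fixes A B :: "'k::field mat"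
  assumes A: "A \<in> carrier_mat n n" and B: "B \<in> carrier_mat n n"
  shows "vec_space.rank n (A * B) \<le> vec_space.rank n A"
  using A B by (rule vec_space.rank_mult_le)

text \<open>Absorbing L and R, dual systems for L M and M R become two dual systems for M. The
  vanishing triple product makes the left vectors of the first orthogonal to the right vectors of
  the second, and a correction removes the opposite pairings, so the two systems unite to
  one.\<close>

lemma rank_frobenius:
  fixes L M R :: "'k::field mat"
  assumes L: "L \<in> carrier_mat n n" and M: "M \<in> carrier_mat n n" and R: "R \<in> carrier_mat n n"
    and 0: "L * M * R = 0\<^sub>m n n"
  shows "vec_space.rank n (L * M) + vec_space.rank n (M * R) \<le> vec_space.rank n M"
proof -
  let ?r = "vec_space.rank n (L * M)" and ?s = "vec_space.rank n (M * R)"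
  have LM: "L * M \<in> carrier_mat n n" and MR: "M * R \<in> carrier_mat n n" using L M R by auto
  obtain u v where uv: "\<And>l l'. l < ?r \<Longrightarrow> l' < ?r \<Longrightarrow> bilin n (L * M) (u l) (v l') = (if l = l' then 1 else 0)"
    using rank_data[OF LM] by blast
  obtain u' v' where uv': "\<And>l l'. l < ?s \<Longrightarrow> l' < ?s \<Longrightarrow> bilin n (M * R) (u' l) (v' l') = (if l = l' then 1 else 0)"
    using rank_data[OF MR] by blast
  define uL where "uL l = (\<lambda>j. \<Sum>i<n. u l i * L $$ (i, j))" for l
  define Rv where "Rv l = (\<lambda>i. \<Sum>j<n. R $$ (i, j) * v' l j)" for l
  \<comment> \<open>Subtracting components along the \<open>Rv\<close> kills the pairings with
    \<open>u'\<close>; the pairings with \<open>uL\<close> do not change, because \<open>uL\<close>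
    and \<open>Rv\<close> pair to zero.\<close>
  define w where "w l = (\<lambda>i. v l i - (\<Sum>m<?s. bilin n M (u' m) (v l) * Rv m i))" for l
  have 1: "bilin n M (uL l) (v l') = (if l = l' then 1 else 0)" if "l < ?r" "l' < ?r" for l l'
    using uv[OF that] unfolding bilin_mult(2)[OF L M] uL_def .
  have 2: "bilin n M (u' l) (Rv l') = (if l = l' then 1 else 0)" if "l < ?s" "l' < ?s" for l l'
    using uv'[OF that] unfolding bilin_mult(1)[OF M R] Rv_def .
  have 3: "bilin n M (uL l) (Rv l') = 0" for l l'
  proof -
    have "bilin n M (uL l) (Rv l') = bilin n (L * M * R) (u l) (v' l')"
      unfolding bilin_mult(1)[OF LM R] bilin_mult(2)[OF L M] uL_def Rv_def ..
    then show ?thesis unfolding 0 by (simp add: bilin_def)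
  qed
  have 4: "bilin n M (uL l) (w l') = (if l = l' then 1 else 0)" if "l < ?r" "l' < ?r" for l l'
    unfolding w_def bilin_linear bilin_sum using 1[OF that] 3 by simp
  have 5: "bilin n M (u' l) (w l') = 0" if "l < ?s" for l l'
  proof -
    have "(\<Sum>m<?s. bilin n M (u' m) (v l') * bilin n M (u' l) (Rv m))
        = (\<Sum>m<?s. if m = l then bilin n M (u' m) (v l') else 0)"
      using that 2 by (intro sum.cong) auto
    then show ?thesis unfolding w_def bilin_linear bilin_sum using that by simp
  qed
  have "card ({..<?r} <+> {..<?s}) \<le> vec_space.rank n M"
    using M
  proof (rule rank_ge_bilin[where u = "case_sum uL u'" and v = "case_sum w Rv"])
    fix l l' assume "l \<in> {..<?r} <+> {..<?s}" "l' \<in> {..<?r} <+> {..<?s}"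
    then show "bilin n M (case_sum uL u' l) (case_sum w Rv l') = (if l = l' then 1 else 0)"
      using 2 3 4 5 by (elim PlusE) auto
  qed simp
  then show ?thesis by (simp add: card_Plus)
qed

section \<open>Inner inverses and annihilators\<close>

lemma rank_one_mat: "vec_space.rank n (1\<^sub>m n :: 'k::field mat) = n"
  using vec_space.rank_ge_left_inverse[of "1\<^sub>m n :: 'k mat" n n "1\<^sub>m n"] by simp

lemma rank_le_dim: "(A :: 'k::field mat) \<in> carrier_mat n n \<Longrightarrow> vec_space.rank n A \<le> n"
  by (rule vec_space.rank_le_nc)

lemma rank_complement:
  fixes A B :: "'k::field mat"
  assumes "A \<in> carrier_mat n n"
  shows "n \<le> vec_space.rank n (1\<^sub>m n - A) + vec_space.rank n A"
proof -
  have "1\<^sub>m n = (1\<^sub>m n - A) + A" using assms by (intro eq_matI) auto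
  then have "vec_space.rank n (1\<^sub>m n :: 'k mat) \<le> vec_space.rank n (1\<^sub>m n - A) + vec_space.rank n A"
    using vec_space.rank_subadditive[OF minus_carrier_mat[OF assms] assms, of "1\<^sub>m n"] by simp
  then show ?thesis by (simp add: rank_one_mat)
qed

text \<open>The expansion M = \<Sum> (M v_l) (u_l^T M) of \<open>rank_data\<close> is M G M with G =
  \<Sum> v_l u_l^T.\<close>

lemma inner_inverse:
  fixes M :: "'k::field mat"
  assumes M: "M \<in> carrier_mat n n"
  obtains G where "G \<in> carrier_mat n n" "M * G * M = M"
proof -
  let ?r = "vec_space.rank n M"
  obtain u v where eq: "\<And>i j. i < n \<Longrightarrow> j < n \<Longrightarrow> M $$ (i, j) =
      (\<Sum>l<?r. bilin n M (unit_fun i) (v l) * bilin n M (u l) (unit_fun j))"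
    using rank_data[OF M] by blast
  define G where "G = mat n n (\<lambda>(j, i). \<Sum>l<?r. v l j * u l i)"
  have G: "G \<in> carrier_mat n n" by (simp add: G_def)
  have b1: "bilin n M (unit_fun i) y = (\<Sum>j<n. M $$ (i, j) * y j)" if "i < n" for i y
  proof -
    have "bilin n M (unit_fun i) y = (\<Sum>a<n. if a = i then \<Sum>j<n. M $$ (a, j) * y j else 0)"
      unfolding bilin_def unit_fun_def by (intro sum.cong) auto
    then show ?thesis using that by simp
  qed
  have b2: "bilin n M x (unit_fun j) = (\<Sum>i<n. x i * M $$ (i, j))" if "j < n" for j x
  proof -
    have "bilin n M x (unit_fun j) = (\<Sum>i<n. \<Sum>b<n. if b = j then x i * M $$ (i, b) else 0)"
      unfolding bilin_def unit_fun_def by (intro sum.cong) auto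
    then show ?thesis using that by simp
  qed
  have "M * G * M = M"
  proof (rule eq_matI)
    fix i j assume "i < dim_row M" "j < dim_col M"
    then have ij: "i < n" "j < n" using M by auto
    have MG: "M * G \<in> carrier_mat n n" using M G by simp
    have "(M * G) $$ (i, b) = (\<Sum>l<?r. bilin n M (unit_fun i) (v l) * u l b)" if b: "b < n" for b
    proof -
      have "(M * G) $$ (i, b) = (\<Sum>a<n. \<Sum>l<?r. M $$ (i, a) * v l a * u l b)"
        using mat_mult_index[OF M G ij(1) b] b by (simp add: G_def sum_distrib_left mult.assoc)
      also have "\<dots> = (\<Sum>l<?r. \<Sum>a<n. M $$ (i, a) * v l a * u l b)" by (rule sum.swap)
      finally show ?thesis by (simp add: b1[OF ij(1)] sum_distrib_right)
    qed
    then have "(M * G * M) $$ (i, j) = (\<Sum>b<n. \<Sum>l<?r. bilin n M (unit_fun i) (v l) * u l b * M $$ (b, j))"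
      using mat_mult_index[OF MG M ij] by (simp add: sum_distrib_right)
    also have "\<dots> = (\<Sum>l<?r. \<Sum>b<n. bilin n M (unit_fun i) (v l) * u l b * M $$ (b, j))" by (rule sum.swap)
    also have "\<dots> = M $$ (i, j)" using eq[OF ij] by (simp add: b2[OF ij(2)] sum_distrib_left mult.assoc)
    finally show "(M * G * M) $$ (i, j) = M $$ (i, j)" .
  qed (use M G in auto)
  then show thesis using G that by blast
qed

text \<open>For an inner inverse G the matrix P = 1 - M G kills M, and its rank is at least n minus
  the rank of M G, which is at most the rank of M.\<close>

lemma left_annihilator:
  fixes M :: "'k::field mat"
  assumes M: "M \<in> carrier_mat n n"
  obtains P where "P \<in> carrier_mat n n" "P * M = 0\<^sub>m n n" "n \<le> vec_space.rank n P + vec_space.rank n M"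
proof -
  obtain G where G: "G \<in> carrier_mat n n" "M * G * M = M" using inner_inverse[OF M] .
  have MG: "M * G \<in> carrier_mat n n" using M G by simp
  have "(1\<^sub>m n - M * G) * M = 1\<^sub>m n * M - M * G * M" using MG M by (intro minus_mult_distrib_mat) auto
  then have "(1\<^sub>m n - M * G) * M = 0\<^sub>m n n" using G M by simp
  moreover have "n \<le> vec_space.rank n (1\<^sub>m n - M * G) + vec_space.rank n M"
    using rank_complement[OF MG] rank_mult_le_left[OF M G(1)] by linarith
  ultimately show thesis by (rule that[OF minus_carrier_mat[OF MG]])
qed

text \<open>The mirror image of \<open>left_annihilator\<close>, with P = 1 - G M.\<close>

lemma right_annihilator:
  fixes M :: "'k::field mat"
  assumes M: "M \<in> carrier_mat n n"
  obtains P where "P \<in> carrier_mat n n" "M * P = 0\<^sub>m n n" "n \<le> vec_space.rank n P + vec_space.rank n M"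
proof -
  obtain G where G: "G \<in> carrier_mat n n" "M * G * M = M" using inner_inverse[OF M] .
  have GM: "G * M \<in> carrier_mat n n" using M G by simp
  have "M * (1\<^sub>m n - G * M) = M * 1\<^sub>m n - M * (G * M)" using GM M by (intro mult_minus_distrib_mat) auto
  also have "M * (G * M) = M" using G M by (simp add: assoc_mult_mat[of M n n G n M n])
  finally have "M * (1\<^sub>m n - G * M) = 0\<^sub>m n n" using M by simp
  moreover have "n \<le> vec_space.rank n (1\<^sub>m n - G * M) + vec_space.rank n M"
    using rank_complement[OF GM] rank_mult_le_right[OF G(1) M] by linarith
  ultimately show thesis by (rule that[OF minus_carrier_mat[OF GM]])
qed

section \<open>General linear groups\<close>

lemma bilin_fmat:
  assumes "finite I"
  shows "bilin (card I) (fmat I F) (\<lambda>p. x (enum I p)) (\<lambda>p. y (enum I p)) = (\<Sum>i\<in>I. \<Sum>j\<in>I. x i * F i j * y j)"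
  unfolding bilin_def sum_enum[OF assms, symmetric] by (intro sum.cong) auto

lemma rank_fmat_ge:
  fixes F :: "'i \<Rightarrow> 'i \<Rightarrow> 'k::field"
  assumes I: "finite I" and L: "finite L"
    and uv: "\<And>l l'. l \<in> L \<Longrightarrow> l' \<in> L \<Longrightarrow> (\<Sum>i\<in>I. \<Sum>j\<in>I. u l i * F i j * v l' j) = (if l = l' then 1 else 0)"
  shows "card L \<le> vec_space.rank (card I) (fmat I F)"
  using fmat_carrier L
  by (rule rank_ge_bilin[where u = "\<lambda>l p. u l (enum I p)" and v = "\<lambda>l p. v l (enum I p)"])
    (use uv in \<open>simp add: bilin_fmat[OF I]\<close>)

lemma rank_fmat_le:
  fixes F :: "'i \<Rightarrow> 'i \<Rightarrow> 'k::field"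
  assumes I: "finite I" and L: "finite L"
    and F: "\<And>i j. i \<in> I \<Longrightarrow> j \<in> I \<Longrightarrow> F i j = (\<Sum>l\<in>L. p l i * q l j)"
  shows "vec_space.rank (card I) (fmat I F) \<le> card L"
  using fmat_carrier L
  by (rule rank_le_card[where p = "\<lambda>l a. p l (enum I a)" and q = "\<lambda>l a. q l (enum I a)"])
    (simp add: F enum_mem[OF I])

lemma fmat_minus: "fmat I F - fmat I F' = fmat I (\<lambda>i j. F i j - F' i j)"
  by (rule eq_matI) auto

text \<open>Products of the rank-one terms of x and y bound the rank from above. Products of their
  dual vectors bound it from below, since the bilinear form of a tensor product factorizes on
  them.\<close>

lemma rank_tensor_mat:
  fixes x y :: "'k::field mat"
  assumes x: "x \<in> carrier_mat m m" and y: "y \<in> carrier_mat n n"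
  shows "vec_space.rank (m * n) (tensor_mat m n x y) = vec_space.rank m x * vec_space.rank n y"
proof -
  let ?r = "vec_space.rank m x" and ?s = "vec_space.rank n y" and ?I = "{..<m} \<times> {..<n}"
  let ?L = "{..<?r} \<times> {..<?s}" and ?F = "\<lambda>(i, k) (j, l). x $$ (i, j) * y $$ (k, l)"
  have I: "finite ?I" "card ?I = m * n" by simp_all
  obtain u v where uv: "\<forall>l<?r. \<forall>l'<?r. bilin m x (u l) (v l') = (if l = l' then 1 else 0)"
    and ex: "\<forall>i<m. \<forall>j<m. x $$ (i, j) = (\<Sum>l<?r. bilin m x (unit_fun i) (v l) * bilin m x (u l) (unit_fun j))"
    using rank_data[OF x] by blast
  obtain u' v' where uv': "\<forall>l<?s. \<forall>l'<?s. bilin n y (u' l) (v' l') = (if l = l' then 1 else 0)"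
    and ey: "\<forall>i<n. \<forall>j<n. y $$ (i, j) = (\<Sum>l<?s. bilin n y (unit_fun i) (v' l) * bilin n y (u' l) (unit_fun j))"
    using rank_data[OF y] by blast
  have "vec_space.rank (card ?I) (fmat ?I ?F) \<le> card ?L"
  proof (rule rank_fmat_le[OF I(1)])
    fix z w assume "z \<in> ?I" "w \<in> ?I"
    then obtain i k j l where z: "z = (i, k)" "w = (j, l)" "i < m" "k < n" "j < m" "l < n" by blast
    have "x $$ (i, j) * y $$ (k, l) = (\<Sum>a<?r. \<Sum>b<?s.
        (bilin m x (unit_fun i) (v a) * bilin m x (u a) (unit_fun j)) *
        (bilin n y (unit_fun k) (v' b) * bilin n y (u' b) (unit_fun l)))"
      using ex ey z by (simp only: sum_product)
    then show "?F z w = (\<Sum>c\<in>?L.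
        (\<lambda>(a, b) (i, k). bilin m x (unit_fun i) (v a) * bilin n y (unit_fun k) (v' b)) c z *
        (\<lambda>(a, b) (j, l). bilin m x (u a) (unit_fun j) * bilin n y (u' b) (unit_fun l)) c w)"
      by (simp add: z sum.cartesian_product[symmetric] case_prod_unfold mult_ac)
         (simp add: sum.cartesian_product case_prod_unfold mult_ac)
  qed simp
  moreover have "card ?L \<le> vec_space.rank (card ?I) (fmat ?I ?F)"
  proof (rule rank_fmat_ge[OF I(1)])
    fix l l' assume "l \<in> ?L" "l' \<in> ?L"
    then obtain a b a' b' where l: "l = (a, b)" "l' = (a', b')" "a < ?r" "b < ?s" "a' < ?r" "b' < ?s" by blast
    have "(\<Sum>z\<in>?I. \<Sum>w\<in>?I. (\<lambda>(a, b) (i, k). u a i * u' b k) l z * ?F z w * (\<lambda>(a, b) (j, l). v a j * v' b l) l' w)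
        = (\<Sum>(i, k)\<in>?I. \<Sum>(j, c)\<in>?I. (u a i * x $$ (i, j) * v a' j) * (u' b k * y $$ (k, c) * v' b' c))"
      by (simp add: l case_prod_unfold mult_ac)
    also have "\<dots> = bilin m x (u a) (v a') * bilin n y (u' b) (v' b')"
      unfolding sum_swap_mult bilin_def ..
    also have "\<dots> = (if l = l' then 1 else 0)" using uv uv' l by auto
    finally show "(\<Sum>z\<in>?I. \<Sum>w\<in>?I. (\<lambda>(a, b) (i, k). u a i * u' b k) l z * ?F z w * (\<lambda>(a, b) (j, l). v a j * v' b l) l' w)
        = (if l = l' then 1 else 0)" .
  qed simp
  ultimately show ?thesis by (simp add: tensor_mat_def)
qed

lemma mat_eq_if_minus_zero:
  fixes A B :: "'k::ring mat"
  assumes A: "A \<in> carrier_mat n n" and B: "B \<in> carrier_mat n n" and z: "A - B = 0\<^sub>m n n"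
  shows "A = B"
proof (rule eq_matI)
  fix i j assume "i < dim_row B" "j < dim_col B"
  then have "A $$ (i, j) - B $$ (i, j) = (A - B) $$ (i, j)" "i < n" "j < n" using B by auto
  then show "A $$ (i, j) = B $$ (i, j)" unfolding z by simp
qed (use A B in auto)

lemma tensor_mat_minus:
  assumes "x \<in> carrier_mat m m" "x' \<in> carrier_mat m m" "y \<in> carrier_mat n n" "y' \<in> carrier_mat n n"
  shows "tensor_mat m n (x - x') y = tensor_mat m n x y - tensor_mat m n x' y"
    and "tensor_mat m n x (y - y') = tensor_mat m n x y - tensor_mat m n x y'"
  unfolding tensor_mat_def fmat_minus using assms
  by (intro fmat_cong; auto simp: algebra_simps)+

text \<open>
  With \<open>T = x - 1\<close> and \<open>S = y - 1\<close>, let \<open>P\<close> annihilate \<open>S\<close> from the left and \<open>Q\<close> annihilate \<open>T\<close>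
  from the right. The products of \<open>x \<otimes> y - 1\<close> with \<open>1 \<otimes> P\<close> on the left and \<open>Q \<otimes> 1\<close> on the right
  are \<open>T \<otimes> P\<close> and \<open>Q \<otimes> S\<close>, and Frobenius' inequality applies.
\<close>

lemma rank_tensor_mat_minus_one:
  fixes x y :: "'k::field mat"
  assumes x: "x \<in> carrier_mat m m" and y: "y \<in> carrier_mat n n"
  defines "a \<equiv> vec_space.rank m (x - 1\<^sub>m m)" and "b \<equiv> vec_space.rank n (y - 1\<^sub>m n)"
  shows "a * (n - b) + (m - a) * b \<le> vec_space.rank (m * n) (tensor_mat m n x y - 1\<^sub>m (m * n))"
proof -
  let ?T = "x - 1\<^sub>m m" and ?S = "y - 1\<^sub>m n" and ?M = "tensor_mat m n x y - tensor_mat m n (1\<^sub>m m) (1\<^sub>m n)"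
  have T: "?T \<in> carrier_mat m m" and S: "?S \<in> carrier_mat n n" by (auto intro: minus_carrier_mat)
  obtain P where P: "P \<in> carrier_mat n n" "P * ?S = 0\<^sub>m n n" "n \<le> vec_space.rank n P + b"
    using left_annihilator[OF S] unfolding b_def .
  obtain Q where Q: "Q \<in> carrier_mat m m" "?T * Q = 0\<^sub>m m m" "m \<le> vec_space.rank m Q + a"
    using right_annihilator[OF T] unfolding a_def .
  let ?L = "tensor_mat m n (1\<^sub>m m) P" and ?R = "tensor_mat m n Q (1\<^sub>m n)"
  \<comment> \<open>That is, P y = P, and likewise x Q = Q below: multiplication by P or Q absorbs
    one tensor factor.\<close>
  have "P * y - P = 0\<^sub>m n n" using mult_minus_distrib_mat[OF P(1) y one_carrier_mat] P by simp
  note Py = mat_eq_if_minus_zero[OF mult_carrier_mat[OF P(1) y] P(1) this]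
  have "x * Q - Q = 0\<^sub>m m m" using minus_mult_distrib_mat[OF x one_carrier_mat Q(1)] Q by simp
  note xQ = mat_eq_if_minus_zero[OF mult_carrier_mat[OF x Q(1)] Q(1) this]
  have LM: "?L * ?M = tensor_mat m n ?T P"
  proof -
    have "?L * ?M = ?L * tensor_mat m n x y - ?L * tensor_mat m n (1\<^sub>m m) (1\<^sub>m n)"
      by (rule mult_minus_distrib_mat[OF tensor_mat_carrier tensor_mat_carrier tensor_mat_carrier])
    also have "\<dots> = tensor_mat m n x P - tensor_mat m n (1\<^sub>m m) P"
      using x y P Py by (simp add: tensor_mat_mult[symmetric])
    finally show ?thesis using tensor_mat_minus(1)[OF x one_carrier_mat P(1) P(1)] by simp
  qed
  have MR: "?M * ?R = tensor_mat m n Q ?S"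
  proof -
    have "?M * ?R = tensor_mat m n x y * ?R - tensor_mat m n (1\<^sub>m m) (1\<^sub>m n) * ?R"
      by (rule minus_mult_distrib_mat[OF tensor_mat_carrier tensor_mat_carrier tensor_mat_carrier])
    also have "\<dots> = tensor_mat m n Q y - tensor_mat m n Q (1\<^sub>m n)"
      using x y Q xQ by (simp add: tensor_mat_mult[symmetric])
    finally show ?thesis using tensor_mat_minus(2)[OF Q(1) Q(1) y one_carrier_mat] by simp
  qed
  have "?L * ?M * ?R = tensor_mat m n (?T * Q) (P * 1\<^sub>m n)"
    unfolding LM using tensor_mat_mult[OF T Q(1) P(1) one_carrier_mat] by simp
  also have "\<dots> = 0\<^sub>m (m * n) (m * n)"
  proof (rule eq_matI)
    fix p q assume "p < dim_row (0\<^sub>m (m * n) (m * n) :: 'k mat)" "q < dim_col (0\<^sub>m (m * n) (m * n) :: 'k mat)"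
    then have pq: "p < m * n" "q < m * n" by simp_all
    then have "enum ({..<m} \<times> {..<n}) p \<in> {..<m} \<times> {..<n}" "enum ({..<m} \<times> {..<n}) q \<in> {..<m} \<times> {..<n}"
      by (simp_all add: enum_mem)
    then show "tensor_mat m n (?T * Q) (P * 1\<^sub>m n) $$ (p, q) = 0\<^sub>m (m * n) (m * n) $$ (p, q)"
      unfolding Q(2) tensor_mat_def using pq by (auto simp: mem_Times_iff case_prod_unfold)
  qed (simp_all add: tensor_mat_def)
  finally have z: "?L * ?M * ?R = 0\<^sub>m (m * n) (m * n)" .
  have "vec_space.rank (m * n) (?L * ?M) + vec_space.rank (m * n) (?M * ?R) \<le> vec_space.rank (m * n) ?M"
    using z by (intro rank_frobenius) (auto intro: minus_carrier_mat)
  then have h: "a * vec_space.rank n P + vec_space.rank m Q * b \<le> vec_space.rank (m * n) ?M"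
    unfolding LM MR rank_tensor_mat[OF T P(1)] rank_tensor_mat[OF Q(1) S] a_def b_def .
  have "a * (n - b) \<le> a * vec_space.rank n P" "(m - a) * b \<le> vec_space.rank m Q * b"
    using P(3) Q(3) by (intro mult_le_mono; simp)+
  from order_trans[OF add_mono[OF this] h] show ?thesis unfolding tensor_mat_one .
qed

text \<open>The difference is split into column blocks. Where s b = t b, the block is a copy of x b
  - y b in one row block; elsewhere two blocks may occur, but n columns have rank at most n.\<close>

lemma rank_wreath_mat_le:
  fixes x y :: "nat \<Rightarrow> 'k::field mat"
  assumes A: "finite A" and x: "\<And>a. a \<in> A \<Longrightarrow> x a \<in> carrier_mat n n"
    and y: "\<And>a. a \<in> A \<Longrightarrow> y a \<in> carrier_mat n n"
  shows "vec_space.rank (card A * n) (wreath_mat n A x s - wreath_mat n A y t)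
    \<le> (\<Sum>a\<in>A. if s a = t a then vec_space.rank n (x a - y a) else n)"
proof -
  let ?I = "A \<times> {..<n}" and ?r = "\<lambda>a. vec_space.rank n (x a - y a)"
  let ?L = "SIGMA a:A. {..<if s a = t a then ?r a else n}"
  let ?F = "\<lambda>z w. (\<lambda>(a, i) (b, j). if a = s b then x b $$ (i, j) else 0) z w
    - (\<lambda>(a, i) (b, j). if a = t b then y b $$ (i, j) else 0) z w"
  have I: "finite ?I" "card ?I = card A * n" using A by simp_all
  have "\<forall>a\<in>A. \<exists>p q. \<forall>i<n. \<forall>j<n. (x a - y a) $$ (i, j) = (\<Sum>l<?r a. p l i * q l j)"
  proof
    fix a assume "a \<in> A"
    then have "x a - y a \<in> carrier_mat n n" using y by (intro minus_carrier_mat)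
    then show "\<exists>p q. \<forall>i<n. \<forall>j<n. (x a - y a) $$ (i, j) = (\<Sum>l<?r a. p l i * q l j)"
      using rank_data[of "x a - y a" n] by fast
  qed
  then obtain p q where pq: "\<And>a i j. a \<in> A \<Longrightarrow> i < n \<Longrightarrow> j < n \<Longrightarrow>
      (x a - y a) $$ (i, j) = (\<Sum>l<?r a. p a l i * q a l j)" by metis
  \<comment> \<open>One rank-one term for each (b, l): a term of the expansion of x b - y b if s b =
    t b, otherwise the column (b, l) of the difference times a unit row.\<close>
  define P where "P = (\<lambda>(b, l) z. if s b = t b then (if fst z = s b then p b l (snd z) else 0) else ?F z (b, l))"
  define Q where "Q = (\<lambda>(b, l) (c, j). if c = b then (if s b = t b then q b l j else if l = j then 1 else 0) else 0)"
  have "vec_space.rank (card ?I) (fmat ?I ?F) \<le> card ?L"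
  proof (rule rank_fmat_le[OF I(1)])
    fix z w assume "z \<in> ?I" "w \<in> ?I"
    then obtain a i b j where z: "z = (a, i)" "w = (b, j)" "a \<in> A" "i < n" "b \<in> A" "j < n" by blast
    have "(\<Sum>l\<in>?L. P l z * Q l w) = (\<Sum>c\<in>A. \<Sum>l<if s c = t c then ?r c else n. P (c, l) z * Q (c, l) w)"
      using A sum.Sigma[of A "\<lambda>c. {..<if s c = t c then ?r c else n}" "\<lambda>c l. P (c, l) z * Q (c, l) w"]
      by (simp add: case_prod_unfold)
    also have "\<dots> = (\<Sum>c\<in>A. if c = b then (\<Sum>l<if s b = t b then ?r b else n. P (b, l) z * Q (b, l) w) else 0)"
      by (intro sum.cong refl) (auto simp: Q_def z)
    also have "\<dots> = (\<Sum>l<if s b = t b then ?r b else n. P (b, l) z * Q (b, l) w)" using A z by simp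
    also have "\<dots> = ?F z w"
    proof (cases "s b = t b")
      case True
      have "?F z w = (if a = s b then (x b - y b) $$ (i, j) else 0)"
        using True z x[OF z(5)] y[OF z(5)] by auto
      also have "\<dots> = (\<Sum>l<?r b. P (b, l) z * Q (b, l) w)"
        unfolding pq[OF z(5,4,6)] by (auto simp: P_def Q_def z True)
      finally show ?thesis using True by simp
    next
      case False
      have "(\<Sum>l<n. P (b, l) z * Q (b, l) w) = (\<Sum>l<n. if l = j then ?F z (b, l) else 0)"
        by (intro sum.cong refl) (simp add: P_def Q_def z False)
      then show ?thesis using False z by simp
    qed
    finally show "?F z w = (\<Sum>l\<in>?L. P l z * Q l w)" by (rule sym)
  qed (use A in auto)
  also have "card ?L = (\<Sum>a\<in>A. if s a = t a then ?r a else n)" using A by (subst card_SigmaI) auto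
  finally show ?thesis unfolding wreath_mat_def fmat_minus I(2) .
qed

lemma sum_Times: "(\<Sum>z\<in>A \<times> B. h z) = (\<Sum>a\<in>A. \<Sum>b\<in>B. h (a, b))"
  by (simp add: sum.cartesian_product)

text \<open>For the identity permutation the difference is block diagonal with blocks x a - 1, so
  dual systems of the blocks, extended by zero, are jointly dual.\<close>

lemma rank_wreath_mat_ge:
  fixes x :: "nat \<Rightarrow> 'k::field mat"
  assumes A: "finite A" and x: "\<And>a. a \<in> A \<Longrightarrow> x a \<in> carrier_mat n n"
  shows "(\<Sum>a\<in>A. vec_space.rank n (x a - 1\<^sub>m n))
    \<le> vec_space.rank (card A * n) (wreath_mat n A x \<one>\<^bsub>BijGroup A\<^esub> - 1\<^sub>m (card A * n))"
proof -
  let ?I = "A \<times> {..<n}" and ?r = "\<lambda>a. vec_space.rank n (x a - 1\<^sub>m n)"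
  let ?L = "SIGMA a:A. {..<?r a}" and ?o = "\<one>\<^bsub>BijGroup A\<^esub>"
  let ?F = "\<lambda>z w. (\<lambda>(a, i) (b, j). if a = ?o b then x b $$ (i, j) else 0) z w
    - (\<lambda>(a, i) (b, j). if a = ?o b then (1\<^sub>m n :: 'k mat) $$ (i, j) else 0) z w"
  have o: "?o a = a" if "a \<in> A" for a using that by (simp add: BijGroup_def)
  have I: "finite ?I" "card ?I = card A * n" using A by simp_all
  have "\<forall>a\<in>A. \<exists>u v. \<forall>l<?r a. \<forall>l'<?r a. bilin n (x a - 1\<^sub>m n) (u l) (v l') = (if l = l' then 1 else 0)"
    using rank_data[OF minus_carrier_mat[OF one_carrier_mat]] by blast
  then obtain u v where uv: "\<And>a l l'. a \<in> A \<Longrightarrow> l < ?r a \<Longrightarrow> l' < ?r a \<Longrightarrow>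
      bilin n (x a - 1\<^sub>m n) (u a l) (v a l') = (if l = l' then 1 else 0)" by metis
  define U where "U = (\<lambda>(a, l) (b, i). if b = a then u a l i else 0)"
  define V where "V = (\<lambda>(a, l) (b, i). if b = a then v a l i else 0)"
  have "card ?L \<le> vec_space.rank (card ?I) (fmat ?I ?F)"
  proof (rule rank_fmat_ge[OF I(1)])
    fix e e' assume "e \<in> ?L" "e' \<in> ?L"
    then obtain a l a' l' where e: "e = (a, l)" "e' = (a', l')" "a \<in> A" "a' \<in> A" "l < ?r a" "l' < ?r a'" by blast
    have "(\<Sum>z\<in>?I. \<Sum>w\<in>?I. U e z * ?F z w * V e' w)
        = (\<Sum>b\<in>A. \<Sum>i<n. \<Sum>c\<in>A. \<Sum>j<n. U e (b, i) * ?F (b, i) (c, j) * V e' (c, j))"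
      unfolding sum_Times ..
    also have "\<dots> = (\<Sum>b\<in>A. if b = a then (\<Sum>i<n. \<Sum>c\<in>A. if c = a' then
        (\<Sum>j<n. u a l i * (if a = a' then (x a - 1\<^sub>m n) $$ (i, j) else 0) * v a' l' j) else 0) else 0)"
      using e o by (intro sum.cong refl) (auto simp: U_def V_def intro!: sum.cong sum.neutral)
    also have "\<dots> = (\<Sum>i<n. \<Sum>j<n. u a l i * (if a = a' then (x a - 1\<^sub>m n) $$ (i, j) else 0) * v a' l' j)"
      using A e by simp
    also have "\<dots> = (if a = a' then bilin n (x a - 1\<^sub>m n) (u a l) (v a' l') else 0)"
      by (simp add: bilin_def)
    also have "\<dots> = (if e = e' then 1 else 0)" using uv e by auto
    finally show "(\<Sum>z\<in>?I. \<Sum>w\<in>?I. U e z * ?F z w * V e' w) = (if e = e' then 1 else 0)" .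
  qed (use A in auto)
  moreover have "card ?L = (\<Sum>a\<in>A. ?r a)" using A by (subst card_SigmaI) auto
  moreover have "wreath_mat n A x ?o - 1\<^sub>m (card A * n) = fmat ?I ?F"
    unfolding wreath_mat_one[OF A refl, symmetric] wreath_mat_def fmat_minus ..
  ultimately show ?thesis using I(2) by simp
qed

section \<open>The rank metric\<close>

lemma rank_dist_triangle:
  fixes A B C :: "'k::field mat"
  assumes A: "A \<in> carrier_mat n n" and B: "B \<in> carrier_mat n n" and C: "C \<in> carrier_mat n n"
  shows "rank_dist n A C \<le> rank_dist n A B + rank_dist n B C"
proof -
  have "A - C = (A - B) + (B - C)" using A B C by (intro eq_matI) auto
  then have "vec_space.rank n (A - C) \<le> vec_space.rank n (A - B) + vec_space.rank n (B - C)"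
    using vec_space.rank_subadditive[OF minus_carrier_mat[OF B] minus_carrier_mat[OF C], of A B] by simp
  then have "real (vec_space.rank n (A - C)) \<le> real (vec_space.rank n (A - B)) + real (vec_space.rank n (B - C))"
    by linarith
  then show ?thesis
    unfolding rank_dist_def add_divide_distrib[symmetric] by (rule divide_right_mono) simp
qed

text \<open>Here \<open>u\<close> and \<open>\<rho>\<close> are both given by the normalized rank
  distance; its growth along tensor powers comes from
  \<open>rank_tensor_mat_minus_one\<close>.\<close>

lemma indexed_family_GL:
  "indexed_family (GL (ty :: 'k::field itself)) tensor_mat wreath_mat rank_dist rank_dist (\<lambda>a. a)
    (\<lambda>n x. rank_dist n x (1\<^sub>m n))"
proof (intro indexed_family.intro indexed_family_axioms.intro)
  have c: "x \<in> carrier_mat n n" if "x \<in> carrier (GL ty n)" for x :: "'k mat" and n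
    using that unfolding GL_carrier_iff by blast
  have d: "x - y \<in> carrier_mat n n" if "y \<in> carrier (GL ty n)" for x y :: "'k mat" and n
    using c[OF that] by (rule minus_carrier_mat)
  have le1: "rank_dist n x y \<le> 1" if "n > 0" "y \<in> carrier (GL ty n)" for n and x y :: "'k mat"
    using rank_le_dim[OF d[OF that(2)], of x] that by (simp add: rank_dist_def)
  have nn: "0 \<le> rank_dist n x y" for n and x y :: "'k mat" by (simp add: rank_dist_def)
  have refl: "rank_dist n x x = 0" if "x \<in> carrier (GL ty n)" for n and x :: "'k mat"
    using minus_r_inv_mat[OF c[OF that]] vec_space.rank_0I[of n n, where 'a = 'k] by (simp add: rank_dist_def)
  have up: "real (card A) * rank_dist (card A * n) (wreath_mat n A l s) (wreath_mat n A l' t)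
      \<le> (\<Sum>a\<in>A. if s a = t a then rank_dist n (l a) (l' a) else 1)"
    if n: "n > 0" and A: "finite A" "A \<noteq> {}" and l: "l \<in> A \<rightarrow> carrier (GL ty n)" "l' \<in> A \<rightarrow> carrier (GL ty n)"
    for n A s t and l l' :: "nat \<Rightarrow> 'k mat"
  proof -
    have "vec_space.rank (card A * n) (wreath_mat n A l s - wreath_mat n A l' t)
        \<le> (\<Sum>a\<in>A. if s a = t a then vec_space.rank n (l a - l' a) else n)"
      using l c by (intro rank_wreath_mat_le[OF A(1)]) auto
    then have "real (vec_space.rank (card A * n) (wreath_mat n A l s - wreath_mat n A l' t)) / real n
        \<le> real (\<Sum>a\<in>A. if s a = t a then vec_space.rank n (l a - l' a) else n) / real n"
      by (intro divide_right_mono) (simp_all only: of_nat_le_iff of_nat_0_le_iff)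
    also have "\<dots> = (\<Sum>a\<in>A. if s a = t a then rank_dist n (l a) (l' a) else 1)"
      unfolding of_nat_sum sum_divide_distrib using n by (intro sum.cong) (auto simp: rank_dist_def)
    finally show ?thesis using A n by (simp add: rank_dist_def card_gt_0_iff)
  qed
  have low: "(\<Sum>a\<in>A. rank_dist n (l a) (1\<^sub>m n))
      \<le> real (card A) * rank_dist (card A * n) (wreath_mat n A l \<one>\<^bsub>BijGroup A\<^esub>) (1\<^sub>m (card A * n))"
    if n: "n > 0" and A: "finite A" "A \<noteq> {}" and l: "l \<in> A \<rightarrow> carrier (GL ty n)"
    for n A and l :: "nat \<Rightarrow> 'k mat"
  proof -
    have "(\<Sum>a\<in>A. vec_space.rank n (l a - 1\<^sub>m n))
        \<le> vec_space.rank (card A * n) (wreath_mat n A l \<one>\<^bsub>BijGroup A\<^esub> - 1\<^sub>m (card A * n))"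
      using l c by (intro rank_wreath_mat_ge[OF A(1)]) auto
    then have "real (\<Sum>a\<in>A. vec_space.rank n (l a - 1\<^sub>m n)) / real n
        \<le> real (vec_space.rank (card A * n) (wreath_mat n A l \<one>\<^bsub>BijGroup A\<^esub> - 1\<^sub>m (card A * n))) / real n"
      by (intro divide_right_mono) (simp_all only: of_nat_le_iff of_nat_0_le_iff)
    moreover have "real (\<Sum>a\<in>A. vec_space.rank n (l a - 1\<^sub>m n)) / real n = (\<Sum>a\<in>A. rank_dist n (l a) (1\<^sub>m n))"
      unfolding of_nat_sum sum_divide_distrib by (simp add: rank_dist_def)
    ultimately show ?thesis using A n by (simp add: rank_dist_def card_gt_0_iff)
  qed
  show "wreath_tensor_family (GL ty) tensor_mat wreath_mat" by (rule wreath_tensor_family_GL)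
  show "\<exists>\<delta>>0. \<forall>a\<ge>0. a < \<delta> \<longrightarrow> a < \<epsilon>" if "\<epsilon> > 0" for \<epsilon> :: real using that by blast
  show "0 \<le> rank_dist n x y" for n and x y :: "'k mat" by (rule nn)
  show "rank_dist n x y \<le> 2" if "n > 0" "y \<in> carrier (GL ty n)" for n and x y :: "'k mat"
    using le1[OF that, of x] by simp
  show "rank_dist n x x = 0" if "x \<in> carrier (GL ty n)" for n and x :: "'k mat" using that by (rule refl)
  show "rank_dist n x (1\<^sub>m n) \<le> rank_dist n x \<one>\<^bsub>GL ty n\<^esub>" for n and x :: "'k mat" by simp
  show "real (card A) * rank_dist (card A * n) (wreath_mat n A l s) (wreath_mat n A l' t)
      \<le> (\<Sum>a\<in>A. if s a = t a then rank_dist n (l a) (l' a) else 1)"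
    if "n > 0" "finite A" "A \<noteq> {}" "l \<in> A \<rightarrow> carrier (GL ty n)" "l' \<in> A \<rightarrow> carrier (GL ty n)"
    for n A s t and l l' :: "nat \<Rightarrow> 'k mat" using that by (rule up)
  show "(\<Sum>a\<in>A. rank_dist n (l a) \<one>\<^bsub>GL ty n\<^esub>)
      \<le> real (card A) * rank_dist (card A * n) (wreath_mat n A l \<one>\<^bsub>BijGroup A\<^esub>) \<one>\<^bsub>GL ty (card A * n)\<^esub>"
    if "n > 0" "finite A" "A \<noteq> {}" "l \<in> A \<rightarrow> carrier (GL ty n)" for n A and l :: "nat \<Rightarrow> 'k mat"
    unfolding GL_simps using that by (rule low)
  \<comment> \<open>The tensor factors are changed one at a time; the rank of such a change is the
    rank of the changed factor's difference times that of the fixed factor.\<close>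
  have tl: "rank_dist (m * n) (tensor_mat m n x y) (tensor_mat m n x' y) \<le> rank_dist m x x'"
    if "m > 0" "n > 0" "x \<in> carrier_mat m m" "x' \<in> carrier_mat m m" "y \<in> carrier_mat n n"
    for m n and x x' y :: "'k mat"
    using that rank_le_dim[OF that(5)]
      rank_tensor_mat[OF minus_carrier_mat[OF that(4)] that(5), of x] tensor_mat_minus(1)[OF that(3,4,5,5)]
    by (simp add: rank_dist_def field_simps mult_right_mono)
  have tr: "rank_dist (m * n) (tensor_mat m n x y) (tensor_mat m n x y') \<le> rank_dist n y y'"
    if "m > 0" "n > 0" "x \<in> carrier_mat m m" "y \<in> carrier_mat n n" "y' \<in> carrier_mat n n"
    for m n and x y y' :: "'k mat"
    using that rank_le_dim[OF that(3)]
      rank_tensor_mat[OF that(3) minus_carrier_mat[OF that(5)], of y] tensor_mat_minus(2)[OF that(3,3,4,5)]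
    by (simp add: rank_dist_def field_simps mult_right_mono)
  show "\<exists>\<delta>>0. \<forall>m>0. \<forall>n>0. \<forall>x\<in>carrier (GL ty m). \<forall>x'\<in>carrier (GL ty m).
      \<forall>y\<in>carrier (GL ty n). \<forall>y'\<in>carrier (GL ty n). rank_dist m x x' < \<delta> \<longrightarrow> rank_dist n y y' < \<delta> \<longrightarrow>
      rank_dist (m * n) (tensor_mat m n x y) (tensor_mat m n x' y') < \<epsilon>" if e: "\<epsilon> > 0" for \<epsilon> :: real
  proof (rule exI[of _ "\<epsilon> / 2"], intro conjI allI impI ballI)
    show "\<epsilon> / 2 > 0" using e by simp
    fix m n :: nat and x x' y y'
    assume h: "m > 0" "n > 0" "x \<in> carrier (GL ty m)" "x' \<in> carrier (GL ty m)"
      "y \<in> carrier (GL ty n)" "y' \<in> carrier (GL ty n)" "rank_dist m x x' < \<epsilon> / 2" "rank_dist n y y' < \<epsilon> / 2"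
    let ?p = "tensor_mat m n x y" and ?q = "tensor_mat m n x' y" and ?r = "tensor_mat m n x' y'"
    have "rank_dist (m * n) ?p ?r \<le> rank_dist (m * n) ?p ?q + rank_dist (m * n) ?q ?r"
      by (rule rank_dist_triangle[OF tensor_mat_carrier tensor_mat_carrier tensor_mat_carrier])
    also have "\<dots> \<le> rank_dist m x x' + rank_dist n y y'"
      using h c by (intro add_mono tl tr) auto
    finally show "rank_dist (m * n) ?p ?r < \<epsilon>" using h by simp
  qed
  show "rank_dist m x \<one>\<^bsub>GL ty m\<^esub> \<le> rank_dist (m * n) (tensor_mat m n x \<one>\<^bsub>GL ty n\<^esub>) \<one>\<^bsub>GL ty (m * n)\<^esub>"
    if "m > 0" "n > 0" "x \<in> carrier (GL ty m)" for m n and x :: "'k mat"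
    unfolding GL_simps tensor_mat_one[symmetric] rank_dist_def
      tensor_mat_minus(1)[OF c[OF that(3)] one_carrier_mat one_carrier_mat one_carrier_mat, symmetric]
      rank_tensor_mat[OF minus_carrier_mat[OF one_carrier_mat] one_carrier_mat] rank_one_mat
    using that by simp
  show "rank_dist n y \<one>\<^bsub>GL ty n\<^esub> \<le> rank_dist (m * n) (tensor_mat m n \<one>\<^bsub>GL ty m\<^esub> y) \<one>\<^bsub>GL ty (m * n)\<^esub>"
    if "m > 0" "n > 0" "y \<in> carrier (GL ty n)" for m n and y :: "'k mat"
    unfolding GL_simps tensor_mat_one[symmetric] rank_dist_def
      tensor_mat_minus(2)[OF one_carrier_mat one_carrier_mat c[OF that(3)] one_carrier_mat, symmetric]
      rank_tensor_mat[OF one_carrier_mat minus_carrier_mat[OF one_carrier_mat]] rank_one_mat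
    using that by simp
  show "rank_dist n y (1\<^sub>m n) + rank_dist m x (1\<^sub>m m) * (1 - 2 * rank_dist n y (1\<^sub>m n))
      \<le> rank_dist (m * n) (tensor_mat m n x y) (1\<^sub>m (m * n))"
    if h: "m > 0" "n > 0" "x \<in> carrier (GL ty m)" "y \<in> carrier (GL ty n)" for m n and x y :: "'k mat"
  proof -
    define a b where "a = vec_space.rank m (x - 1\<^sub>m m)" and "b = vec_space.rank n (y - 1\<^sub>m n)"
    have ab: "a \<le> m" "b \<le> n"
      unfolding a_def b_def by (intro rank_le_dim minus_carrier_mat one_carrier_mat)+
    have "real (a * (n - b) + (m - a) * b) \<le> real (vec_space.rank (m * n) (tensor_mat m n x y - 1\<^sub>m (m * n)))"
      unfolding a_def b_def using rank_tensor_mat_minus_one[OF c[OF h(3)] c[OF h(4)]] of_nat_le_iff by blast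
    then have "(real a * (real n - real b) + (real m - real a) * real b) / (real m * real n)
        \<le> rank_dist (m * n) (tensor_mat m n x y) (1\<^sub>m (m * n))"
      unfolding rank_dist_def using ab by (simp add: of_nat_diff divide_right_mono)
    \<comment> \<open>With p = a / m and q = b / n, the Frobenius bound p (1 - q) + (1 - p) q is
      rewritten as q + p (1 - 2q), the form that \<open>rho_T\<close> asks for.\<close>
    moreover have "(real a * (real n - real b) + (real m - real a) * real b) / (real m * real n)
        = real b / real n + real a / real m * (1 - 2 * (real b / real n))"
      using h by (simp add: field_simps)
    ultimately show ?thesis by (simp add: rank_dist_def a_def b_def)
  qed
  show "\<exists>\<eta>>0. \<forall>n>0. \<forall>x\<in>carrier (GL ty n).
      rank_dist (4 * n) (wreath_mat n {..<4} (\<lambda>a. if a = 0 then x else \<one>\<^bsub>GL ty n\<^esub>) \<one>\<^bsub>BijGroup {..<4}\<^esub>) (1\<^sub>m (4 * n)) \<le> 1/2 \<and>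
      (rank_dist n x \<one>\<^bsub>GL ty n\<^esub> > e \<longrightarrow>
        \<eta> \<le> rank_dist (4 * n) (wreath_mat n {..<4} (\<lambda>a. if a = 0 then x else \<one>\<^bsub>GL ty n\<^esub>) \<one>\<^bsub>BijGroup {..<4}\<^esub>) (1\<^sub>m (4 * n)))"
    if e: "e > 0" for e :: real
  \<comment> \<open>The upper and lower wreath bounds show that adding three unit blocks divides the
    distance to the unit by 4: it becomes at most 1/4, and at least e / 4 if it exceeded e.\<close>
  proof (rule exI[of _ "e / 4"], intro conjI allI impI ballI)
    show "e / 4 > 0" using e by simp
    fix n :: nat and x assume n: "n > 0" and x: "x \<in> carrier (GL ty n)"
    let ?l = "\<lambda>a::nat. if a = 0 then x else 1\<^sub>m n" and ?o = "\<one>\<^bsub>BijGroup {..<4::nat}\<^esub>"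
    have A: "finite {..<4::nat}" "{..<4::nat} \<noteq> {}" by (auto simp: lessThan_empty_iff)
    have one: "1\<^sub>m n \<in> carrier (GL ty n)" using monoid.one_closed[OF group.is_monoid[OF group_GL[of ty n]]] by simp
    have l: "?l \<in> {..<4} \<rightarrow> carrier (GL ty n)" "(\<lambda>_. 1\<^sub>m n) \<in> {..<4::nat} \<rightarrow> carrier (GL ty n)" using x one by auto
    have s: "(\<Sum>a<4::nat. rank_dist n (?l a) (1\<^sub>m n)) = rank_dist n x (1\<^sub>m n)"
      using refl[OF one] by (simp add: eval_nat_numeral)
    have w: "wreath_mat n {..<4::nat} (\<lambda>_. 1\<^sub>m n :: 'k mat) ?o = 1\<^sub>m (4 * n)"
      using wreath_mat_one[OF A(1), of "\<lambda>_. 1\<^sub>m n :: 'k mat" n] by simp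
    have "4 * rank_dist (4 * n) (wreath_mat n {..<4} ?l ?o) (1\<^sub>m (4 * n)) \<le> rank_dist n x (1\<^sub>m n)"
      using up[OF n A l, of ?o ?o] s w by simp
    then show "rank_dist (4 * n) (wreath_mat n {..<4} (\<lambda>a. if a = 0 then x else \<one>\<^bsub>GL ty n\<^esub>) ?o) (1\<^sub>m (4 * n)) \<le> 1/2"
      unfolding GL_simps using le1[OF n one, of x] by linarith
    assume "rank_dist n x \<one>\<^bsub>GL ty n\<^esub> > e"
    then show "e / 4 \<le> rank_dist (4 * n) (wreath_mat n {..<4} (\<lambda>a. if a = 0 then x else \<one>\<^bsub>GL ty n\<^esub>) ?o) (1\<^sub>m (4 * n))"
      unfolding GL_simps using low[OF n A l(1)] s by simp
  qed
qed simp_all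

lemmas permanence_GL = indexed_family.permanence[OF indexed_family_GL]

section \<open>Finite groups with bi-invariant metrics\<close>

text \<open>On a finite nonempty carrier the supremum is attained, so diameter one becomes a bound
  with a witness. The element type is left free, so that products and wreath products can be formed
  before they are moved to the natural numbers.\<close>

definition finite_metric_group :: "('b, 'm) monoid_scheme \<Rightarrow> ('b \<Rightarrow> 'b \<Rightarrow> real) \<Rightarrow> bool" where
  "finite_metric_group K e \<longleftrightarrow> group K \<and> finite (carrier K) \<and> biinvariant_metric K e \<and>
    (\<forall>x\<in>carrier K. \<forall>y\<in>carrier K. e x y \<le> 1) \<and> (\<exists>x\<in>carrier K. \<exists>y\<in>carrier K. e x y = 1)"

lemma Sup_eq_one_iff:
  fixes e :: "'b \<Rightarrow> 'b \<Rightarrow> real"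
  assumes "finite C" "C \<noteq> {}"
  shows "(SUP (x, y) \<in> C \<times> C. e x y) = 1 \<longleftrightarrow> (\<forall>x\<in>C. \<forall>y\<in>C. e x y \<le> 1) \<and> (\<exists>x\<in>C. \<exists>y\<in>C. e x y = 1)"
proof -
  let ?E = "(\<lambda>(x, y). e x y) ` (C \<times> C)"
  have E: "finite ?E" "?E \<noteq> {}" using assms by auto
  have "Sup ?E = 1 \<longleftrightarrow> 1 \<in> ?E \<and> (\<forall>r\<in>?E. r \<le> 1)"
    unfolding cSup_eq_Max[OF E] using Max_eq_iff[OF E] by blast
  also have "\<dots> \<longleftrightarrow> (\<forall>x\<in>C. \<forall>y\<in>C. e x y \<le> 1) \<and> (\<exists>x\<in>C. \<exists>y\<in>C. e x y = 1)" by force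
  finally show ?thesis .
qed

abbreviation finite_metric_groups :: "(nat monoid \<times> (nat \<Rightarrow> nat \<Rightarrow> real)) set" where
  "finite_metric_groups \<equiv> {(G :: nat monoid, d). group G \<and> finite (carrier G) \<and> biinvariant_metric G d \<and>
      (SUP (x, y) \<in> carrier G \<times> carrier G. d x y) = 1}"

lemma finite_metric_groups_iff: "(G, d) \<in> finite_metric_groups \<longleftrightarrow> finite_metric_group G d"
proof (cases "group G \<and> finite (carrier G)")
  case True
  then have "carrier G \<noteq> {}" using monoid.one_closed group.is_monoid by blast
  then show ?thesis using True Sup_eq_one_iff[of "carrier G" d] by (simp add: finite_metric_group_def)
qed (auto simp: finite_metric_group_def)

lemma finite_metric_groupD:
  assumes "finite_metric_group K e"
  shows "group K" "finite (carrier K)" "0 \<le> e x y" "e x y = e y x"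
    "x \<in> carrier K \<Longrightarrow> y \<in> carrier K \<Longrightarrow> e x y = 0 \<longleftrightarrow> x = y"
    "x \<in> carrier K \<Longrightarrow> y \<in> carrier K \<Longrightarrow> z \<in> carrier K \<Longrightarrow> e x z \<le> e x y + e y z"
    "x \<in> carrier K \<Longrightarrow> y \<in> carrier K \<Longrightarrow> z \<in> carrier K \<Longrightarrow> e (z \<otimes>\<^bsub>K\<^esub> x) (z \<otimes>\<^bsub>K\<^esub> y) = e x y"
    "x \<in> carrier K \<Longrightarrow> y \<in> carrier K \<Longrightarrow> z \<in> carrier K \<Longrightarrow> e (x \<otimes>\<^bsub>K\<^esub> z) (y \<otimes>\<^bsub>K\<^esub> z) = e x y"
    "x \<in> carrier K \<Longrightarrow> y \<in> carrier K \<Longrightarrow> e x y \<le> 1"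
    "\<exists>x\<in>carrier K. \<exists>y\<in>carrier K. e x y = 1"
proof -
  interpret M: Metric_space "carrier K" e
    using assms by (simp add: finite_metric_group_def biinvariant_metric_def)
  show "0 \<le> e x y" "e x y = e y x" by (rule M.nonneg, rule M.commute)
  show "x \<in> carrier K \<Longrightarrow> y \<in> carrier K \<Longrightarrow> e x y = 0 \<longleftrightarrow> x = y" by (rule M.zero)
  show "x \<in> carrier K \<Longrightarrow> y \<in> carrier K \<Longrightarrow> z \<in> carrier K \<Longrightarrow> e x z \<le> e x y + e y z" by (rule M.triangle)
qed (use assms in \<open>simp_all add: finite_metric_group_def biinvariant_metric_def\<close>)

lemma finite_metric_groupI:
  assumes "group K" "finite (carrier K)" "\<And>x y. 0 \<le> e x y" "\<And>x y. e x y = e y x"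
    "\<And>x y. x \<in> carrier K \<Longrightarrow> y \<in> carrier K \<Longrightarrow> e x y = 0 \<longleftrightarrow> x = y"
    "\<And>x y z. x \<in> carrier K \<Longrightarrow> y \<in> carrier K \<Longrightarrow> z \<in> carrier K \<Longrightarrow> e x z \<le> e x y + e y z"
    "\<And>x y z. x \<in> carrier K \<Longrightarrow> y \<in> carrier K \<Longrightarrow> z \<in> carrier K \<Longrightarrow> e (z \<otimes>\<^bsub>K\<^esub> x) (z \<otimes>\<^bsub>K\<^esub> y) = e x y"
    "\<And>x y z. x \<in> carrier K \<Longrightarrow> y \<in> carrier K \<Longrightarrow> z \<in> carrier K \<Longrightarrow> e (x \<otimes>\<^bsub>K\<^esub> z) (y \<otimes>\<^bsub>K\<^esub> z) = e x y"
    "\<And>x y. x \<in> carrier K \<Longrightarrow> y \<in> carrier K \<Longrightarrow> e x y \<le> 1"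
    "\<exists>x\<in>carrier K. \<exists>y\<in>carrier K. e x y = 1"
  shows "finite_metric_group K e"
proof -
  have "Metric_space (carrier K) e" by (rule Metric_space.intro) (fact assms)+
  then show ?thesis
    unfolding finite_metric_group_def biinvariant_metric_def using assms(1,2,7-10) by simp
qed

text \<open>An injection of the finite carrier into the naturals carries over both multiplication
  and metric. This brings constructions over other types back into the family.\<close>

lemma finite_metric_group_transport:
  fixes K :: "('c, 'm) monoid_scheme"
  assumes K: "finite_metric_group K e"
  shows "\<exists>(H, e')\<in>finite_metric_groups. \<exists>f\<in>hom K H.
    \<forall>x\<in>carrier K. \<forall>y\<in>carrier K. e' (f x) (f y) = e x y"
proof -
  note D = finite_metric_groupD[OF K]
  interpret K: group K by (rule D(1))
  obtain f :: "'c \<Rightarrow> nat" where f: "inj_on f (carrier K)"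
    using finite_imp_inj_to_nat_seg[OF D(2)] by blast
  let ?g = "inv_into (carrier K) f"
  define H where "H = \<lparr>carrier = f ` carrier K, monoid.mult = (\<lambda>a b. f (?g a \<otimes>\<^bsub>K\<^esub> ?g b)), one = f \<one>\<^bsub>K\<^esub>\<rparr>"
  \<comment> \<open>Pulled back along the inverse, the metric is nonnegative and symmetric on all
    naturals, as \<open>Metric_space\<close> demands also outside the carrier.\<close>
  define e' where "e' a b = e (?g a) (?g b)" for a b
  have g: "?g (f x) = x" if "x \<in> carrier K" for x using f that by simp
  have H: "carrier H = f ` carrier K" "\<one>\<^bsub>H\<^esub> = f \<one>\<^bsub>K\<^esub>" by (simp_all add: H_def)
  have m: "f x \<otimes>\<^bsub>H\<^esub> f y = f (x \<otimes>\<^bsub>K\<^esub> y)" if "x \<in> carrier K" "y \<in> carrier K" for x y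
    using that g by (simp add: H_def)
  have e': "e' (f x) (f y) = e x y" if "x \<in> carrier K" "y \<in> carrier K" for x y
    using that g by (simp add: e'_def)
  have gH: "group H"
  proof (rule groupI)
    show "\<exists>b\<in>carrier H. b \<otimes>\<^bsub>H\<^esub> a = \<one>\<^bsub>H\<^esub>" if "a \<in> carrier H" for a
    proof -
      obtain x where x: "x \<in> carrier K" "a = f x" using \<open>a \<in> carrier H\<close> H by auto
      then have "f (inv\<^bsub>K\<^esub> x) \<otimes>\<^bsub>H\<^esub> a = \<one>\<^bsub>H\<^esub>" using m H by simp
      then show ?thesis using x H by blast
    qed
  qed (auto simp: H m K.m_assoc)
  have fi: "f x = f y \<longleftrightarrow> x = y" if "x \<in> carrier K" "y \<in> carrier K" for x y
    using inj_on_eq_iff[OF f that] .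
  have "finite_metric_group H e'"
  proof (rule finite_metric_groupI[OF gH])
    show "finite (carrier H)" using D(2) H by simp
    show "0 \<le> e' a b" "e' a b = e' b a" for a b using D(3,4) by (simp_all add: e'_def)
    obtain x y where "x \<in> carrier K" "y \<in> carrier K" "e x y = 1" using D(10) by blast
    then show "\<exists>a\<in>carrier H. \<exists>b\<in>carrier H. e' a b = 1" using e' H by auto
  qed (use D fi in \<open>auto simp: H e' m\<close>)
  then have "(H, e') \<in> finite_metric_groups" unfolding finite_metric_groups_iff .
  moreover have "f \<in> hom K H" using m H by (intro homI) auto
  ultimately show ?thesis using e' by blast
qed

text \<open>Scaling by 1 / c and cutting at 1 preserve invariance and the triangle inequality. For c
  < 1 a pair at distance 1 stays at distance 1, so the diameter remains one.\<close>

lemma finite_metric_group_truncate: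
  assumes G: "finite_metric_group G d" and c: "c > 0" "c < 1"
  shows "finite_metric_group G (\<lambda>x y. min (d x y / c) 1)"
proof -
  note D = finite_metric_groupD[OF G]
  show ?thesis
  proof (rule finite_metric_groupI)
    show "group G" "finite (carrier G)" by (fact D)+
    show "0 \<le> min (d x y / c) 1" "min (d x y / c) 1 = min (d y x / c) 1" for x y
      using D(3)[of x y] D(4)[of x y] c by auto
    show "min (d x y / c) 1 \<le> 1" for x y by simp
    show "min (d x y / c) 1 = 0 \<longleftrightarrow> x = y" if "x \<in> carrier G" "y \<in> carrier G" for x y
      using D(5)[OF that] c by (auto simp: min_def)
    show "min (d x z / c) 1 \<le> min (d x y / c) 1 + min (d y z / c) 1"
      if "x \<in> carrier G" "y \<in> carrier G" "z \<in> carrier G" for x y z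
    proof -
      have "d x z / c \<le> d x y / c + d y z / c"
        using D(6)[OF that] c by (simp add: add_divide_distrib[symmetric] divide_right_mono)
      moreover have "0 \<le> d x y / c" "0 \<le> d y z / c" using D(3) c by simp_all
      ultimately show ?thesis by linarith
    qed
    obtain x y where "x \<in> carrier G" "y \<in> carrier G" "d x y = 1" using D(10) by blast
    then show "\<exists>x\<in>carrier G. \<exists>y\<in>carrier G. min (d x y / c) 1 = 1" using c by force
  qed (simp_all add: D(7,8))
qed

text \<open>The maximum keeps the diameter at one, and separation in either factor passes to the
  product without loss.\<close>

lemma finite_metric_group_product:
  fixes G :: "('b, 'm) monoid_scheme" and G' :: "('c, 'n) monoid_scheme"
  assumes G: "finite_metric_group G d" and G': "finite_metric_group G' d'"
  shows "finite_metric_group (G \<times>\<times> G') (\<lambda>(x, x') (y, y'). max (d x y) (d' x' y'))"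
proof -
  note D = finite_metric_groupD[OF G] and D' = finite_metric_groupD[OF G']
  interpret G': group G' by (rule D'(1))
  let ?e = "\<lambda>(x, x') (y, y'). max (d x y) (d' x' y')"
  show ?thesis
  proof (rule finite_metric_groupI)
    show "group (G \<times>\<times> G')" using D(1) D'(1) by (rule DirProd_group)
    show "finite (carrier (G \<times>\<times> G'))" using D(2) D'(2) by simp
    obtain x y where xy: "x \<in> carrier G" "y \<in> carrier G" "d x y = 1" using D(10) by blast
    have "max (d x y) (d' \<one>\<^bsub>G'\<^esub> \<one>\<^bsub>G'\<^esub>) = 1" using xy D'(9)[of "\<one>\<^bsub>G'\<^esub>" "\<one>\<^bsub>G'\<^esub>"] by simp
    then show "\<exists>z\<in>carrier (G \<times>\<times> G'). \<exists>w\<in>carrier (G \<times>\<times> G').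
        ?e z w = 1"
      using xy by (intro bexI[of _ "(x, \<one>\<^bsub>G'\<^esub>)"] bexI[of _ "(y, \<one>\<^bsub>G'\<^esub>)"]) auto
  next
    fix z w :: "'b \<times> 'c"
    obtain x x' y y' where z: "z = (x, x')" "w = (y, y')" by (metis surj_pair)
    show "0 \<le> ?e z w" using D(3)[of x y] by (simp add: z)
    show "?e z w = ?e w z"
      using D(4)[of x y] D'(4)[of x' y'] by (simp add: z)
    assume "z \<in> carrier (G \<times>\<times> G')" "w \<in> carrier (G \<times>\<times> G')"
    then have c: "x \<in> carrier G" "y \<in> carrier G" "x' \<in> carrier G'" "y' \<in> carrier G'" by (auto simp: z)
    show "?e z w \<le> 1" using D(9) D'(9) c by (simp add: z)
    show "?e z w = 0 \<longleftrightarrow> z = w"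
      using D(5)[OF c(1,2)] D'(5)[OF c(3,4)] D(3)[of x y] D'(3)[of x' y'] unfolding z prod.case prod.inject by linarith
    fix v :: "'b \<times> 'c" assume v: "v \<in> carrier (G \<times>\<times> G')"
    obtain u u' where u: "v = (u, u')" by (metis surj_pair)
    have cu: "u \<in> carrier G" "u' \<in> carrier G'" using v by (auto simp: u)
    show "?e (v \<otimes>\<^bsub>G \<times>\<times> G'\<^esub> z) (v \<otimes>\<^bsub>G \<times>\<times> G'\<^esub> w)
        = ?e z w"
      "?e (z \<otimes>\<^bsub>G \<times>\<times> G'\<^esub> v) (w \<otimes>\<^bsub>G \<times>\<times> G'\<^esub> v)
        = ?e z w"
      using c cu D(7,8) D'(7,8) by (simp_all add: z u)
    show "?e z v
        \<le> ?e z w + ?e w v"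
      using D(6)[OF c(1,2) cu(1)] D'(6)[OF c(3,4) cu(2)] unfolding z u prod.case by linarith
  qed
qed

text \<open>Extensional labels make the carrier finite and let a vanishing distance imply
  equality.\<close>

definition wreath_product :: "('b, 'm) monoid_scheme \<Rightarrow> 'x set \<Rightarrow> (('x \<Rightarrow> 'b) \<times> ('x \<Rightarrow> 'x)) monoid" where
  "wreath_product G A = \<lparr>carrier = (A \<rightarrow>\<^sub>E carrier G) \<times> carrier (BijGroup A),
    monoid.mult = (\<lambda>(x, s) (y, t). (\<lambda>a\<in>A. x (t a) \<otimes>\<^bsub>G\<^esub> y a, s \<otimes>\<^bsub>BijGroup A\<^esub> t)),
    one = (\<lambda>a\<in>A. \<one>\<^bsub>G\<^esub>, \<one>\<^bsub>BijGroup A\<^esub>)\<rparr>"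

lemma wreath_product_simps:
  "carrier (wreath_product G A) = (A \<rightarrow>\<^sub>E carrier G) \<times> carrier (BijGroup A)"
  "(x, s) \<otimes>\<^bsub>wreath_product G A\<^esub> (y, t) = (\<lambda>a\<in>A. x (t a) \<otimes>\<^bsub>G\<^esub> y a, s \<otimes>\<^bsub>BijGroup A\<^esub> t)"
  "\<one>\<^bsub>wreath_product G A\<^esub> = (\<lambda>a\<in>A. \<one>\<^bsub>G\<^esub>, \<one>\<^bsub>BijGroup A\<^esub>)"
  by (simp_all add: wreath_product_def)

lemma group_wreath_product:
  assumes "group G" shows "group (wreath_product G A)"
proof -
  interpret G: group G by fact
  interpret B: group "BijGroup A" by (rule group_BijGroup)
  have o: "\<one>\<^bsub>BijGroup A\<^esub> a = a" if "a \<in> A" for a using that by (simp add: BijGroup_def)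
  show ?thesis
  proof (rule groupI)
    show "\<one>\<^bsub>wreath_product G A\<^esub> \<in> carrier (wreath_product G A)" by (auto simp: wreath_product_simps)
    fix z assume "z \<in> carrier (wreath_product G A)"
    then obtain x s where z: "z = (x, s)" "x \<in> A \<rightarrow>\<^sub>E carrier G" "s \<in> carrier (BijGroup A)"
      by (auto simp: wreath_product_simps)
    have xc: "x a \<in> carrier G" if "a \<in> A" for a using z that by auto
    show "\<one>\<^bsub>wreath_product G A\<^esub> \<otimes>\<^bsub>wreath_product G A\<^esub> z = z"
    proof -
      have "(\<lambda>a\<in>A. (\<lambda>a\<in>A. \<one>\<^bsub>G\<^esub>) (s a) \<otimes>\<^bsub>G\<^esub> x a) = x"
      proof
        fix a show "(\<lambda>a\<in>A. (\<lambda>a\<in>A. \<one>\<^bsub>G\<^esub>) (s a) \<otimes>\<^bsub>G\<^esub> x a) a = x a"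
          using xc BijGroup_apply(1)[OF z(3)] PiE_arb[OF z(2)] by (cases "a \<in> A") simp_all
      qed
      then show ?thesis using z by (simp add: wreath_product_simps)
    qed
    let ?t = "inv\<^bsub>BijGroup A\<^esub> s"
    have tA: "?t a \<in> A" if "a \<in> A" for a using BijGroup_apply(1)[OF B.inv_closed[OF z(3)] that] .
    have "(\<lambda>a\<in>A. inv\<^bsub>G\<^esub> (x (?t a)), ?t) \<in> carrier (wreath_product G A)"
      using xc tA z by (auto simp: wreath_product_simps)
    moreover have "(\<lambda>a\<in>A. inv\<^bsub>G\<^esub> (x (?t a)), ?t) \<otimes>\<^bsub>wreath_product G A\<^esub> z = \<one>\<^bsub>wreath_product G A\<^esub>"
      using z xc BijGroup_apply(1,3)[OF z(3)] by (auto simp: wreath_product_simps fun_eq_iff)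
    ultimately show "\<exists>w\<in>carrier (wreath_product G A). w \<otimes>\<^bsub>wreath_product G A\<^esub> z = \<one>\<^bsub>wreath_product G A\<^esub>"
      by blast
    fix w assume "w \<in> carrier (wreath_product G A)"
    then obtain y t where w: "w = (y, t)" "y \<in> A \<rightarrow>\<^sub>E carrier G" "t \<in> carrier (BijGroup A)"
      by (auto simp: wreath_product_simps)
    have yc: "y a \<in> carrier G" if "a \<in> A" for a using w that by auto
    note ta = BijGroup_apply(1)[OF w(3)]
    show "z \<otimes>\<^bsub>wreath_product G A\<^esub> w \<in> carrier (wreath_product G A)"
      using z w xc yc ta by (auto simp: wreath_product_simps)
    fix v assume "v \<in> carrier (wreath_product G A)"
    then obtain u r where v: "v = (u, r)" "u \<in> A \<rightarrow>\<^sub>E carrier G" "r \<in> carrier (BijGroup A)"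
      by (auto simp: wreath_product_simps)
    have uc: "u a \<in> carrier G" if "a \<in> A" for a using v that by auto
    note ra = BijGroup_apply(1)[OF v(3)]
    have "(\<lambda>a\<in>A. (\<lambda>a\<in>A. x (t a) \<otimes>\<^bsub>G\<^esub> y a) (r a) \<otimes>\<^bsub>G\<^esub> u a)
        = (\<lambda>a\<in>A. x ((t \<otimes>\<^bsub>BijGroup A\<^esub> r) a) \<otimes>\<^bsub>G\<^esub> (\<lambda>a\<in>A. y (r a) \<otimes>\<^bsub>G\<^esub> u a) a)"
      by (rule restrict_ext)
        (simp add: BijGroup_apply(2)[OF w(3) v(3)] ra ta xc yc uc G.m_assoc)
    then show "z \<otimes>\<^bsub>wreath_product G A\<^esub> w \<otimes>\<^bsub>wreath_product G A\<^esub> v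
        = z \<otimes>\<^bsub>wreath_product G A\<^esub> (w \<otimes>\<^bsub>wreath_product G A\<^esub> v)"
      using z w v by (simp add: wreath_product_simps B.m_assoc)
  qed
qed

text \<open>A mean over the points. Disagreement of the permutations costs 1, the largest value that
  a label distance of a metric of diameter one can take, so each summand obeys the triangle
  inequality.\<close>

definition wreath_dist :: "('b \<Rightarrow> 'b \<Rightarrow> real) \<Rightarrow> 'x set \<Rightarrow> ('x \<Rightarrow> 'b) \<times> ('x \<Rightarrow> 'x) \<Rightarrow> ('x \<Rightarrow> 'b) \<times> ('x \<Rightarrow> 'x) \<Rightarrow> real" where
  "wreath_dist d A = (\<lambda>(x, s) (y, t). (\<Sum>a\<in>A. if s a = t a then d (x a) (y a) else 1) / real (card A))"

text \<open>Left invariance holds summand by summand, because permutations are injective; right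
  invariance reindexes the sum along the permutation of the right factor.\<close>

lemma finite_metric_group_wreath:
  fixes G :: "('b, 'm) monoid_scheme" and A :: "'x set"
  assumes G: "finite_metric_group G d" and A: "finite A" "A \<noteq> {}"
  shows "finite_metric_group (wreath_product G A) (wreath_dist d A)"
proof -
  note D = finite_metric_groupD[OF G]
  interpret G: group G by (rule D(1))
  interpret B: group "BijGroup A" by (rule group_BijGroup)
  have cA: "real (card A) > 0" using A by (simp add: card_gt_0_iff)
  let ?W = "wreath_product G A" and ?e = "wreath_dist d A"
  have sb: "bij_betw s A A" if "s \<in> carrier (BijGroup A)" for s
    using that by (simp add: BijGroup_def Bij_def)
  show ?thesis
  proof (rule finite_metric_groupI)
    show "group ?W" using D(1) by (rule group_wreath_product)
    have "carrier (BijGroup A) \<subseteq> A \<rightarrow>\<^sub>E A" by (auto simp: BijGroup_def Bij_def bij_betw_def PiE_def)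
    then have "finite (carrier (BijGroup A))" by (rule finite_subset) (simp add: A finite_PiE)
    then show "finite (carrier ?W)" using A D(2) by (simp add: wreath_product_simps finite_PiE)
    obtain x y where xy: "x \<in> carrier G" "y \<in> carrier G" "d x y = 1" using D(10) by blast
    have "?e (\<lambda>a\<in>A. x, \<one>\<^bsub>BijGroup A\<^esub>) (\<lambda>a\<in>A. y, \<one>\<^bsub>BijGroup A\<^esub>) = 1"
      using xy cA by (simp add: wreath_dist_def)
    moreover have "(\<lambda>a\<in>A. x, \<one>\<^bsub>BijGroup A\<^esub>) \<in> carrier ?W" "(\<lambda>a\<in>A. y, \<one>\<^bsub>BijGroup A\<^esub>) \<in> carrier ?W"
      using xy by (auto simp: wreath_product_simps)
    ultimately show "\<exists>z\<in>carrier ?W. \<exists>w\<in>carrier ?W. ?e z w = 1" by blast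
  next
    fix z w :: "('x \<Rightarrow> 'b) \<times> ('x \<Rightarrow> 'x)"
    obtain x s y t where z: "z = (x, s)" "w = (y, t)" by (metis surj_pair)
    show "0 \<le> ?e z w" unfolding z wreath_dist_def prod.case
      using D(3) by (intro divide_nonneg_nonneg sum_nonneg) auto
    show "?e z w = ?e w z"
      unfolding z wreath_dist_def prod.case using D(4) by (intro arg_cong2[where f = "(/)"] sum.cong) auto
    assume "z \<in> carrier ?W" "w \<in> carrier ?W"
    then have c: "x \<in> A \<rightarrow>\<^sub>E carrier G" "s \<in> carrier (BijGroup A)" "y \<in> A \<rightarrow>\<^sub>E carrier G" "t \<in> carrier (BijGroup A)"
      by (auto simp: z wreath_product_simps)
    have xc: "x a \<in> carrier G" "y a \<in> carrier G" if "a \<in> A" for a using c that by auto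
    have "(\<Sum>a\<in>A. if s a = t a then d (x a) (y a) else 1) \<le> (\<Sum>a\<in>A. 1)"
      using D(9) xc by (intro sum_mono) auto
    then show "?e z w \<le> 1" using cA by (simp add: z wreath_dist_def)
    show "?e z w = 0 \<longleftrightarrow> z = w"
    proof
      assume "?e z w = 0"
      then have "(\<Sum>a\<in>A. if s a = t a then d (x a) (y a) else 1) = 0" using cA by (simp add: z wreath_dist_def)
      then have 0: "(if s a = t a then d (x a) (y a) else 1) = 0" if "a \<in> A" for a
        using that A D(3) by (subst (asm) sum_nonneg_eq_0_iff) auto
      have st: "s a = t a" if "a \<in> A" for a using 0[OF that] by (simp split: if_splits)
      have xy: "x a = y a" if "a \<in> A" for a using 0[OF that] st[OF that] D(5)[OF xc[OF that]] by simp
      have "x = y" using c(1,3) xy by (rule PiE_ext)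
      moreover have "s \<in> extensional A" "t \<in> extensional A" using c by (simp_all add: BijGroup_def Bij_def)
      then have "s = t" using st by (rule extensionalityI)
      ultimately show "z = w" by (simp add: z)
    next
      assume "z = w"
      then show "?e z w = 0" using D(5) xc by (simp add: z wreath_dist_def)
    qed
    fix v :: "('x \<Rightarrow> 'b) \<times> ('x \<Rightarrow> 'x)" assume "v \<in> carrier ?W"
    then obtain u r where v: "v = (u, r)" and cu: "u \<in> A \<rightarrow>\<^sub>E carrier G" "r \<in> carrier (BijGroup A)"
      by (auto simp: wreath_product_simps)
    have uc: "u a \<in> carrier G" if "a \<in> A" for a using cu that by auto
    have sA: "s a \<in> A" "t a \<in> A" "r a \<in> A" if "a \<in> A" for a
      using BijGroup_apply(1)[OF c(2) that] BijGroup_apply(1)[OF c(4) that] BijGroup_apply(1)[OF cu(2) that]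
      by simp_all
    have ri: "r a = r b \<longleftrightarrow> a = b" if "a \<in> A" "b \<in> A" for a b
      using inj_on_eq_iff[OF bij_betw_imp_inj_on[OF sb[OF cu(2)]] that] .
    show "?e (v \<otimes>\<^bsub>?W\<^esub> z) (v \<otimes>\<^bsub>?W\<^esub> w) = ?e z w"
      unfolding v z wreath_product_simps wreath_dist_def prod.case
      by (intro arg_cong2[where f = "(/)"] sum.cong refl)
        (simp add: BijGroup_apply(2)[OF cu(2) c(2)] BijGroup_apply(2)[OF cu(2) c(4)] ri sA D(7) xc uc)
    have "?e (z \<otimes>\<^bsub>?W\<^esub> v) (w \<otimes>\<^bsub>?W\<^esub> v)
        = (\<Sum>a\<in>A. if s (r a) = t (r a) then d (x (r a)) (y (r a)) else 1) / real (card A)"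
      unfolding v z wreath_product_simps wreath_dist_def prod.case
      by (intro arg_cong2[where f = "(/)"] sum.cong refl)
        (simp add: BijGroup_apply(2)[OF c(2) cu(2)] BijGroup_apply(2)[OF c(4) cu(2)] sA D(8) xc uc)
    also have "\<dots> = ?e z w"
      unfolding z wreath_dist_def prod.case
        sum.reindex_bij_betw[OF sb[OF cu(2)], of "\<lambda>a. if s a = t a then d (x a) (y a) else 1"] ..
    finally show "?e (z \<otimes>\<^bsub>?W\<^esub> v) (w \<otimes>\<^bsub>?W\<^esub> v) = ?e z w" .
    have "(\<Sum>a\<in>A. if s a = r a then d (x a) (u a) else 1) \<le> (\<Sum>a\<in>A. (if s a = t a then d (x a) (y a) else 1)
        + (if t a = r a then d (y a) (u a) else 1))"
    proof (rule sum_mono)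
      fix a assume a: "a \<in> A"
      show "(if s a = r a then d (x a) (u a) else 1) \<le> (if s a = t a then d (x a) (y a) else 1)
        + (if t a = r a then d (y a) (u a) else 1)"
        using D(6)[OF xc[OF a] uc[OF a]] D(9)[OF xc(1)[OF a] uc[OF a]] D(3)[of "x a" "y a"] D(3)[of "y a" "u a"]
        by (simp split: if_split)
    qed
    then show "?e z v \<le> ?e z w + ?e w v"
      unfolding z v wreath_dist_def prod.case add_divide_distrib[symmetric] sum.distrib[symmetric]
      by (rule divide_right_mono) simp
  qed
qed

section \<open>Permanence for finite groups with bi-invariant metrics\<close>

lemma amplify_finite_metric_groups:
  assumes c: "c > 0" and eps: "\<epsilon> > 0"
  shows "\<exists>\<delta>>0. \<forall>(G, d)\<in>finite_metric_groups. \<exists>(H, e)\<in>finite_metric_groups. \<exists>P.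
    amplification G d H e \<delta> \<epsilon> c (1/2) P"
\<comment> \<open>The amplification is the identity map into the same group with a new metric: d < c
  \<open>\<epsilon>\<close> gives d / c < \<open>\<epsilon>\<close>, and the bound
  \<open>\<epsilon>\<close> covers the case in which d is kept.\<close>
proof (rule exI[of _ "min \<epsilon> (c * \<epsilon>)"], rule conjI)
  let ?\<delta> = "min \<epsilon> (c * \<epsilon>)"
  show "?\<delta> > 0" using c eps by simp
  have "\<exists>(H, e)\<in>finite_metric_groups. \<exists>P. amplification G d H e ?\<delta> \<epsilon> c (1/2) P"
    if Gd: "(G, d) \<in> finite_metric_groups" for G d
  proof -
    have G: "finite_metric_group G d" using Gd unfolding finite_metric_groups_iff .
    note D = finite_metric_groupD[OF G]
    interpret G: group G by (rule D(1))
    \<comment> \<open>For \<open>c\<close> at least 1 no element lies beyond \<open>c\<close>, as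
      the diameter is one, so the metric can stay as it is.\<close>
    define e where "e = (if c < 1 then (\<lambda>x y. min (d x y / c) 1) else d)"
    have "finite_metric_group G e" using finite_metric_group_truncate[OF G c] G by (simp add: e_def)
    then have m: "(G, e) \<in> finite_metric_groups" unfolding finite_metric_groups_iff .
    have h: "(\<lambda>x. x) \<in> hom G G" by (simp add: hom_def)
    have 1: "e x y < \<epsilon>" if "d x y < min \<epsilon> (c * \<epsilon>)" for x y
    proof -
      have "d x y / c < \<epsilon>" using that c by (simp add: field_simps)
      then show ?thesis using that by (simp add: e_def min_less_iff_disj)
    qed
    have 2: "e x \<one>\<^bsub>G\<^esub> > 1/2" if "x \<in> carrier G" "d x \<one>\<^bsub>G\<^esub> > c" for x
    proof -
      have "c < 1" using D(9)[OF that(1) G.one_closed] that(2) by simp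
      then show ?thesis using that c by (simp add: e_def)
    qed
    have "amplification G d G e ?\<delta> \<epsilon> c (1/2) (\<lambda>x. x)"
      unfolding amplification_def using h 1 2 by blast
    then show ?thesis using m by blast
  qed
  then show "\<forall>(G, d)\<in>finite_metric_groups. \<exists>(H, e)\<in>finite_metric_groups. \<exists>P.
      amplification G d H e ?\<delta> \<epsilon> c (1/2) P" by blast
qed

lemma product_finite_metric_groups:
  assumes eps: "\<epsilon> > 0"
  shows "\<exists>\<delta>>0. \<forall>(G, d)\<in>finite_metric_groups. \<forall>(G', d')\<in>finite_metric_groups.
    \<exists>(H, e)\<in>finite_metric_groups. \<exists>P. joining G d G' d' H e \<delta> \<epsilon> (1/4) (1/2) (1/4) P"
proof (rule exI[of _ \<epsilon>], rule conjI[OF eps])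
  have "\<exists>(H, e)\<in>finite_metric_groups. \<exists>P. joining G d G' d' H e \<epsilon> \<epsilon> (1/4) (1/2) (1/4) P"
    if "(G, d) \<in> finite_metric_groups" "(G', d') \<in> finite_metric_groups" for G d G' d'
  proof -
    have G: "finite_metric_group G d" "finite_metric_group G' d'" using that unfolding finite_metric_groups_iff .
    interpret G: group G by (rule finite_metric_groupD(1)[OF G(1)])
    interpret G': group G' by (rule finite_metric_groupD(1)[OF G(2)])
    obtain H e P where H: "(H, e) \<in> finite_metric_groups" and P: "P \<in> hom (G \<times>\<times> G') H"
      and e: "\<And>z w. z \<in> carrier (G \<times>\<times> G') \<Longrightarrow> w \<in> carrier (G \<times>\<times> G') \<Longrightarrow>
        e (P z) (P w) = (\<lambda>(x, x') (y, y'). max (d x y) (d' x' y')) z w"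
      using finite_metric_group_transport[OF finite_metric_group_product[OF G]] by blast
    have gH: "group H" using H unfolding finite_metric_groups_iff by (rule finite_metric_groupD(1))
    have P1: "P (\<one>\<^bsub>G\<^esub>, \<one>\<^bsub>G'\<^esub>) = \<one>\<^bsub>H\<^esub>"
      using hom_one[OF P DirProd_group[OF G.is_group G'.is_group] gH] by simp
    have 1: "e (P (x, x')) (P (y, y')) = max (d x y) (d' x' y')"
      if "x \<in> carrier G" "y \<in> carrier G" "x' \<in> carrier G'" "y' \<in> carrier G'" for x y x' y'
      using that by (simp add: e)
    have 2: "e (P (x, x')) \<one>\<^bsub>H\<^esub> = max (d x \<one>\<^bsub>G\<^esub>) (d' x' \<one>\<^bsub>G'\<^esub>)"
      if "x \<in> carrier G" "x' \<in> carrier G'" for x x'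
      using that unfolding P1[symmetric] by (simp add: 1)
    have "joining G d G' d' H e \<epsilon> \<epsilon> (1/4) (1/2) (1/4) P"
      unfolding joining_def using P by (auto simp: 1 2)
    then show ?thesis using H by blast
  qed
  then show "\<forall>(G, d)\<in>finite_metric_groups. \<forall>(G', d')\<in>finite_metric_groups.
      \<exists>(H, e)\<in>finite_metric_groups. \<exists>P. joining G d G' d' H e \<epsilon> \<epsilon> (1/4) (1/2) (1/4) P" by blast
qed

lemma wreath_finite_metric_groups:
  assumes eps: "\<epsilon> > 0"
  shows "\<exists>\<delta>>0. \<forall>(G, d)\<in>finite_metric_groups. \<forall>A :: nat set. finite A \<and> A \<noteq> {} \<longrightarrow>
    (\<exists>(H, e)\<in>finite_metric_groups. \<exists>P. wreath_map G d A H e \<delta> \<epsilon> (1/2) (1/4) P)"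
\<comment> \<open>Half of \<open>\<epsilon>\<close> pays for the good points, the other half for the
  proportion of bad ones, whose summands are at most 1.\<close>
proof (rule exI[of _ "\<epsilon> / 2"], rule conjI)
  show "\<epsilon> / 2 > 0" using eps by simp
  have "\<exists>(H, e)\<in>finite_metric_groups. \<exists>P. wreath_map G d A H e (\<epsilon> / 2) \<epsilon> (1/2) (1/4) P"
    if Gd: "(G, d) \<in> finite_metric_groups" and A: "finite A" "A \<noteq> {}" for G d and A :: "nat set"
  proof -
    have G: "finite_metric_group G d" using Gd unfolding finite_metric_groups_iff .
    note D = finite_metric_groupD[OF G]
    interpret G: group G by (rule D(1))
    interpret B: group "BijGroup A" by (rule group_BijGroup)
    have cA: "real (card A) > 0" using A by (simp add: card_gt_0_iff)
    obtain H e f where H: "(H, e) \<in> finite_metric_groups" and f: "f \<in> hom (wreath_product G A) H"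
      and e: "\<And>z w. z \<in> carrier (wreath_product G A) \<Longrightarrow> w \<in> carrier (wreath_product G A) \<Longrightarrow>
        e (f z) (f w) = wreath_dist d A z w"
      using finite_metric_group_transport[OF finite_metric_group_wreath[OF G A]] by blast
    have gH: "group H" using H unfolding finite_metric_groups_iff by (rule finite_metric_groupD(1))
    \<comment> \<open>\<open>wreath_hom\<close> speaks of plain label functions, the abstract wreath
      product of extensional ones; the restriction passes from the former to the latter.\<close>
    define P where "P x s = f (restrict x A, s)" for x s
    have c: "(restrict x A, s) \<in> carrier (wreath_product G A)"
      if "x \<in> A \<rightarrow> carrier G" "s \<in> carrier (BijGroup A)" for x s
      using that by (auto simp: wreath_product_simps)
    have eP: "e (P x s) (P y t) = (\<Sum>a\<in>A. if s a = t a then d (x a) (y a) else 1) / real (card A)"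
      if "x \<in> A \<rightarrow> carrier G" "s \<in> carrier (BijGroup A)" "y \<in> A \<rightarrow> carrier G" "t \<in> carrier (BijGroup A)"
      for x s y t
      unfolding P_def e[OF c[OF that(1,2)] c[OF that(3,4)]] wreath_dist_def prod.case
      by (intro arg_cong2[where f = "(/)"] sum.cong) auto
    have hom: "wreath_hom G A H P"
      unfolding wreath_hom_def
    proof (intro conjI ballI)
      fix x s assume x: "x \<in> A \<rightarrow> carrier G" and s: "s \<in> carrier (BijGroup A)"
      show "P x s \<in> carrier H" unfolding P_def using f c[OF x s] by (rule hom_in_carrier)
      fix y t assume y: "y \<in> A \<rightarrow> carrier G" and t: "t \<in> carrier (BijGroup A)"
      have "(\<lambda>a\<in>A. restrict x A (t a) \<otimes>\<^bsub>G\<^esub> restrict y A a) = (\<lambda>a\<in>A. x (t a) \<otimes>\<^bsub>G\<^esub> y a)"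
        using BijGroup_apply(1)[OF t] by (intro restrict_ext) simp
      then show "P (\<lambda>a. x (t a) \<otimes>\<^bsub>G\<^esub> y a) (s \<otimes>\<^bsub>BijGroup A\<^esub> t) = P x s \<otimes>\<^bsub>H\<^esub> P y t"
        unfolding P_def hom_mult[OF f c[OF x s] c[OF y t], symmetric] wreath_product_simps by simp
    qed
    have P1: "P (\<lambda>_. \<one>\<^bsub>G\<^esub>) \<one>\<^bsub>BijGroup A\<^esub> = \<one>\<^bsub>H\<^esub>" by (rule wreath_hom_one[OF hom G.is_group gH])
    have up: "e (P x s) (P y t) < \<epsilon>"
      if x: "x \<in> A \<rightarrow> carrier G" and y: "y \<in> A \<rightarrow> carrier G"
        and s: "s \<in> carrier (BijGroup A)" and t: "t \<in> carrier (BijGroup A)"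
        and l: "real (card {a \<in> A. \<not> (s a = t a \<and> d (x a) (y a) < \<epsilon> / 2)}) < \<epsilon> / 2 * real (card A)"
      for x y s t
    proof -
      let ?B = "{a \<in> A. \<not> (s a = t a \<and> d (x a) (y a) < \<epsilon> / 2)}"
      have "(\<Sum>a\<in>A. if s a = t a then d (x a) (y a) else 1) \<le> (\<Sum>a\<in>A. \<epsilon> / 2 + (if a \<in> ?B then 1 else 0))"
      proof (rule sum_mono)
        fix a assume a: "a \<in> A"
        then show "(if s a = t a then d (x a) (y a) else 1) \<le> \<epsilon> / 2 + (if a \<in> ?B then 1 else 0)"
          using D(9)[of "x a" "y a"] x y eps by (auto simp: Pi_iff)
      qed
      also have "\<dots> = \<epsilon> / 2 * real (card A) + real (card ?B)"
        using A by (simp add: sum.distrib sum.If_cases Int_def conj_commute)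
      also have "\<dots> < \<epsilon> * real (card A)" using l by linarith
      finally show ?thesis unfolding eP[OF x s y t] using cA by (simp add: divide_less_eq)
    qed
    have low: "e (P x \<one>\<^bsub>BijGroup A\<^esub>) \<one>\<^bsub>H\<^esub> > 1/4"
      if x: "x \<in> A \<rightarrow> carrier G" and l: "2 * card {a \<in> A. d (x a) \<one>\<^bsub>G\<^esub> > 1/2} \<ge> card A" for x
    proof -
      let ?C = "{a \<in> A. d (x a) \<one>\<^bsub>G\<^esub> > 1/2}"
      have C0: "?C \<noteq> {}" using l cA by (metis card.empty mult_0_right not_le of_nat_0_less_iff)
      have "1/2 * real (card ?C) = (\<Sum>a\<in>?C. 1/2)" by simp
      also have "\<dots> < (\<Sum>a\<in>?C. d (x a) \<one>\<^bsub>G\<^esub>)" using C0 A by (intro sum_strict_mono) auto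
      also have "\<dots> \<le> (\<Sum>a\<in>A. d (x a) \<one>\<^bsub>G\<^esub>)" using A D(3) by (intro sum_mono2) auto
      finally have "1/4 * real (card A) < (\<Sum>a\<in>A. d (x a) \<one>\<^bsub>G\<^esub>)" using l by linarith
      moreover have "e (P x \<one>\<^bsub>BijGroup A\<^esub>) \<one>\<^bsub>H\<^esub> = (\<Sum>a\<in>A. d (x a) \<one>\<^bsub>G\<^esub>) / real (card A)"
        unfolding P1[symmetric] using x by (simp add: eP)
      ultimately show ?thesis using cA by (simp add: less_divide_eq)
    qed
    have "wreath_map G d A H e (\<epsilon> / 2) \<epsilon> (1/2) (1/4) P"
      unfolding wreath_map_def using hom up low by blast
    then show ?thesis using H by blast
  qed
  then show "\<forall>(G, d)\<in>finite_metric_groups. \<forall>A :: nat set. finite A \<and> A \<noteq> {} \<longrightarrow>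
      (\<exists>(H, e)\<in>finite_metric_groups. \<exists>P. wreath_map G d A H e (\<epsilon> / 2) \<epsilon> (1/2) (1/4) P)" by blast
qed

lemma permanence_finite_metric_groups: "permanence_family finite_metric_groups (1/2) (1/4) (1/4)"
proof (rule permanence_family.intro)
  show "group G" if "(G, d) \<in> finite_metric_groups" for G d
    using that unfolding finite_metric_groups_iff by (rule finite_metric_groupD(1))
qed (simp, erule (1) amplify_finite_metric_groups, erule product_finite_metric_groups,
    erule wreath_finite_metric_groups)

section \<open>The four classes of groups\<close>

lemma permanence_family_semidirect_product:
  fixes \<Gamma> :: "('g, 'm) monoid_scheme" and \<Delta> :: "('d, 'n) monoid_scheme"
  assumes "permanence_family \<G> c0 c1 c2"
    and C: "\<And>X :: 'l monoid. C X \<longleftrightarrow> approximable \<G> X"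
    and "approximable \<G> \<Gamma>" "approximable \<G> \<Delta>" and act: "sofic_action C \<Gamma> \<Delta> \<beta>"
  shows "approximable \<G> (semidirect_product \<Delta> \<Gamma> \<beta>)"
proof (rule permanence_family.semidirect_product_approximable)
  \<comment> \<open>The class enters \<open>sofic_action\<close> as an unapplied predicate, so the
    pointwise equivalence is turned into an equation.\<close>
  have "C = approximable \<G>" using C by blast
  then show "sofic_action (approximable \<G> :: 'l monoid \<Rightarrow> bool) \<Gamma> \<Delta> \<beta>" using act by simp
  show "group \<Delta>" using assms(4) by (simp add: approximable_def)
qed (fact assms)+

theorem corollary5p2:
  fixes \<Gamma> :: "('g, 'm) monoid_scheme" and \<Delta> :: "('d, 'n) monoid_scheme"
    and \<beta> :: "'g \<Rightarrow> 'd \<Rightarrow> 'd"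
  shows
    "(sofic_group \<Gamma> \<and> sofic_group \<Delta> \<and>
        sofic_action (sofic_group :: 'l monoid \<Rightarrow> bool) \<Gamma> \<Delta> \<beta> \<longrightarrow>
        sofic_group (semidirect_product \<Delta> \<Gamma> \<beta>)) \<and>
     (linear_sofic_group TYPE('k::field) \<Gamma> \<and> linear_sofic_group TYPE('k) \<Delta> \<and>
        sofic_action (linear_sofic_group TYPE('k) :: 'l monoid \<Rightarrow> bool) \<Gamma> \<Delta> \<beta> \<longrightarrow>
        linear_sofic_group TYPE('k) (semidirect_product \<Delta> \<Gamma> \<beta>)) \<and>
     (hyperlinear_group \<Gamma> \<and> hyperlinear_group \<Delta> \<and>
        sofic_action (hyperlinear_group :: 'l monoid \<Rightarrow> bool) \<Gamma> \<Delta> \<beta> \<longrightarrow>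
        hyperlinear_group (semidirect_product \<Delta> \<Gamma> \<beta>)) \<and>
     (weakly_sofic_group \<Gamma> \<and> weakly_sofic_group \<Delta> \<and>
        sofic_action (weakly_sofic_group :: 'l monoid \<Rightarrow> bool) \<Gamma> \<Delta> \<beta> \<longrightarrow>
        weakly_sofic_group (semidirect_product \<Delta> \<Gamma> \<beta>))"
proof (intro conjI impI; elim conjE)
  assume "sofic_group \<Gamma>" "sofic_group \<Delta>" "sofic_action (sofic_group :: 'l monoid \<Rightarrow> bool) \<Gamma> \<Delta> \<beta>"
  then show "sofic_group (semidirect_product \<Delta> \<Gamma> \<beta>)"
    \<comment> \<open>The definition is unfolded at these three groups only; the class inside the
      action, over the type \<open>'l\<close>, stays folded, as
      \<open>permanence_family_semidirect_product\<close> expects.\<close>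
    unfolding sofic_group_def[of \<Gamma>] sofic_group_def[of \<Delta>] sofic_group_def[of "semidirect_product \<Delta> \<Gamma> \<beta>"]
    by (rule permanence_family_semidirect_product[OF permanence_Sym sofic_group_def])
next
  assume "linear_sofic_group TYPE('k) \<Gamma>" "linear_sofic_group TYPE('k) \<Delta>"
    "sofic_action (linear_sofic_group TYPE('k) :: 'l monoid \<Rightarrow> bool) \<Gamma> \<Delta> \<beta>"
  then show "linear_sofic_group TYPE('k) (semidirect_product \<Delta> \<Gamma> \<beta>)"
    unfolding linear_sofic_group_def[of _ \<Gamma>] linear_sofic_group_def[of _ \<Delta>]
      linear_sofic_group_def[of _ "semidirect_product \<Delta> \<Gamma> \<beta>"]
    by (rule permanence_family_semidirect_product[OF permanence_GL linear_sofic_group_def])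
next
  assume "hyperlinear_group \<Gamma>" "hyperlinear_group \<Delta>"
    "sofic_action (hyperlinear_group :: 'l monoid \<Rightarrow> bool) \<Gamma> \<Delta> \<beta>"
  then show "hyperlinear_group (semidirect_product \<Delta> \<Gamma> \<beta>)"
    unfolding hyperlinear_group_def[of \<Gamma>] hyperlinear_group_def[of \<Delta>]
      hyperlinear_group_def[of "semidirect_product \<Delta> \<Gamma> \<beta>"]
    by (rule permanence_family_semidirect_product[OF permanence_unitary hyperlinear_group_def])
next
  assume "weakly_sofic_group \<Gamma>" "weakly_sofic_group \<Delta>"
    "sofic_action (weakly_sofic_group :: 'l monoid \<Rightarrow> bool) \<Gamma> \<Delta> \<beta>"
  then show "weakly_sofic_group (semidirect_product \<Delta> \<Gamma> \<beta>)"
    unfolding weakly_sofic_group_def[of \<Gamma>] weakly_sofic_group_def[of \<Delta>]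
      weakly_sofic_group_def[of "semidirect_product \<Delta> \<Gamma> \<beta>"]
    by (rule permanence_family_semidirect_product[OF permanence_finite_metric_groups weakly_sofic_group_def])
qed

end
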